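(* Let $n$ denote an element of $\mathbb{Z}_{\ge 1}$ and $\varepsilon$ an element of $\{\pm1\}$. The irreducible Seifert form pairs $(H_{\mathbb R},L)$ are, up to isomorphism, exactly those of the following types. For all admissible parameters listed, the type exists and is irreducible, and it is determined uniquely (up to isomorphism) by the indicated properties, where $M$ is the monodromy of $L$, $N$ its nilpotent part, and "Jordan blocks" are those of $M$ on $H_{\mathbb C}$. (1) $\mathrm{Seif}(\lambda,1,n,\varepsilon)$ with ($\lambda=1$ and $n$ odd) or ($\lambda=-1$ and $n$ even): $\dim H_{\mathbb R}=n$, $H_{\mathbb C}=H_\lambda$, one Jordan block, and $L(a,N^{n-1}a)\in\varepsilon\cdot\mathbb{R}_{>0}$ for each $a\in H_{\mathbb R}\setminus \mathrm{Im}\,N$. (2) $\mathrm{Seif}(\lambda,2,n)$ with ($\lambda=1$ and $n$ even) or ($\lambda=-1$ and $n$ odd): $\dim H_{\mathbb R}=2n$, $H_{\mathbb C}=H_\lambda$, two Jordan blocks of size $n$. (3) $\mathrm{Seif}(\lambda,2,n,\zeta)$ with $\lambda,\zeta\in S^1\setminus\{\pm1\}$ and $\zeta^2=\overline{\lambda}\cdot(-1)^{n+1}$: $\dim H_{\mathbb R}=2n$, $H_{\mathbb C}=H_\lambda\oplus H_{\overline\lambda}$, two Jordan blocks, and $L(a,N^{n-1}\overline a)\in\zeta\cdot\mathbb{R}_{>0}$ for each $a\in H_\lambda\setminus\mathrm{Im}\,N$. Here $\mathrm{Seif}(\lambda,2,n,\zeta)\cong\mathrm{Seif}(\overline\lambda,2,n,\overline\zeta)$.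 (4) $\mathrm{Seif}(\lambda,2,n)$ with $\lambda\in\mathbb{R}_{>1}\cup\mathbb{R}_{<-1}$: $\dim H_{\mathbb R}=2n$, $H_{\mathbb C}=H_\lambda\oplus H_{\lambda^{-1}}$, two Jordan blocks of size $n$. (5) $\mathrm{Seif}(\lambda,4,n)$ with $\lambda\in\mathbb{C}$, $|\lambda|>1$, $\mathrm{Im}\,\lambda>0$: $\dim H_{\mathbb R}=4n$, $H_{\mathbb C}=H_\lambda\oplus H_{\lambda^{-1}}\oplus H_{\overline\lambda}\oplus H_{\overline\lambda^{-1}}$, four Jordan blocks of size $n$.
   Context: A Seifert form pair $(H_{\mathbb R},L)$ is a finite dimensional real vector space $H_{\mathbb R}$ with a nondegenerate bilinear form $L:H_{\mathbb R}\times H_{\mathbb R}\to\mathbb{R}$ (not necessarily symmetric or antisymmetric). It is irreducible if it is nonzero and $H_{\mathbb R}$ does not split as $V_1\oplus V_2$ with $V_1,V_2\ne\{0\}$ and $L(V_1,V_2)=L(V_2,V_1)=0$. Isomorphisms are linear isomorphisms respecting $L$. The monodromy of $L$ is the unique automorphism $M$ of $H_{\mathbb R}$ with $L(Ma,b)=L(b,a)$ for all $a,b$. $H_{\mathbb C}=H_{\mathbb R}\otimes\mathbb{C}$, and $L$, $M$ are extended complex (bi)linearly. $M=M_sM_u=M_uM_s$ is the decomposition into semisimple and unipotent part, $N=\log M_u$, and $H_\lambda=\ker(M_s-\lambda\,\mathrm{id})\subset H_{\mathbb C}$. $S^1$ is the unit circle in $\mathbb{C}$. *)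

theory Defs
  imports
    "HOL-Analysis.Finite_Function_Topology"
    "HOL-Library.FuncSet"
    "Jordan_Normal_Form.Jordan_Normal_Form"
begin

section \<open>Seifert form pairs\<close>

text \<open>
  A finite dimensional real vector space is a finite dimensional subspace \<open>V\<close> of a type of class
  \<open>real_vector\<close>; maps and forms matter on \<open>V\<close> only. Keeping the carrier a set, and not a type,
  lets the dimension vary inside a statement; the type \<open>nat \<Rightarrow>\<^sub>0 real\<close> has such subspaces of every dimension.
\<close>

definition fin_dim_space :: "'a::real_vector set \<Rightarrow> bool" where
  "fin_dim_space V \<longleftrightarrow> subspace V \<and> (\<exists>B. finite B \<and> span B = V)"

definition bilinear_on :: "'a::real_vector set \<Rightarrow> ('a \<Rightarrow> 'a \<Rightarrow> real) \<Rightarrow> bool" where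
  "bilinear_on V L \<longleftrightarrow>
     (\<forall>x\<in>V. \<forall>y\<in>V. \<forall>z\<in>V. L (x + y) z = L x z + L y z \<and> L z (x + y) = L z x + L z y) \<and>
     (\<forall>c. \<forall>x\<in>V. \<forall>y\<in>V. L (c *\<^sub>R x) y = c * L x y \<and> L x (c *\<^sub>R y) = c * L x y)"

definition nondegenerate_on :: "'a::real_vector set \<Rightarrow> ('a \<Rightarrow> 'a \<Rightarrow> real) \<Rightarrow> bool" where
  "nondegenerate_on V L \<longleftrightarrow>
     (\<forall>a\<in>V. (\<forall>b\<in>V. L a b = 0) \<longrightarrow> a = 0) \<and>
     (\<forall>b\<in>V. (\<forall>a\<in>V. L a b = 0) \<longrightarrow> b = 0)"

definition seifert_form_pair :: "'a::real_vector set \<Rightarrow> ('a \<Rightarrow> 'a \<Rightarrow> real) \<Rightarrow> bool" where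
  "seifert_form_pair V L \<longleftrightarrow> fin_dim_space V \<and> bilinear_on V L \<and> nondegenerate_on V L"

definition irreducible_pair :: "'a::real_vector set \<Rightarrow> ('a \<Rightarrow> 'a \<Rightarrow> real) \<Rightarrow> bool" where
  "irreducible_pair V L \<longleftrightarrow> V \<noteq> {0} \<and>
     \<not> (\<exists>V1 V2. subspace V1 \<and> subspace V2 \<and> V1 \<noteq> {0} \<and> V2 \<noteq> {0} \<and>
          V = {x + y | x y. x \<in> V1 \<and> y \<in> V2} \<and> V1 \<inter> V2 = {0} \<and>
          (\<forall>x\<in>V1. \<forall>y\<in>V2. L x y = 0 \<and> L y x = 0))"

definition lin_iso :: "'a::real_vector set \<Rightarrow> 'b::real_vector set \<Rightarrow> ('a \<Rightarrow> 'b) \<Rightarrow> bool" where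
  "lin_iso V W f \<longleftrightarrow> bij_betw f V W \<and>
     (\<forall>x\<in>V. \<forall>y\<in>V. f (x + y) = f x + f y) \<and> (\<forall>c. \<forall>x\<in>V. f (c *\<^sub>R x) = c *\<^sub>R f x)"

definition isomorphic_pairs ::
  "'a::real_vector set \<Rightarrow> ('a \<Rightarrow> 'a \<Rightarrow> real) \<Rightarrow> 'b::real_vector set \<Rightarrow> ('b \<Rightarrow> 'b \<Rightarrow> real) \<Rightarrow> bool"
where
  "isomorphic_pairs V L W K \<longleftrightarrow>
     (\<exists>f. lin_iso V W f \<and> (\<forall>a\<in>V. \<forall>b\<in>V. K (f a) (f b) = L a b))"

text \<open>Extensionality fixes the irrelevant values outside \<open>V\<close>, so that the monodromy is unique as a
  function on the whole type. The same device is used for \<open>ss_part\<close> and \<open>unip_part\<close> below.\<close>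

definition monodromy :: "'a::real_vector set \<Rightarrow> ('a \<Rightarrow> 'a \<Rightarrow> real) \<Rightarrow> 'a \<Rightarrow> 'a" where
  "monodromy V L = (THE M. M \<in> extensional V \<and> lin_iso V V M \<and>
     (\<forall>a\<in>V. \<forall>b\<in>V. L (M a) b = L b a))"


section \<open>Complexification\<close>

text \<open>The complexification of \<open>V\<close> is \<open>V \<times> V\<close>, the pair \<open>(u, v)\<close> standing for \<open>u + \<i> v\<close>.\<close>

definition cscale :: "complex \<Rightarrow> 'a::real_vector \<times> 'a \<Rightarrow> 'a \<times> 'a" where
  "cscale c x = (Re c *\<^sub>R fst x - Im c *\<^sub>R snd x, Re c *\<^sub>R snd x + Im c *\<^sub>R fst x)"

interpretation cplx: vector_space "cscale :: complex \<Rightarrow> 'a::real_vector \<times> 'a \<Rightarrow> 'a \<times> 'a"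
  by unfold_locales (auto simp: cscale_def algebra_simps)

definition cconj :: "'a::real_vector \<times> 'a \<Rightarrow> 'a \<times> 'a" where
  "cconj x = (fst x, - snd x)"

definition form_cplx ::
  "('a::real_vector \<Rightarrow> 'a \<Rightarrow> real) \<Rightarrow> 'a \<times> 'a \<Rightarrow> 'a \<times> 'a \<Rightarrow> complex"
where
  "form_cplx L x y = Complex (L (fst x) (fst y) - L (snd x) (snd y))
                             (L (fst x) (snd y) + L (snd x) (fst y))"

definition monodromy_cplx ::
  "'a::real_vector set \<Rightarrow> ('a \<Rightarrow> 'a \<Rightarrow> real) \<Rightarrow> 'a \<times> 'a \<Rightarrow> 'a \<times> 'a"
where
  "monodromy_cplx V L = map_prod (monodromy V L) (monodromy V L)"

definition clin_endo :: "('a::real_vector \<times> 'a) set \<Rightarrow> ('a \<times> 'a \<Rightarrow> 'a \<times> 'a) \<Rightarrow> bool" where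
  "clin_endo H f \<longleftrightarrow> (\<forall>x\<in>H. f x \<in> H) \<and>
     (\<forall>x\<in>H. \<forall>y\<in>H. f (x + y) = f x + f y) \<and> (\<forall>c. \<forall>x\<in>H. f (cscale c x) = cscale c (f x))"

text \<open>Over the complex numbers semisimple means diagonalizable, i.e. spanned by eigenvectors.\<close>

definition semisimple_on :: "('a::real_vector \<times> 'a) set \<Rightarrow> ('a \<times> 'a \<Rightarrow> 'a \<times> 'a) \<Rightarrow> bool" where
  "semisimple_on H S \<longleftrightarrow> clin_endo H S \<and> cplx.span {x \<in> H. \<exists>\<mu>. S x = cscale \<mu> x} = H"

definition unipotent_on :: "('a::real_vector \<times> 'a) set \<Rightarrow> ('a \<times> 'a \<Rightarrow> 'a \<times> 'a) \<Rightarrow> bool" where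
  "unipotent_on H U \<longleftrightarrow> clin_endo H U \<and> (\<exists>k. \<forall>x\<in>H. ((\<lambda>y. U y - y) ^^ k) x = 0)"

definition ss_unip_decomp ::
  "('a::real_vector \<times> 'a) set \<Rightarrow> ('a \<times> 'a \<Rightarrow> 'a \<times> 'a) \<Rightarrow>
   ('a \<times> 'a \<Rightarrow> 'a \<times> 'a) \<Rightarrow> ('a \<times> 'a \<Rightarrow> 'a \<times> 'a) \<Rightarrow> bool"
where
  "ss_unip_decomp H f S U \<longleftrightarrow>
     S \<in> extensional H \<and> U \<in> extensional H \<and> semisimple_on H S \<and> unipotent_on H U \<and>
     (\<forall>x\<in>H. f x = S (U x) \<and> f x = U (S x))"

definition ss_part ::
  "'a::real_vector set \<Rightarrow> ('a \<Rightarrow> 'a \<Rightarrow> real) \<Rightarrow> 'a \<times> 'a \<Rightarrow> 'a \<times> 'a"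
where
  "ss_part V L = (THE S. \<exists>U. ss_unip_decomp (V \<times> V) (monodromy_cplx V L) S U)"

definition unip_part ::
  "'a::real_vector set \<Rightarrow> ('a \<Rightarrow> 'a \<Rightarrow> real) \<Rightarrow> 'a \<times> 'a \<Rightarrow> 'a \<times> 'a"
where
  "unip_part V L = (THE U. \<exists>S. ss_unip_decomp (V \<times> V) (monodromy_cplx V L) S U)"

text \<open>The logarithm of the unipotent part \<open>U\<close>: the terms of \<open>\<Sum>k\<ge>1. (-1)^(k+1)/k (U - id)^k\<close> with
  \<open>k > dim V\<close> vanish on \<open>V \<times> V\<close>, whose complex dimension is \<open>dim V\<close>.\<close>

definition nilp_part ::
  "'a::real_vector set \<Rightarrow> ('a \<Rightarrow> 'a \<Rightarrow> real) \<Rightarrow> 'a \<times> 'a \<Rightarrow> 'a \<times> 'a"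
where
  "nilp_part V L x =
     (\<Sum>k = 1..dim V. cscale ((- 1) ^ (k + 1) / of_nat k) (((\<lambda>y. unip_part V L y - y) ^^ k) x))"

definition gen_eigenspace ::
  "'a::real_vector set \<Rightarrow> ('a \<Rightarrow> 'a \<Rightarrow> real) \<Rightarrow> complex \<Rightarrow> ('a \<times> 'a) set"
where
  "gen_eigenspace V L \<mu> = {x \<in> V \<times> V. ss_part V L x = cscale \<mu> x}"

definition direct_sum_of :: "'b::ab_group_add set \<Rightarrow> 'i set \<Rightarrow> ('i \<Rightarrow> 'b set) \<Rightarrow> bool" where
  "direct_sum_of H I W \<longleftrightarrow> finite I \<and>
     H = {\<Sum>i\<in>I. y i | y. \<forall>i\<in>I. y i \<in> W i} \<and>
     (\<forall>y. (\<forall>i\<in>I. y i \<in> W i) \<and> (\<Sum>i\<in>I. y i) = 0 \<longrightarrow> (\<forall>i\<in>I. y i = 0))"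

text \<open>\<open>bs\<close> lists the pairs (size, eigenvalue) of the Jordan blocks of \<open>f\<close> on \<open>H\<close>: with respect to some
  basis of \<open>H\<close> the matrix of \<open>f\<close> is \<open>jordan_matrix bs\<close>. The list is unique up to permutation.\<close>

definition jordan_blocks_on ::
  "('a::real_vector \<times> 'a) set \<Rightarrow> ('a \<times> 'a \<Rightarrow> 'a \<times> 'a) \<Rightarrow> (nat \<times> complex) list \<Rightarrow> bool"
where
  "jordan_blocks_on H f bs \<longleftrightarrow> 0 \<notin> fst ` set bs \<and>
     (\<exists>vs. distinct vs \<and> \<not> cplx.dependent (set vs) \<and> cplx.span (set vs) = H \<and>
        length vs = dim_row (jordan_matrix bs) \<and>
        (\<forall>j<length vs. f (vs ! j) = (\<Sum>i<length vs. cscale (jordan_matrix bs $$ (i, j)) (vs ! i))))"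

definition pos_ray :: "complex \<Rightarrow> complex set" where
  "pos_ray c = {c * of_real r | r. r > 0}"


section \<open>The types of irreducible Seifert form pairs\<close>

text \<open>
  The constructors stand, in this order, for \<open>Seif(\<lambda>,1,n,\<epsilon>)\<close>; \<open>Seif(\<lambda>,2,n)\<close> with \<open>\<lambda> = \<plusminus>1\<close>;
  \<open>Seif(\<lambda>,2,n,\<zeta>)\<close>; \<open>Seif(\<lambda>,2,n)\<close> with \<open>\<lambda>\<close> real and \<open>\<bar>\<lambda>\<bar> > 1\<close>; \<open>Seif(\<lambda>,4,n)\<close>.
\<close>

datatype seif_type =
    Seif1 real nat real
  | Seif2 real nat
  | Seif3 complex nat complex
  | Seif4 real nat
  | Seif5 complex nat

fun admissible :: "seif_type \<Rightarrow> bool" where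
  "admissible (Seif1 lam n \<epsilon>) \<longleftrightarrow> n \<ge> 1 \<and> \<epsilon> \<in> {1, -1} \<and> (lam = 1 \<and> odd n \<or> lam = -1 \<and> even n)"
| "admissible (Seif2 lam n) \<longleftrightarrow> n \<ge> 1 \<and> (lam = 1 \<and> even n \<or> lam = -1 \<and> odd n)"
| "admissible (Seif3 lam n \<zeta>) \<longleftrightarrow> n \<ge> 1 \<and> cmod lam = 1 \<and> lam \<notin> {1, -1} \<and>
     cmod \<zeta> = 1 \<and> \<zeta> \<notin> {1, -1} \<and>
     \<zeta>\<^sup>2 = cnj lam * (- 1) ^ (n + 1)"
| "admissible (Seif4 lam n) \<longleftrightarrow> n \<ge> 1 \<and> (lam > 1 \<or> lam < -1)"
| "admissible (Seif5 lam n) \<longleftrightarrow> n \<ge> 1 \<and> cmod lam > 1 \<and> Im lam > 0"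

text \<open>A real vector \<open>a\<close> is embedded into \<open>V \<times> V\<close> as \<open>(a, 0)\<close>.\<close>

fun has_type ::
  "'a::real_vector set \<Rightarrow> ('a \<Rightarrow> 'a \<Rightarrow> real) \<Rightarrow> seif_type \<Rightarrow> bool"
where
  "has_type V L (Seif1 lam n \<epsilon>) \<longleftrightarrow>
     dim V = n \<and> V \<times> V = gen_eigenspace V L (of_real lam) \<and>
     (\<exists>bs. jordan_blocks_on (V \<times> V) (monodromy_cplx V L) bs \<and> length bs = 1) \<and>
     (\<forall>a\<in>V. (a, 0) \<notin> nilp_part V L ` (V \<times> V) \<longrightarrow>
        form_cplx L (a, 0) ((nilp_part V L ^^ (n - 1)) (a, 0)) \<in> pos_ray (of_real \<epsilon>))"
| "has_type V L (Seif2 lam n) \<longleftrightarrow>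
     dim V = 2 * n \<and> V \<times> V = gen_eigenspace V L (of_real lam) \<and>
     (\<exists>bs. jordan_blocks_on (V \<times> V) (monodromy_cplx V L) bs \<and> length bs = 2 \<and>
        (\<forall>b\<in>set bs. fst b = n))"
| "has_type V L (Seif3 lam n \<zeta>) \<longleftrightarrow>
     dim V = 2 * n \<and> direct_sum_of (V \<times> V) {lam, cnj lam} (gen_eigenspace V L) \<and>
     (\<exists>bs. jordan_blocks_on (V \<times> V) (monodromy_cplx V L) bs \<and> length bs = 2) \<and>
     (\<forall>a\<in>gen_eigenspace V L lam - nilp_part V L ` (V \<times> V).
        form_cplx L a ((nilp_part V L ^^ (n - 1)) (cconj a)) \<in> pos_ray \<zeta>)"
| "has_type V L (Seif4 lam n) \<longleftrightarrow>
     dim V = 2 * n \<and>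
     direct_sum_of (V \<times> V) {of_real lam, inverse (of_real lam)} (gen_eigenspace V L) \<and>
     (\<exists>bs. jordan_blocks_on (V \<times> V) (monodromy_cplx V L) bs \<and> length bs = 2 \<and>
        (\<forall>b\<in>set bs. fst b = n))"
| "has_type V L (Seif5 lam n) \<longleftrightarrow>
     dim V = 4 * n \<and>
     direct_sum_of (V \<times> V) {lam, inverse lam, cnj lam, inverse (cnj lam)} (gen_eigenspace V L) \<and>
     (\<exists>bs. jordan_blocks_on (V \<times> V) (monodromy_cplx V L) bs \<and> length bs = 4 \<and>
        (\<forall>b\<in>set bs. fst b = n))"

end

theory Submission
  imports Defs
begin

text \<open>
  The monodromy \<open>M\<close> is an isometry of \<open>L\<close>, and \<open>L\<close> is almost symmetric along it: \<open>L (M a) b = L b a\<close>.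
  Hence generalized eigenspaces for \<open>\<mu>\<close> and \<open>\<nu>\<close> are orthogonal unless \<open>\<mu> \<nu> = 1\<close>, and on them
  the nilpotent operator \<open>T = M\<^sub>u - 1\<close> is skew adjoint up to terms of higher order. Where \<open>T ^ n = 0\<close>, the
  leading form \<open>\<omega> x y = L x (T ^ (n - 1) y)\<close> therefore depends on \<open>x\<close> and \<open>y\<close> modulo the image of \<open>T\<close>
  only, and it satisfies \<open>\<omega> y x = \<mu> (-1) ^ (n - 1) \<omega> x y\<close> for \<open>x\<close> with eigenvalue \<open>\<mu>\<close>
  (\<open>leading_form_swap\<close>). For \<open>\<mu> = \<plusminus>1\<close> it is symmetric or skew symmetric, depending on the parity of \<open>n\<close>;
  for other \<open>\<mu>\<close> on the unit circle, \<open>\<omega> x (cconj y)\<close> is Hermitian up to a constant. This is the source of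
  the distinction between the five types and of the signs \<open>\<epsilon>\<close> and \<open>\<zeta>\<close>.

  The five types are treated uniformly by means of frames. A frame of a type consists of one generator
  \<open>x i\<close> for each Jordan block, such that \<open>\<omega>\<close> pairs the block \<open>i\<close> with exactly one dual block, with a
  prescribed value, and such that complex conjugation permutes the generators. The vectors
  \<open>T ^ k (x i)\<close> then have an antitriangular Gram matrix. So they are linearly independent and span the
  complexification of an \<open>M\<close>-invariant real subspace on which \<open>L\<close> is nondegenerate (\<open>frame_subpair\<close>).
  If it is the whole space, the frame is called full here. A pair has a type if and only if it has a
  full frame of this type (\<open>has_type_imp_frame\<close>, \<open>frame_imp_has_type\<close>).

  Frames exist as soon as two vectors are paired nontrivially by \<open>\<omega>\<close>: polarization gives a vector with
  nonzero square in the symmetric and Hermitian cases, and positive scaling leaves only a sign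
  undetermined (\<open>paired_imp_frame\<close>). In an irreducible pair, take for \<open>n\<close> the order of nilpotency of \<open>T\<close>.
  Such vectors exist by nondegeneracy, and the subspace spanned by the frame is an orthogonal summand,
  hence everything (\<open>irreducible_has_type\<close>). In an explicit hyperbolic pair such vectors are written down, which
  yields the existence of all types (\<open>type_exists\<close>); the undetermined sign is corrected by passing
  from \<open>L\<close> to \<open>- L\<close>.

  Irreducibility and uniqueness both rest on one observation (\<open>leading_zero_nilpotent\<close>): an operator
  that commutes with \<open>T\<close> and has leading matrix \<open>\<omega> (A (x i)) (x j) = 0\<close> is nilpotent. If a pair with a full frame
  splits, the leading matrix of the orthogonal projection \<open>\<pi>\<close> to a summand is a constant multiple, by 0 or 1, of that
  of the identity, so that \<open>\<pi>\<close> or \<open>1 - \<pi>\<close> is nilpotent, hence zero (\<open>frame_irreducible\<close>). If two pairs have full frames of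
  the same type, mapping one chain basis to the other is compatible with the monodromies and carries
  \<open>L\<close> to a form \<open>L ((1 + A) a) b\<close> with \<open>A\<close> nilpotent; composing with the
  square root of \<open>1 + A\<close>, a polynomial in \<open>A\<close>, gives an isomorphism of pairs (\<open>frames_isomorphic\<close>).
\<close>

section \<open>Polynomials of a linear operator\<close>

text \<open>The scalar multiplication is a parameter, so that real polynomials of operators on a space
  and complex polynomials of operators on its complexification are covered at once.\<close>

definition polyop :: "('a::field \<Rightarrow> 'b \<Rightarrow> 'b) \<Rightarrow> ('b \<Rightarrow> 'b) \<Rightarrow> 'a poly \<Rightarrow> 'b \<Rightarrow> 'b::ab_group_add" where
  "polyop sc f q x = (\<Sum>i\<le>degree q. sc (coeff q i) ((f ^^ i) x))"

context vector_space
begin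

lemma polyop_altdef:
  assumes "degree q \<le> N"
  shows "polyop scale f q x = (\<Sum>i\<le>N. scale (coeff q i) ((f ^^ i) x))"
  unfolding polyop_def
  by (rule sum.mono_neutral_left) (use assms in \<open>auto simp: coeff_eq_0\<close>)

lemma polyop_pCons: "polyop scale f (pCons a q) x = scale a x + polyop scale f q (f x)"
proof -
  have "polyop scale f (pCons a q) x = (\<Sum>i\<le>Suc (degree q). scale (coeff (pCons a q) i) ((f ^^ i) x))"
    by (rule polyop_altdef) (simp add: degree_pCons_le)
  also have "\<dots> = scale a x + (\<Sum>i\<le>degree q. scale (coeff q i) ((f ^^ i) (f x)))"
    by (simp add: sum.atMost_Suc_shift funpow_swap1 del: sum.atMost_Suc)
  finally show ?thesis by (simp add: polyop_def)
qed

lemma polyop_0 [simp]: "polyop scale f 0 x = 0"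
  and polyop_const [simp]: "polyop scale f [:c:] x = scale c x"
  and polyop_1 [simp]: "polyop scale f 1 x = x"
  and polyop_linear_poly [simp]: "polyop scale f [:c, d:] x = scale c x + scale d (f x)"
  by (simp_all add: polyop_def one_pCons)

lemma polyop_add: "polyop scale f (p + q) x = polyop scale f p x + polyop scale f q x"
proof -
  let ?N = "max (degree p) (degree q)"
  show ?thesis
    by (subst (1 2 3) polyop_altdef[where N = ?N])
       (auto intro: degree_add_le simp: sum.distrib local.scale_left_distrib)
qed

lemma polyop_smult: "polyop scale f (Polynomial.smult c p) x = scale c (polyop scale f p x)"
  by (subst polyop_altdef[where N = "degree p"])
     (auto simp: polyop_def scale_sum_right)

lemma polyop_minus: "polyop scale f (- p) x = - polyop scale f p x"
  using polyop_add[of f p "- p" x] by (simp add: eq_neg_iff_add_eq_0 add.commute)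

lemma polyop_diff: "polyop scale f (p - q) x = polyop scale f p x - polyop scale f q x"
  using polyop_add[of f p "- q" x] by (simp add: polyop_minus)

lemma linear_funpow: "Vector_Spaces.linear scale scale f \<Longrightarrow> Vector_Spaces.linear scale scale (f ^^ k)"
proof (induction k)
  case 0
  show ?case by (simp add: Vector_Spaces.linear_iff vector_space_axioms)
next
  case (Suc k)
  then show ?case by (auto simp: Vector_Spaces.linear_iff)
qed

lemma linear_polyop:
  assumes "Vector_Spaces.linear scale scale f"
  shows "Vector_Spaces.linear scale scale (polyop scale f q)"
proof -
  have "(f ^^ k) (x + y) = (f ^^ k) x + (f ^^ k) y" "(f ^^ k) (scale c x) = scale c ((f ^^ k) x)" for k x y c
    using linear_funpow[OF assms, of k] by (auto simp: Vector_Spaces.linear_iff)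
  then show ?thesis
    by (auto simp: Vector_Spaces.linear_iff vector_space_axioms polyop_def sum.distrib local.scale_right_distrib
        scale_sum_right mult.commute intro!: sum.cong)
qed

lemma polyop_commute_on:
  assumes "Vector_Spaces.linear scale scale g" "\<And>x. x \<in> S \<Longrightarrow> f x \<in> S"
    and "\<And>x. x \<in> S \<Longrightarrow> g (f x) = f' (g x)" and "x \<in> S"
  shows "g (polyop scale f q x) = polyop scale f' q (g x)"
  using \<open>x \<in> S\<close>
proof (induction q arbitrary: x)
  case 0
  have "g 0 = 0" using assms(1) by (metis Vector_Spaces.linear_iff local.scale_zero_left)
  then show ?case by simp
next
  case (pCons a q)
  have "g (polyop scale f (pCons a q) x) = scale a (g x) + g (polyop scale f q (f x))"
    using assms(1) by (simp add: polyop_pCons Vector_Spaces.linear_iff)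
  also have "\<dots> = scale a (g x) + polyop scale f' q (f' (g x))"
    using pCons.IH[of "f x"] pCons.prems assms(2,3) by simp
  finally show ?case by (simp add: polyop_pCons)
qed

lemma polyop_subspace:
  assumes "subspace S" "\<And>x. x \<in> S \<Longrightarrow> f x \<in> S" "x \<in> S"
  shows "polyop scale f q x \<in> S"
  using \<open>x \<in> S\<close>
proof (induction q arbitrary: x)
  case 0
  then show ?case using assms(1) subspace_0 by simp
next
  case (pCons a q)
  then show ?case using assms by (simp add: polyop_pCons subspace_add subspace_scale)
qed

lemma polyop_mult:
  assumes "Vector_Spaces.linear scale scale f"
  shows "polyop scale f (p * q) x = polyop scale f p (polyop scale f q x)"
proof (induction p arbitrary: x)
  case 0
  then show ?case by simp
next
  case (pCons a p)
  have "f (polyop scale f q x) = polyop scale f q (f x)"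
    by (rule polyop_commute_on[where S = UNIV]) (use assms in auto)
  then show ?case
    by (simp add: polyop_pCons polyop_add polyop_smult pCons.IH)
qed

lemma polyop_power:
  assumes "Vector_Spaces.linear scale scale f"
  shows "polyop scale f (p ^ k) x = (polyop scale f p ^^ k) x"
  by (induction k arbitrary: x) (auto simp: polyop_mult[OF assms])

end

text \<open>Since \<open>X - c\<close> divides \<open>q - q(c)\<close> and \<open>q(c) \<noteq>
  0\<close>, the polynomial \<open>X - c\<close> is a unit modulo \<open>q\<close>, hence so are its
  powers.\<close>

lemma bezout_linear_power:
  fixes q :: "'a::field poly"
  assumes "poly q c \<noteq> 0"
  shows "\<exists>a b. a * [:- c, 1:] ^ k + b * q = 1"
proof (induction k)
  case 0
  show ?case by (rule exI[of _ 1], rule exI[of _ 0]) simp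
next
  case (Suc k)
  then obtain a b where ab: "a * [:- c, 1:] ^ k + b * q = 1" by blast
  have "[:- c, 1:] dvd q - [:poly q c:]" by (simp add: poly_eq_0_iff_dvd[symmetric])
  then obtain r where r: "q - [:poly q c:] = [:- c, 1:] * r" by (elim dvdE)
  define i where "i = [:1 / poly q c:]"
  have i: "i * [:poly q c:] = 1" using assms by (simp add: i_def one_pCons)
  have one: "1 = i * q - i * r * [:- c, 1:]"
  proof -
    have "i * q - i * r * [:- c, 1:] = i * (q - [:- c, 1:] * r)" by (simp only: algebra_simps)
    also have "\<dots> = i * [:poly q c:]" using r by (metis add_diff_cancel_left' diff_add_cancel)
    finally show ?thesis using i by simp
  qed
  have "1 = a * [:- c, 1:] ^ k * (i * q - i * r * [:- c, 1:]) + b * q"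
    using ab one by simp
  also have "\<dots> = (a * [:- c, 1:] ^ k * i + b) * q - (a * i * r) * [:- c, 1:] ^ Suc k"
    by (simp only: power_Suc) (simp only: algebra_simps)
  finally have "(- (a * i * r)) * [:- c, 1:] ^ Suc k + (a * [:- c, 1:] ^ k * i + b) * q = 1"
    by simp
  then show ?case by blast
qed

text \<open>Induction on \<open>R\<close>: the product of the powers treated so far is a unit modulo the
  next one.\<close>

lemma chinese_remainder_linear_powers:
  fixes r :: "'a::field \<Rightarrow> 'a poly"
  assumes "finite R"
  shows "\<exists>s. \<forall>c\<in>R. [:- c, 1:] ^ k dvd s - r c"
  using assms
proof (induction R rule: finite_induct)
  case empty
  show ?case by simp
next
  case (insert m R)
  then obtain s where s: "\<And>c. c \<in> R \<Longrightarrow> [:- c, 1:] ^ k dvd s - r c" by blast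
  define G where "G = (\<Prod>c\<in>R. [:- c, 1:] ^ k)"
  have "poly G m \<noteq> 0" using insert by (auto simp: G_def poly_prod)
  then obtain a b where ab: "a * [:- m, 1:] ^ k + b * G = 1" using bezout_linear_power by blast
  define s' where "s' = s + b * G * (r m - s)"
  have "[:- c, 1:] ^ k dvd s' - r c" if "c \<in> R" for c
  proof -
    have "[:- c, 1:] ^ k dvd G" unfolding G_def by (rule dvd_prodI) (use that insert(1) in auto)
    then have "[:- c, 1:] ^ k dvd (s - r c) + b * G * (r m - s)"
      using s[OF that] by (intro dvd_add dvd_mult2[OF dvd_mult]) auto
    then show ?thesis by (simp add: s'_def algebra_simps)
  qed
  moreover have "[:- m, 1:] ^ k dvd s' - r m"
  proof -
    have "s' - r m = (1 - b * G) * (s - r m)" by (simp add: s'_def algebra_simps)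
    also have "1 - b * G = a * [:- m, 1:] ^ k" using ab by (metis add_diff_cancel_right')
    finally show ?thesis by simp
  qed
  ultimately show ?case by blast
qed


section \<open>Finite dimensional spaces and their complexification\<close>

interpretation cpair: vector_space_pair
  "cscale :: complex \<Rightarrow> 'a::real_vector \<times> 'a \<Rightarrow> 'a \<times> 'a"
  "cscale :: complex \<Rightarrow> 'b::real_vector \<times> 'b \<Rightarrow> 'b \<times> 'b"
  by unfold_locales

abbreviation clinear :: "('a::real_vector \<times> 'a \<Rightarrow> 'b::real_vector \<times> 'b) \<Rightarrow> bool" where
  "clinear \<equiv> Vector_Spaces.linear cscale cscale"

lemma clinear_iff:
  "clinear f \<longleftrightarrow> (\<forall>x y. f (x + y) = f x + f y) \<and> (\<forall>c x. f (cscale c x) = cscale c (f x))"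
  by (simp add: Vector_Spaces.linear_iff cplx.vector_space_axioms)

lemma clinear_add: "clinear f \<Longrightarrow> f (x + y) = f x + f y"
  and clinear_scale: "clinear f \<Longrightarrow> f (cscale c x) = cscale c (f x)"
  unfolding clinear_iff by blast+

lemma clinearI:
  "(\<And>x y. f (x + y) = f x + f y) \<Longrightarrow> (\<And>c x. f (cscale c x) = cscale c (f x)) \<Longrightarrow> clinear f"
  unfolding clinear_iff by blast

lemma clinear_0: "clinear f \<Longrightarrow> f 0 = 0"
  by (metis clinear_scale cplx.scale_zero_left)

lemma clinear_minus: "clinear f \<Longrightarrow> f (- x) = - f x"
  by (metis clinear_add clinear_0 add.right_inverse neg_eq_iff_add_eq_0 minus_minus)

lemma clinear_diff: "clinear f \<Longrightarrow> f (x - y) = f x - f y"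
  using clinear_add[of f x "- y"] by (simp add: clinear_minus)

lemma clinear_sum: "clinear f \<Longrightarrow> f (\<Sum>i\<in>I. v i) = (\<Sum>i\<in>I. f (v i))"
  by (induction I rule: infinite_finite_induct) (auto simp: clinear_0 clinear_add)

lemma clinear_compose: "clinear f \<Longrightarrow> clinear g \<Longrightarrow> clinear (\<lambda>x. f (g x))"
  by (rule clinearI) (simp_all add: clinear_add clinear_scale)

lemma clinear_plus: "clinear f \<Longrightarrow> clinear g \<Longrightarrow> clinear (\<lambda>x. f x + g x)"
  by (rule clinearI) (simp_all add: clinear_add clinear_scale cplx.scale_right_distrib)

lemma clinear_id: "clinear (\<lambda>x. x)"
  by (rule clinearI) simp_all

lemma clinear_map_prod: "linear f \<Longrightarrow> clinear (map_prod f f)"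
  by (auto simp: clinear_iff cscale_def linear_add linear_diff linear_scale)

lemma cscale_simps [simp]: "cscale c (cscale d x) = cscale (c * d) x" "cscale 1 x = x" "cscale 0 x = 0"
  "cscale c 0 = 0"
  by simp_all

lemma cconj_simps [simp]: "cconj (cconj x) = x" "cconj (x + y) = cconj x + cconj y"
  "cconj (cscale c x) = cscale (cnj c) (cconj x)" "cconj 0 = 0" "cconj (x - y) = cconj x - cconj y"
  "cconj (- x) = - cconj x" "cconj (a, 0) = (a, 0)"
  by (auto simp: cconj_def cscale_def zero_prod_def)

lemma cconj_map_prod: "linear f \<Longrightarrow> cconj (map_prod f f x) = map_prod f f (cconj x)"
  by (auto simp: cconj_def linear_neg split_beta map_prod_def)

lemma subspace_Times: "subspace V \<Longrightarrow> cplx.subspace (V \<times> V)"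
  by (auto simp: cplx.subspace_def cscale_def subspace_0 subspace_add subspace_diff subspace_scale
      zero_prod_def)

lemma cconj_Times: "subspace V \<Longrightarrow> cconj x \<in> V \<times> V \<longleftrightarrow> x \<in> V \<times> V"
  by (auto simp: cconj_def mem_Times_iff) (metis minus_minus subspace_neg, metis subspace_neg)

text \<open>The real and imaginary part of a vector are linear combinations of the vector and its
  conjugate. So conjugation invariant subspaces are complexifications.\<close>

lemma conj_closed_eq_Times:
  assumes C: "cplx.subspace C" and conj: "\<And>x. x \<in> C \<Longrightarrow> cconj x \<in> C"
  shows "C = {v. (v, 0) \<in> C} \<times> {v. (v, 0) \<in> C}" and "subspace {v. (v, 0) \<in> C}"
proof -
  have key: "(u, v) \<in> C \<longleftrightarrow> (u, 0) \<in> C \<and> (v, 0) \<in> C" for u v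
  proof
    assume uv: "(u, v) \<in> C"
    then have vu: "(u, - v) \<in> C" using conj[OF uv] by (simp add: cconj_def)
    have "cscale (1/2) ((u, v) + (u, - v)) \<in> C" "cscale (- \<i>/2) ((u, v) - (u, - v)) \<in> C"
      using uv vu by (intro cplx.subspace_scale[OF C] cplx.subspace_add[OF C] cplx.subspace_diff[OF C]; simp)+
    moreover have "cscale (1/2) ((u, v) + (u, - v)) = (u, 0)"
      by (simp add: cscale_def flip: scaleR_add_left)
    moreover have "cscale (- \<i>/2) ((u, v) - (u, - v)) = (v, 0)"
      by (simp add: cscale_def flip: scaleR_add_left)
    ultimately show "(u, 0) \<in> C \<and> (v, 0) \<in> C" by simp
  next
    assume "(u, 0) \<in> C \<and> (v, 0) \<in> C"
    then have "(u, 0) + cscale \<i> (v, 0) \<in> C"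
      by (intro cplx.subspace_add[OF C] cplx.subspace_scale[OF C]) auto
    then show "(u, v) \<in> C" by (simp add: cscale_def)
  qed
  show "C = {v. (v, 0) \<in> C} \<times> {v. (v, 0) \<in> C}"
  proof (rule Set.set_eqI)
    fix x :: "'a \<times> 'a"
    show "x \<in> C \<longleftrightarrow> x \<in> {v. (v, 0) \<in> C} \<times> {v. (v, 0) \<in> C}"
      using key[of "fst x" "snd x"] unfolding mem_Times_iff mem_Collect_eq prod.collapse .
  qed
  show "subspace {v. (v, 0) \<in> C}"
  proof (rule subspaceI)
    show "0 \<in> {v. (v, 0) \<in> C}" using cplx.subspace_0[OF C] by (simp add: zero_prod_def)
    show "x + y \<in> {v. (v, 0) \<in> C}" if "x \<in> {v. (v, 0) \<in> C}" "y \<in> {v. (v, 0) \<in> C}" for x y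
      using cplx.subspace_add[OF C, of "(x, 0)" "(y, 0)"] that by simp
    show "c *\<^sub>R x \<in> {v. (v, 0) \<in> C}" if "x \<in> {v. (v, 0) \<in> C}" for c x
      using cplx.subspace_scale[OF C, of "(x, 0)" "of_real c"] that by (simp add: cscale_def)
  qed
qed

lemma Times_basis:
  fixes B :: "'a::real_vector set"
  assumes B: "finite B" "independent B"
  shows "cplx.span ((\<lambda>b. (b, 0)) ` B) = span B \<times> span B"
    and "cplx.independent ((\<lambda>b. (b, 0)) ` B)"
proof -
  let ?i = "\<lambda>b::'a. (b, 0::'a)"
  have inj: "inj_on ?i B" by (auto simp: inj_on_def)
  have comb: "(\<Sum>b\<in>B. cscale (c b) (?i b)) = (\<Sum>b\<in>B. Re (c b) *\<^sub>R b, \<Sum>b\<in>B. Im (c b) *\<^sub>R b)" for c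
    by (rule prod_eqI) (simp_all add: fst_sum snd_sum cscale_def)
  show "cplx.span (?i ` B) = span B \<times> span B"
  proof
    have "cplx.subspace (span B \<times> span B)" by (rule subspace_Times) simp
    then show "cplx.span (?i ` B) \<subseteq> span B \<times> span B"
      by (rule cplx.span_minimal[rotated]) (auto intro: span_base span_zero)
    show "span B \<times> span B \<subseteq> cplx.span (?i ` B)"
    proof safe
      fix u v assume "u \<in> span B" "v \<in> span B"
      then obtain a b where ab: "u = (\<Sum>x\<in>B. a x *\<^sub>R x)" "v = (\<Sum>x\<in>B. b x *\<^sub>R x)"
        using B(1) by (auto simp: span_finite)
      have "(u, v) = (\<Sum>x\<in>B. cscale (Complex (a x) (b x)) (?i x))" by (simp add: comb ab)
      also have "\<dots> \<in> cplx.span (?i ` B)"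
        by (intro cplx.span_sum cplx.span_scale cplx.span_base) auto
      finally show "(u, v) \<in> cplx.span (?i ` B)" .
    qed
  qed
  show "cplx.independent (?i ` B)"
  proof (rule cplx.independent_if_scalars_zero)
    fix f x assume s: "(\<Sum>x\<in>?i ` B. cscale (f x) x) = 0" and x: "x \<in> ?i ` B"
    have "(\<Sum>b\<in>B. cscale (f (?i b)) (?i b)) = 0" using s by (simp add: sum.reindex inj)
    then have "(\<Sum>b\<in>B. Re (f (?i b)) *\<^sub>R b) = 0" "(\<Sum>b\<in>B. Im (f (?i b)) *\<^sub>R b) = 0"
      unfolding comb by (auto simp: zero_prod_def)
    then have "Re (f (?i b)) = 0 \<and> Im (f (?i b)) = 0" if "b \<in> B" for b
      using that independentD[OF B(2) B(1) order_refl, of "\<lambda>b. Re (f (?i b))" b]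
        independentD[OF B(2) B(1) order_refl, of "\<lambda>b. Im (f (?i b))" b] by blast
    then show "f x = 0" using x by (auto simp: complex_eq_iff)
  qed (use B in simp)
qed

lemma fin_dim_basis:
  assumes "fin_dim_space V"
  obtains B where "finite B" "independent B" "span B = V" "card B = dim V" "B \<subseteq> V"
proof -
  from assms obtain B0 where B0: "subspace V" "finite B0" "span B0 = V" by (auto simp: fin_dim_space_def)
  obtain B where B: "B \<subseteq> V" "independent B" "V \<subseteq> span B" "card B = dim V"
    using basis_exists[of V] by blast
  have "finite B" using independent_span_bound[OF B0(2) B(2)] B0(3) B(1) by simp
  moreover have "span B = V" using B(1,3) B0(1) span_minimal by blast
  ultimately show ?thesis using B that by blast
qed

lemma fin_dim_subspace:
  assumes "fin_dim_space V" "subspace Y" "Y \<subseteq> V"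
  shows "fin_dim_space Y"
proof -
  obtain B0 where B0: "finite B0" "span B0 = V" using assms(1) unfolding fin_dim_space_def by blast
  obtain B where B: "B \<subseteq> Y" "independent B" "Y \<subseteq> span B" "card B = dim Y"
    by (rule basis_exists)
  have "finite B" using independent_span_bound[OF B0(1) B(2)] B0(2) B(1) assms(3) by auto
  moreover have "span B = Y" using span_minimal[OF B(1) assms(2)] B(3) by (rule subset_antisym)
  ultimately show ?thesis using assms(2) unfolding fin_dim_space_def by blast
qed

text \<open>A real basis of \<open>V\<close> is a complex basis of \<open>V \<times> V\<close>, so the exchange lemma bounds independent
  sets by \<open>dim V\<close>.\<close>

lemma Times_independent_card:
  fixes V :: "'a::real_vector set"
  assumes V: "fin_dim_space V" and S: "cplx.independent S" "S \<subseteq> V \<times> V"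
  shows "finite S" "card S \<le> dim V" "card S = dim V \<Longrightarrow> cplx.span S = V \<times> V"
    "cplx.span S = V \<times> V \<Longrightarrow> card S = dim V"
proof -
  obtain B where B: "finite B" "independent B" "span B = V" "card B = dim V"
    using fin_dim_basis[OF V] by metis
  let ?B = "(\<lambda>b. (b, 0::'a)) ` B"
  have iB: "cplx.independent ?B" and sB: "cplx.span ?B = V \<times> V"
    using Times_basis[OF B(1,2)] B(3) by auto
  have card: "card ?B = dim V" using B(4) by (subst card_image) (auto simp: inj_on_def)
  have bound: "finite S \<and> card S \<le> card ?B"
    using cplx.independent_span_bound[of ?B S] S sB B(1) by simp
  show fS: "finite S" and le: "card S \<le> dim V"
    using bound unfolding card by blast+
  show "card S = dim V" if "cplx.span S = V \<times> V"
  proof -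
    have "?B \<subseteq> cplx.span S" using that sB cplx.span_superset by metis
    then have "card ?B \<le> card S" using cplx.independent_span_bound[OF fS iB] by blast
    then show ?thesis using le unfolding card by simp
  qed
  assume eq: "card S = dim V"
  show "cplx.span S = V \<times> V"
  proof (rule ccontr)
    assume "cplx.span S \<noteq> V \<times> V"
    moreover have "cplx.span S \<subseteq> V \<times> V"
      using S(2) sB by (metis cplx.span_mono cplx.span_span)
    ultimately obtain x where x: "x \<in> V \<times> V" "x \<notin> cplx.span S" by blast
    then have "cplx.independent (insert x S)" using S(1) cplx.independent_insertI by blast
    moreover have "insert x S \<subseteq> cplx.span ?B" using x(1) S(2) sB by blast
    ultimately have "card (insert x S) \<le> card ?B"
      using cplx.independent_span_bound[of ?B "insert x S"] B(1) by blast
    moreover have "x \<notin> S" using x(2) cplx.span_base by blast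
    ultimately show False using eq card fS by simp
  qed
qed

text \<open>Chains of vectors come with indices; their distinctness is part of the claim.\<close>

lemma indexed_independent:
  assumes "finite I" and zero: "\<And>c. (\<Sum>i\<in>I. cscale (c i) (v i)) = 0 \<Longrightarrow> \<forall>i\<in>I. c i = 0"
  shows "inj_on v I" and "cplx.independent (v ` I)"
proof -
  show inj: "inj_on v I"
  proof (rule inj_onI, rule ccontr)
    fix i j assume ij: "i \<in> I" "j \<in> I" "v i = v j" "i \<noteq> j"
    let ?c = "\<lambda>k. if k = i then 1 else if k = j then - 1 else (0::complex)"
    have "(\<Sum>k\<in>I. cscale (?c k) (v k)) = (\<Sum>k\<in>{i, j}. cscale (?c k) (v k))"
      by (rule sum.mono_neutral_right) (use ij assms(1) in auto)
    also have "\<dots> = 0" using ij by simp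
    finally show False using zero[of ?c] ij(1) by auto
  qed
  show "cplx.independent (v ` I)"
  proof (rule cplx.independent_if_scalars_zero)
    fix f x assume "(\<Sum>x\<in>v ` I. cscale (f x) x) = 0" and x: "x \<in> v ` I"
    then have "(\<Sum>i\<in>I. cscale (f (v i)) (v i)) = 0" by (simp add: sum.reindex inj)
    from zero[OF this] x show "f x = 0" by auto
  qed (use assms in simp)
qed

lemma linear_projection:
  assumes "subspace V"
  obtains P where "linear P" "\<And>x. P x \<in> V" "\<And>v. v \<in> V \<Longrightarrow> P v = v"
proof -
  have "linear (\<lambda>x. x)" by (simp add: linear_iff)
  from linear_exists_left_inverse_on[OF this assms] obtain g
    where "range g \<subseteq> V" "linear g" "\<forall>v\<in>V. g v = v" by (auto simp: inj_on_def)
  then show ?thesis by (intro that[of g]) auto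
qed

lemma fin_dim_inj_onto:
  assumes V: "fin_dim_space V" and W: "fin_dim_space W" and dims: "dim W \<le> dim V"
    and f: "linear f" "\<And>v. v \<in> V \<Longrightarrow> f v \<in> W" "\<And>v. v \<in> V \<Longrightarrow> f v = 0 \<Longrightarrow> v = 0"
  shows "bij_betw f V W"
proof -
  have sV: "subspace V" using V by (simp add: fin_dim_space_def)
  obtain B where B: "finite B" "independent B" "span B = V" "card B = dim V" "B \<subseteq> V"
    using fin_dim_basis[OF V] by metis
  obtain C where C: "finite C" "independent C" "span C = W" "card C = dim W" "C \<subseteq> W"
    using fin_dim_basis[OF W] by metis
  have inj: "inj_on f V"
  proof (rule inj_onI)
    fix x y assume xy: "x \<in> V" "y \<in> V" "f x = f y"
    then have "f (x - y) = 0" by (simp add: linear_diff f(1))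
    then show "x = y" using f(3)[of "x - y"] subspace_diff[OF sV xy(1,2)] by simp
  qed
  have ind: "independent (f ` B)"
    by (rule linear_independent_injective_image[OF f(1) B(2)]) (use inj B(3) in simp)
  have card: "card (f ` B) = dim V" using inj B(4,5) by (metis card_image inj_on_subset)
  have sub: "f ` B \<subseteq> W" using f(2) B(5) by blast
  have "w \<in> span (f ` B)" if w: "w \<in> W" for w
  proof (rule ccontr)
    assume n: "w \<notin> span (f ` B)"
    then have "independent (insert w (f ` B))" using ind independent_insertI by blast
    moreover have "insert w (f ` B) \<subseteq> span C" using w sub C(3) by blast
    ultimately have "card (insert w (f ` B)) \<le> card C"
      using independent_span_bound[OF C(1)] by blast
    moreover have "w \<notin> f ` B" using n span_base by blast
    ultimately show False using card dims C(4) B(1) by simp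
  qed
  then have "W \<subseteq> f ` V" using linear_span_image[OF f(1), of B] B(3) by blast
  then show ?thesis using inj f(2) by (auto simp: bij_betw_def)
qed

definition bilinear_form :: "('a::real_vector \<Rightarrow> 'a \<Rightarrow> real) \<Rightarrow> bool" where
  "bilinear_form L \<longleftrightarrow> (\<forall>x. linear (L x)) \<and> (\<forall>y. linear (\<lambda>x. L x y))"

text \<open>A Riesz representation lemma, linear in a parameter; it yields the monodromy, adjoint operators
  and orthogonal projections. For a basis \<open>B\<close> of \<open>V\<close> the map \<open>x \<mapsto> \<Sum>b\<in>B. L x b *\<^sub>R b\<close> is injective
  on \<open>V\<close> by nondegeneracy, hence a bijection.\<close>

lemma bilinear_representation:
  fixes V :: "'a::real_vector set" and L :: "'a \<Rightarrow> 'a \<Rightarrow> real" and \<Psi> :: "'a \<Rightarrow> 'a \<Rightarrow> real"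
  assumes V: "fin_dim_space V" and L: "bilinear_form L" and \<Psi>: "bilinear_form \<Psi>"
    and nd: "\<And>a. a \<in> V \<Longrightarrow> (\<And>b. b \<in> V \<Longrightarrow> L a b = 0) \<Longrightarrow> a = 0"
  obtains G where "linear G" "\<And>c. G c \<in> V" "\<And>c b. b \<in> V \<Longrightarrow> L (G c) b = \<Psi> c b"
proof -
  obtain B where B: "finite B" "independent B" "span B = V" "card B = dim V" "B \<subseteq> V"
    using fin_dim_basis[OF V] by metis
  have sV: "subspace V" using V by (simp add: fin_dim_space_def)
  have lin: "linear (L x)" "linear (\<lambda>x. L x y)" "linear (\<Psi> c)" "linear (\<lambda>c. \<Psi> c y)" for x y c
    using L \<Psi> by (simp_all add: bilinear_form_def)
  have ext: "f b = g b" if "linear f" "linear g" "\<And>b. b \<in> B \<Longrightarrow> f b = g b" "b \<in> V" for f g :: "'a \<Rightarrow> real" and b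
    using linear_eq_on[OF that(1,2), of b B] that(3,4) B(3) by auto
  define \<Phi> where "\<Phi> x = (\<Sum>b\<in>B. L x b *\<^sub>R b)" for x
  have lin\<Phi>: "linear \<Phi>"
    unfolding \<Phi>_def by (rule linearI)
      (simp_all add: linear_add[OF lin(2)] linear_scale[OF lin(2)] scaleR_add_left sum.distrib scaleR_sum_right)
  have in\<Phi>: "\<Phi> x \<in> V" for x
    unfolding \<Phi>_def using B(5) by (intro subspace_sum[OF sV] subspace_scale[OF sV]) auto
  have comp: "u b = w b" if "(\<Sum>b\<in>B. u b *\<^sub>R b) = (\<Sum>b\<in>B. w b *\<^sub>R b)" "b \<in> B" for u w b
  proof -
    have "(\<Sum>b\<in>B. (u b - w b) *\<^sub>R b) = 0" using that(1) by (simp add: scaleR_diff_left sum_subtractf)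
    then show ?thesis using independentD[OF B(2,1) order_refl _ that(2), of "\<lambda>b. u b - w b"] by simp
  qed
  have "\<Phi> x = 0 \<Longrightarrow> x = 0" if "x \<in> V" for x
  proof (rule nd[OF that])
    fix b assume z: "\<Phi> x = 0" and b: "b \<in> V"
    have "L x b = 0" if "b \<in> B" for b
      using comp[of "L x" "\<lambda>_. 0" b] z that by (simp add: \<Phi>_def)
    then show "L x b = 0" using ext[OF lin(1), of "\<lambda>_. 0" x b] b by (simp add: linear_zero)
  qed
  then have bij: "bij_betw \<Phi> V V"
    by (intro fin_dim_inj_onto[OF V V order_refl lin\<Phi> in\<Phi>])
  then have "inj_on \<Phi> V" by (simp add: bij_betw_def)
  from linear_exists_left_inverse_on[OF lin\<Phi> sV this]
  obtain g where g: "range g \<subseteq> V" "linear g" "\<And>v. v \<in> V \<Longrightarrow> g (\<Phi> v) = v" by blast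
  define G where "G c = g (\<Sum>b\<in>B. \<Psi> c b *\<^sub>R b)" for c
  show ?thesis
  proof (rule that[of G])
    have "linear (\<lambda>c. \<Sum>b\<in>B. \<Psi> c b *\<^sub>R b)"
      by (rule linearI)
        (simp_all add: linear_add[OF lin(4)] linear_scale[OF lin(4)] scaleR_add_left sum.distrib scaleR_sum_right)
    from linear_compose[OF this g(2)] show "linear G" unfolding G_def o_def .
    show "G c \<in> V" for c using g(1) by (auto simp: G_def)
    fix c b assume b: "b \<in> V"
    have "(\<Sum>b\<in>B. \<Psi> c b *\<^sub>R b) \<in> V"
      using B(5) by (intro subspace_sum[OF sV] subspace_scale[OF sV]) auto
    then obtain u where u: "u \<in> V" "\<Phi> u = (\<Sum>b\<in>B. \<Psi> c b *\<^sub>R b)"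
      using bij by (metis bij_betw_imp_surj_on imageE)
    have "G c = u" using g(3)[OF u(1)] by (simp add: G_def u(2))
    moreover have "L u b = \<Psi> c b" if "b \<in> B" for b
      using comp[of "L u" "\<Psi> c" b] u(2) that by (simp add: \<Phi>_def)
    ultimately show "L (G c) b = \<Psi> c b" using ext[OF lin(1) lin(3)] b by metis
  qed
qed

section \<open>Seifert form pairs with globally defined form and monodromy\<close>

text \<open>Form and monodromy are defined and linear on the whole type here, so that linear algebra needs no
  carriers; lemma \<open>seif_extend\<close> below shows that this is no restriction.\<close>

locale seif =
  fixes V :: "'a::real_vector set" and L :: "'a \<Rightarrow> 'a \<Rightarrow> real" and M :: "'a \<Rightarrow> 'a"
  assumes fin: "fin_dim_space V" and bil: "bilinear_form L"
    and nondeg_left: "\<And>a. a \<in> V \<Longrightarrow> (\<And>b. b \<in> V \<Longrightarrow> L a b = 0) \<Longrightarrow> a = 0"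
    and nondeg_right: "\<And>b. b \<in> V \<Longrightarrow> (\<And>a. a \<in> V \<Longrightarrow> L a b = 0) \<Longrightarrow> b = 0"
    and lin_M: "linear M" and M_in: "\<And>a. a \<in> V \<Longrightarrow> M a \<in> V"
    and M_form: "\<And>a b. a \<in> V \<Longrightarrow> b \<in> V \<Longrightarrow> L (M a) b = L b a"

text \<open>The monodromy represents the functionals \<open>b \<mapsto> L b a\<close>.\<close>

lemma seif_of_form:
  assumes V: "fin_dim_space V" and L: "bilinear_form L"
    and nd1: "\<And>a. a \<in> V \<Longrightarrow> (\<And>b. b \<in> V \<Longrightarrow> L a b = 0) \<Longrightarrow> a = 0"
    and nd2: "\<And>b. b \<in> V \<Longrightarrow> (\<And>a. a \<in> V \<Longrightarrow> L a b = 0) \<Longrightarrow> b = 0"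
  shows "\<exists>M. seif V L M"
proof -
  have L': "bilinear_form (\<lambda>a b. L b a)" using L by (simp add: bilinear_form_def)
  obtain M where M: "linear M" "\<And>c. M c \<in> V" "\<And>c b. b \<in> V \<Longrightarrow> L (M c) b = L b c"
    using bilinear_representation[OF V L L' nd1] by metis
  have "seif V L M" by (rule seif.intro[OF V L nd1 nd2 M(1,2,3)])
  then show ?thesis by blast
qed

text \<open>Compose the form with a linear projection to \<open>V\<close>.\<close>

lemma seif_extend:
  assumes "seifert_form_pair V L0"
  obtains L M where "seif V L M" "\<And>x y. x \<in> V \<Longrightarrow> y \<in> V \<Longrightarrow> L x y = L0 x y"
proof -
  have V: "fin_dim_space V" "subspace V" and L0: "bilinear_on V L0" and nd: "nondegenerate_on V L0"
    using assms by (auto simp: seifert_form_pair_def fin_dim_space_def)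
  obtain P where P: "linear P" "\<And>x. P x \<in> V" "\<And>v. v \<in> V \<Longrightarrow> P v = v"
    using linear_projection[OF V(2)] by blast
  define L where "L x y = L0 (P x) (P y)" for x y
  have L: "L x y = L0 x y" if "x \<in> V" "y \<in> V" for x y using that P(3) by (simp add: L_def)
  have "linear (L x)" "linear (\<lambda>x. L x y)" for x y
    using L0 P by (auto intro!: linearI simp: L_def linear_add linear_scale bilinear_on_def)
  then have bil: "bilinear_form L" by (simp add: bilinear_form_def)
  have nd1: "a = 0" if "a \<in> V" "\<And>b. b \<in> V \<Longrightarrow> L a b = 0" for a
    using nd that L by (simp add: nondegenerate_on_def)
  have nd2: "b = 0" if "b \<in> V" "\<And>a. a \<in> V \<Longrightarrow> L a b = 0" for b
    using nd that L by (simp add: nondegenerate_on_def)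
  have "\<exists>M. seif V L M" by (rule seif_of_form[OF V(1) bil nd1 nd2])
  then show ?thesis using that L by blast
qed

context seif
begin

lemma subspace_V: "subspace V"
  using fin by (simp add: fin_dim_space_def)

lemma L_simps:
  "L (x + y) z = L x z + L y z" "L z (x + y) = L z x + L z y"
  "L (x - y) z = L x z - L y z" "L z (x - y) = L z x - L z y"
  "L (c *\<^sub>R x) z = c * L x z" "L z (c *\<^sub>R x) = c * L z x" "L 0 z = 0" "L z 0 = 0"
  "L (- x) z = - L x z" "L z (- x) = - L z x"
proof -
  have lin: "linear (L x)" "linear (\<lambda>x. L x y)" for x y
    using bil by (simp_all add: bilinear_form_def)
  show "L (x + y) z = L x z + L y z" "L z (x + y) = L z x + L z y"
    "L (x - y) z = L x z - L y z" "L z (x - y) = L z x - L z y"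
    "L (c *\<^sub>R x) z = c * L x z" "L z (c *\<^sub>R x) = c * L z x" "L 0 z = 0" "L z 0 = 0"
    "L (- x) z = - L x z" "L z (- x) = - L z x"
    using linear_add[OF lin(1)] linear_add[OF lin(2)] linear_diff[OF lin(1)] linear_diff[OF lin(2)]
      linear_scale[OF lin(1)] linear_scale[OF lin(2)] linear_0[OF lin(1)] linear_0[OF lin(2)]
      linear_neg[OF lin(1)] linear_neg[OF lin(2)] by simp_all
qed

lemma M_eq_0: "a \<in> V \<Longrightarrow> M a = 0 \<Longrightarrow> a = 0"
  using nondeg_right[of a] M_form[of a] by (simp add: L_simps)

lemma M_isometry: "a \<in> V \<Longrightarrow> b \<in> V \<Longrightarrow> L (M a) (M b) = L a b"
  using M_form M_in by metis

lemma bij_M: "bij_betw M V V"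
  by (rule fin_dim_inj_onto[OF fin fin order_refl lin_M M_in M_eq_0])

lemma seifert_form_pair: "seifert_form_pair V L"
  using fin nondeg_left nondeg_right
  by (auto simp: seifert_form_pair_def bilinear_on_def nondegenerate_on_def L_simps)

lemma monodromy_eq: "monodromy V L = restrict M V"
  unfolding monodromy_def
proof (rule the_equality)
  show "restrict M V \<in> extensional V \<and> lin_iso V V (restrict M V) \<and>
      (\<forall>a\<in>V. \<forall>b\<in>V. L (restrict M V a) b = L b a)"
    using bij_M M_form subspace_V
    by (auto simp: lin_iso_def linear_add[OF lin_M] linear_scale[OF lin_M] subspace_add subspace_scale
        cong: bij_betw_cong)
next
  fix f assume f: "f \<in> extensional V \<and> lin_iso V V f \<and> (\<forall>a\<in>V. \<forall>b\<in>V. L (f a) b = L b a)"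
  have "f a = M a" if "a \<in> V" for a
  proof -
    have "f a \<in> V" using f that by (auto simp: lin_iso_def bij_betw_def)
    then have "f a - M a \<in> V" using M_in that subspace_V subspace_diff by blast
    moreover have "L (f a - M a) b = 0" if "b \<in> V" for b
      using f \<open>a \<in> V\<close> that M_form by (simp add: L_simps)
    ultimately show ?thesis using nondeg_left[of "f a - M a"] by simp
  qed
  then show "f = restrict M V" using f by (auto simp: restrict_def extensional_def)
qed

text \<open>On \<open>Y\<close> the monodromy is bijective and exchanges the two arguments of the form, so nondegeneracy on
  one side implies nondegeneracy on the other.\<close>

lemma seif_subspace:
  assumes Y: "subspace Y" "Y \<subseteq> V" "\<And>y. y \<in> Y \<Longrightarrow> M y \<in> Y"
    and nd: "\<And>b. b \<in> Y \<Longrightarrow> (\<And>a. a \<in> Y \<Longrightarrow> L a b = 0) \<Longrightarrow> b = 0"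
  shows "seif Y L M"
proof -
  have fY: "fin_dim_space Y" by (rule fin_dim_subspace[OF fin Y(1,2)])
  have bij: "bij_betw M Y Y"
    by (rule fin_dim_inj_onto[OF fY fY order_refl lin_M Y(3)]) (use M_eq_0 Y(2) in auto)
  have ndl: "a = 0" if a: "a \<in> Y" "\<And>b. b \<in> Y \<Longrightarrow> L a b = 0" for a
  proof (rule nd[OF a(1)])
    fix b assume "b \<in> Y"
    then obtain c where "c \<in> Y" "M c = b" using bij by (metis bij_betw_imp_surj_on imageE)
    then show "L b a = 0" using M_form[of c a] a Y(2) by auto
  qed
  show ?thesis
    by (rule seif.intro[OF fY bil ndl nd lin_M Y(3) M_form[OF subsetD[OF Y(2)] subsetD[OF Y(2)]]])
qed

text \<open>The right orthogonal complement of \<open>Y\<close> is also left orthogonal to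
  \<open>Y\<close>, because \<open>L z y = L (M y) z\<close> and \<open>M y \<in> Y\<close>; and
  \<open>Y\<close> and this complement span \<open>V\<close> since the form represents functionals on
  \<open>Y\<close>.\<close>

lemma irreducible_subspace:
  assumes Y: "subspace Y" "Y \<subseteq> V" "\<And>y. y \<in> Y \<Longrightarrow> M y \<in> Y" "Y \<noteq> {0}"
    and nd: "\<And>b. b \<in> Y \<Longrightarrow> (\<And>a. a \<in> Y \<Longrightarrow> L a b = 0) \<Longrightarrow> b = 0"
    and irr: "irreducible_pair V L"
  shows "Y = V"
proof -
  have fY: "fin_dim_space Y" by (rule fin_dim_subspace[OF fin Y(1,2)])
  have bil': "bilinear_form (\<lambda>a b. L b a)" using bil by (simp add: bilinear_form_def)
  obtain G where G: "linear G" "\<And>c. G c \<in> Y" "\<And>c b. b \<in> Y \<Longrightarrow> L b (G c) = L b c"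
    using bilinear_representation[OF fY bil' bil' nd] by metis
  define Z where "Z = {v\<in>V. \<forall>y\<in>Y. L y v = 0}"
  have sZ: "subspace Z"
    using subspace_V by (auto simp: Z_def subspace_def L_simps)
  have orth: "L y z = 0 \<and> L z y = 0" if "y \<in> Y" "z \<in> Z" for y z
    using that Y(2,3) M_form[of y z] by (auto simp: Z_def)
  have "V = {x + y |x y. x \<in> Y \<and> y \<in> Z}"
  proof safe
    fix v assume v: "v \<in> V"
    have "v - G v \<in> V" using v G(2) Y(2) by (intro subspace_diff[OF subspace_V]) auto
    then have "v - G v \<in> Z" using G(3) by (auto simp: Z_def L_simps)
    then show "\<exists>x y. v = x + y \<and> x \<in> Y \<and> y \<in> Z" using G(2)[of v] by (metis add.commute diff_add_cancel)
  next
    fix x y assume "x \<in> Y" "y \<in> Z"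
    then show "x + y \<in> V" using Y(2) subspace_V by (auto simp: Z_def intro: subspace_add)
  qed
  moreover have "Y \<inter> Z = {0}"
    using nd orth subspace_0[OF Y(1)] subspace_0[OF sZ] by blast
  ultimately have "Z = {0}" using irr Y(1,4) sZ orth unfolding irreducible_pair_def by blast
  then show ?thesis using \<open>V = _\<close> by auto
qed

abbreviation "H \<equiv> V \<times> V"
abbreviation "Mc \<equiv> map_prod M M"
abbreviation "LC \<equiv> form_cplx L"

lemma LC_simps:
  "LC (x + y) z = LC x z + LC y z" "LC z (x + y) = LC z x + LC z y"
  "LC (x - y) z = LC x z - LC y z" "LC z (x - y) = LC z x - LC z y"
  "LC (cscale c x) z = c * LC x z" "LC z (cscale c x) = c * LC z x" "LC 0 z = 0" "LC z 0 = 0"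
  "LC (- x) z = - LC x z" "LC z (- x) = - LC z x"
  by (auto simp: form_cplx_def cscale_def L_simps complex_eq_iff algebra_simps)

lemma LC_sum: "LC (\<Sum>i\<in>I. f i) z = (\<Sum>i\<in>I. LC (f i) z)" "LC z (\<Sum>i\<in>I. f i) = (\<Sum>i\<in>I. LC z (f i))"
  by (induction I rule: infinite_finite_induct) (auto simp: LC_simps)

lemma LC_cconj: "LC (cconj x) (cconj y) = cnj (LC x y)"
  by (auto simp: form_cplx_def cconj_def L_simps complex_eq_iff)

lemma LC_real: "LC (a, 0) (b, 0) = of_real (L a b)"
  by (auto simp: form_cplx_def L_simps complex_eq_iff)

lemma subspace_H: "cplx.subspace H"
  by (rule subspace_Times[OF subspace_V])

lemma clinear_Mc: "clinear Mc"
  by (rule clinear_map_prod[OF lin_M])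

lemma Mc_in: "x \<in> H \<Longrightarrow> Mc x \<in> H"
  using M_in by auto

lemma cconj_in_H [simp]: "cconj x \<in> H \<longleftrightarrow> x \<in> H"
  by (rule cconj_Times[OF subspace_V])

lemma Mc_form: "x \<in> H \<Longrightarrow> y \<in> H \<Longrightarrow> LC (Mc x) y = LC y x"
  by (auto simp: form_cplx_def M_form)

lemma Mc_isometry: "x \<in> H \<Longrightarrow> y \<in> H \<Longrightarrow> LC (Mc x) (Mc y) = LC x y"
  by (auto simp: form_cplx_def M_isometry)

lemma Mc_eq_0: "x \<in> H \<Longrightarrow> Mc x = 0 \<Longrightarrow> x = 0"
  using M_eq_0 by (auto simp: zero_prod_def)

lemma LC_nondeg:
  assumes "x \<in> H"
  shows "(\<And>y. y \<in> H \<Longrightarrow> LC x y = 0) \<Longrightarrow> x = 0" "(\<And>y. y \<in> H \<Longrightarrow> LC y x = 0) \<Longrightarrow> x = 0"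
proof -
  have r: "(b, 0) \<in> H" if "b \<in> V" for b using that subspace_0[OF subspace_V] by simp
  have x: "fst x \<in> V" "snd x \<in> V" using assms by auto
  { assume *: "\<And>y. y \<in> H \<Longrightarrow> LC x y = 0"
    have "L (fst x) b = 0 \<and> L (snd x) b = 0" if "b \<in> V" for b
      using *[OF r[OF that]] by (simp add: form_cplx_def L_simps complex_eq_iff)
    then show "x = 0" using nondeg_left x by (metis prod.collapse zero_prod_def) }
  { assume *: "\<And>y. y \<in> H \<Longrightarrow> LC y x = 0"
    have "L b (fst x) = 0 \<and> L b (snd x) = 0" if "b \<in> V" for b
      using *[OF r[OF that]] by (simp add: form_cplx_def L_simps complex_eq_iff)
    then show "x = 0" using nondeg_right x by (metis prod.collapse zero_prod_def) }
qed

lemma monodromy_cplx_eq: "x \<in> H \<Longrightarrow> monodromy_cplx V L x = Mc x"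
  by (auto simp: monodromy_cplx_def monodromy_eq)

end

section \<open>Generalized eigenspaces and the Jordan--Chevalley decomposition\<close>

text \<open>On the generalized eigenspace for \<open>\<mu>\<close> this is the unipotent part of the
  monodromy minus the identity. In contrast to \<open>M - \<mu>\<close>, it is skew adjoint to leading
  order (lemma \<open>tw_adjoint\<close> below).\<close>

definition tw :: "('a::real_vector \<Rightarrow> 'a) \<Rightarrow> complex \<Rightarrow> 'a \<times> 'a \<Rightarrow> 'a \<times> 'a" where
  "tw M \<mu> x = cscale (1 / \<mu>) (map_prod M M x) - x"

lemma clinear_funpow:
  fixes f :: "'a::real_vector \<times> 'a \<Rightarrow> 'a \<times> 'a"
  shows "clinear f \<Longrightarrow> clinear (f ^^ k)"
  by (rule cplx.linear_funpow)

lemma funpow_in: "(\<And>x. x \<in> S \<Longrightarrow> f x \<in> S) \<Longrightarrow> x \<in> S \<Longrightarrow> (f ^^ k) x \<in> S"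
  by (induction k) auto

lemma funpow_commute_on:
  "(\<And>x. x \<in> S \<Longrightarrow> f x \<in> S) \<Longrightarrow> (\<And>x. x \<in> S \<Longrightarrow> g (f x) = f' (g x)) \<Longrightarrow> x \<in> S
    \<Longrightarrow> g ((f ^^ k) x) = (f' ^^ k) (g x)"
  by (induction k arbitrary: x) (auto simp: funpow_swap1)

context seif
begin

lemma clinear_tw: "clinear (tw M \<mu>)"
proof -
  have "clinear (\<lambda>x. cscale (1 / \<mu>) (Mc x) - x)"
    by (simp add: clinear_iff clinear_add[OF clinear_Mc] clinear_scale[OF clinear_Mc]
        cplx.scale_right_distrib cplx.scale_right_diff_distrib mult.commute)
  then show ?thesis by (simp add: tw_def[abs_def])
qed

lemmas clinear_tw_pow = clinear_funpow[OF clinear_tw]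

lemma tw_in: "x \<in> H \<Longrightarrow> tw M \<mu> x \<in> H"
  unfolding tw_def by (intro cplx.subspace_diff[OF subspace_H] cplx.subspace_scale[OF subspace_H] Mc_in)

lemma tw_pow_in: "x \<in> H \<Longrightarrow> (tw M \<mu> ^^ k) x \<in> H"
  by (rule funpow_in[OF tw_in])

lemma tw_cconj: "tw M (cnj \<mu>) (cconj x) = cconj (tw M \<mu> x)"
  by (simp add: tw_def cconj_map_prod[OF lin_M])

lemma tw_pow_cconj: "(tw M (cnj \<mu>) ^^ k) (cconj x) = cconj ((tw M \<mu> ^^ k) x)"
  by (induction k) (auto simp: tw_cconj)

lemma tw_pow_polyop: "(tw M \<mu> ^^ k) x = polyop cscale Mc ([:- 1, 1 / \<mu>:] ^ k) x"
proof -
  have "polyop cscale Mc [:- 1, 1 / \<mu>:] = tw M \<mu>"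
    by (rule ext) (simp add: tw_def)
  then show ?thesis by (simp add: cplx.polyop_power[OF clinear_Mc])
qed

lemma tw_pow_zero_iff:
  assumes "\<mu> \<noteq> 0"
  shows "(tw M \<mu> ^^ k) x = 0 \<longleftrightarrow> polyop cscale Mc ([:- \<mu>, 1:] ^ k) x = 0"
proof -
  have "[:- \<mu>, 1:] ^ k = Polynomial.smult (\<mu> ^ k) ([:- 1, 1 / \<mu>:] ^ k)"
    using assms by (simp flip: smult_power)
  then show ?thesis using assms by (simp add: tw_pow_polyop cplx.polyop_smult)
qed

lemma Mc_tw: "\<mu> \<noteq> 0 \<Longrightarrow> Mc x = cscale \<mu> (x + tw M \<mu> x)"
  by (simp add: tw_def)

lemma tw_Mc: "tw M \<mu> (Mc x) = Mc (tw M \<mu> x)"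
  by (simp add: tw_def clinear_diff[OF clinear_Mc] clinear_scale[OF clinear_Mc])

lemma tw_pow_Mc: "(tw M \<mu> ^^ k) (Mc x) = Mc ((tw M \<mu> ^^ k) x)"
  by (induction k) (auto simp: tw_Mc)

definition gev :: "complex \<Rightarrow> ('a \<times> 'a) set" where
  "gev \<mu> = {x \<in> H. \<exists>k. (tw M \<mu> ^^ k) x = 0}"

lemma tw_pow_zero_mono: "(tw M \<mu> ^^ k) x = 0 \<Longrightarrow> k \<le> l \<Longrightarrow> (tw M \<mu> ^^ l) x = 0"
  using clinear_0[OF clinear_tw_pow, of "l - k" \<mu>] funpow_add[of "l - k" k "tw M \<mu>"] by simp

lemma gev_in: "x \<in> gev \<mu> \<Longrightarrow> x \<in> H"
  by (simp add: gev_def)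

lemma gevI: "x \<in> H \<Longrightarrow> (tw M \<mu> ^^ k) x = 0 \<Longrightarrow> x \<in> gev \<mu>"
  by (auto simp: gev_def)

lemma subspace_gev: "cplx.subspace (gev \<mu>)"
  unfolding cplx.subspace_def
proof (intro conjI ballI allI)
  show "0 \<in> gev \<mu>" using cplx.subspace_0[OF subspace_H] by (auto simp: gev_def intro!: exI[of _ 0])
  fix x assume x: "x \<in> gev \<mu>"
  then obtain k where k: "x \<in> H" "(tw M \<mu> ^^ k) x = 0" by (auto simp: gev_def)
  show "cscale c x \<in> gev \<mu>" for c
    using k cplx.subspace_scale[OF subspace_H]
    by (intro gevI[of _ k]) (auto simp: clinear_scale[OF clinear_tw_pow])
  fix y assume "y \<in> gev \<mu>"
  then obtain l where l: "y \<in> H" "(tw M \<mu> ^^ l) y = 0" by (auto simp: gev_def)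
  show "x + y \<in> gev \<mu>"
    using k l cplx.subspace_add[OF subspace_H] tw_pow_zero_mono[of k \<mu> x "k + l"] tw_pow_zero_mono[of l \<mu> y "k + l"]
    by (intro gevI[of _ "k + l"]) (auto simp: clinear_add[OF clinear_tw_pow])
qed

text \<open>As \<open>1 / 0 = 0\<close>, the operator \<open>tw M 0\<close> is \<open>- id\<close>. This
  agrees with the fact that \<open>M\<close> is injective on \<open>V\<close>.\<close>

lemma gev_zero: "x \<in> gev 0 \<Longrightarrow> x = 0"
proof -
  have "(tw M 0 ^^ k) x = 0 \<Longrightarrow> x = 0" for k
    by (induction k) (auto simp: tw_def)
  then show "x \<in> gev 0 \<Longrightarrow> x = 0" by (auto simp: gev_def)
qed

lemma gev_cconj: "x \<in> gev \<mu> \<Longrightarrow> cconj x \<in> gev (cnj \<mu>)"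
  unfolding gev_def by (clarsimp simp del: mem_Sigma_iff) (metis cconj_simps(4) tw_pow_cconj)

lemma polyop_in: "x \<in> H \<Longrightarrow> polyop cscale Mc q x \<in> H"
  by (rule cplx.polyop_subspace[OF subspace_H Mc_in])

text \<open>For each vector of a basis, its iterated images under \<open>M\<close> are linearly
  dependent; multiply the polynomials obtained from these relations.\<close>

lemma exists_annihilator:
  "\<exists>Q. Q \<noteq> 0 \<and> (\<forall>x\<in>H. polyop cscale Mc Q x = 0)"
proof -
  have loc: "\<exists>q. q \<noteq> 0 \<and> polyop cscale Mc q x = 0" if x: "x \<in> H" for x
  proof -
    let ?v = "\<lambda>i. (Mc ^^ i) x"
    have "\<exists>c. (\<Sum>i\<le>dim V. cscale (c i) (?v i)) = 0 \<and> (\<exists>i\<le>dim V. c i \<noteq> 0)"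
    proof (rule ccontr)
      assume "\<not> ?thesis"
      then have *: "\<And>c. (\<Sum>i\<le>dim V. cscale (c i) (?v i)) = 0 \<Longrightarrow> \<forall>i\<in>{..dim V}. c i = 0" by auto
      note ind = indexed_independent[of "{..dim V}" ?v, OF finite_atMost *]
      have "?v ` {..dim V} \<subseteq> V \<times> V" by (rule image_subsetI) (rule funpow_in[OF Mc_in x])
      then have "card (?v ` {..dim V}) \<le> dim V" using Times_independent_card(2)[OF fin ind(2)] by blast
      then show False using card_image[OF ind(1)] by simp
    qed
    then obtain c j where c: "(\<Sum>i\<le>dim V. cscale (c i) (?v i)) = 0" "j \<le> dim V" "c j \<noteq> 0" by blast
    define q where "q = (\<Sum>i\<le>dim V. Polynomial.monom (c i) i)"
    have co: "coeff q i = (if i \<le> dim V then c i else 0)" for i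
      by (simp add: q_def coeff_sum if_distrib cong: if_cong)
    have "degree q \<le> dim V" by (rule degree_le) (simp add: co)
    then have "polyop cscale Mc q x = (\<Sum>i\<le>dim V. cscale (coeff q i) (?v i))" by (rule cplx.polyop_altdef)
    also have "\<dots> = 0" using c(1) by (simp add: co)
    finally show ?thesis using c(2,3) co[of j] by (metis coeff_0)
  qed
  obtain B where B: "finite B" "independent B" "span B = V" using fin_dim_basis[OF fin] by metis
  let ?B = "(\<lambda>b. (b, 0::'a)) ` B"
  have sB: "cplx.span ?B = H" using Times_basis(1)[OF B(1,2)] B(3) by simp
  have "\<exists>Q. Q \<noteq> 0 \<and> (\<forall>x\<in>S. polyop cscale Mc Q x = 0)" if "finite S" "S \<subseteq> H" for S
    using that
  proof (induction S rule: finite_induct)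
    case empty
    show ?case by (rule exI[of _ 1]) simp
  next
    case (insert x S)
    then obtain Q where Q: "Q \<noteq> 0" "\<forall>x\<in>S. polyop cscale Mc Q x = 0" by auto
    obtain q where q: "q \<noteq> 0" "polyop cscale Mc q x = 0" using loc insert by blast
    have "polyop cscale Mc (Q * q) x = 0" using q(2)
      by (simp add: cplx.polyop_mult[OF clinear_Mc] clinear_0[OF cplx.linear_polyop[OF clinear_Mc]])
    moreover have "polyop cscale Mc (Q * q) y = 0" if "y \<in> S" for y
      using Q(2) that by (subst mult.commute)
        (simp add: cplx.polyop_mult[OF clinear_Mc] clinear_0[OF cplx.linear_polyop[OF clinear_Mc]])
    ultimately show ?case using Q(1) q(1) by (intro exI[of _ "Q * q"]) auto
  qed
  then obtain Q where Q: "Q \<noteq> 0" "\<forall>x\<in>?B. polyop cscale Mc Q x = 0"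
    using B(1) sB cplx.span_superset[of ?B] by (metis finite_imageI)
  have "polyop cscale Mc Q x = 0" if "x \<in> H" for x
  proof -
    have "x \<in> cplx.span ?B" using that sB by simp
    moreover have "cplx.subspace {x. polyop cscale Mc Q x = 0}"
      using cplx.linear_polyop[OF clinear_Mc, of Q]
      by (auto simp: cplx.subspace_def clinear_0 clinear_add clinear_scale)
    ultimately show ?thesis using cplx.span_minimal[of ?B "{x. polyop cscale Mc Q x = 0}"] Q(2) by blast
  qed
  then show ?thesis using Q(1) by blast
qed

text \<open>The cofactor of \<open>(X - \<mu>) ^ order \<mu> Q\<close> in \<open>Q\<close> is a unit
  modulo every power of \<open>X - \<mu>\<close>.\<close>

lemma gev_annihilator_order:
  assumes Q: "Q \<noteq> 0" "polyop cscale Mc Q x = 0" and x: "x \<in> gev \<mu>" and "\<mu> \<noteq> 0"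
  shows "polyop cscale Mc ([:- \<mu>, 1:] ^ order \<mu> Q) x = 0"
proof -
  obtain j where j: "polyop cscale Mc ([:- \<mu>, 1:] ^ j) x = 0"
    using x tw_pow_zero_iff[OF \<open>\<mu> \<noteq> 0\<close>] by (auto simp: gev_def)
  obtain R where R: "Q = [:- \<mu>, 1:] ^ order \<mu> Q * R" "\<not> [:- \<mu>, 1:] dvd R"
    using order_decomp[OF Q(1)] by blast
  then have "poly R \<mu> \<noteq> 0" by (simp add: poly_eq_0_iff_dvd)
  then obtain a b where ab: "a * [:- \<mu>, 1:] ^ j + b * R = 1" using bezout_linear_power by blast
  let ?p = "[:- \<mu>, 1:] ^ order \<mu> Q"
  note [simp] = clinear_0[OF cplx.linear_polyop[OF clinear_Mc]]
  have "polyop cscale Mc ?p x = polyop cscale Mc (?p * (a * [:- \<mu>, 1:] ^ j + b * R)) x" by (simp add: ab)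
  also have "?p * (a * [:- \<mu>, 1:] ^ j + b * R) = ?p * a * [:- \<mu>, 1:] ^ j + b * (?p * R)"
    by (simp add: algebra_simps)
  also have "polyop cscale Mc \<dots> x = 0"
    using j Q(2) unfolding R(1)[symmetric] by (simp add: cplx.polyop_add cplx.polyop_mult[OF clinear_Mc])
  finally show ?thesis .
qed

text \<open>Split off the roots of \<open>Q\<close> one at a time: \<open>1 = a (X - \<mu>) ^ k + b
  R\<close> decomposes \<open>x\<close> into a vector killed by \<open>R\<close> and one killed by
  \<open>(X - \<mu>) ^ k\<close>.\<close>

lemma span_gev_polyop:
  assumes "Q \<noteq> 0" "x \<in> H" "polyop cscale Mc Q x = 0"
  shows "x \<in> cplx.span (\<Union>\<mu>. gev \<mu>)"
  using assms
proof (induction "degree Q" arbitrary: Q x rule: less_induct)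
  case less
  note [simp] = clinear_0[OF cplx.linear_polyop[OF clinear_Mc]]
  show ?case
  proof (cases "degree Q = 0")
    case True
    then obtain c where "Q = [:c:]" by (auto elim: degree_eq_zeroE)
    then have "x = 0" using less by simp
    then show ?thesis by (simp add: cplx.span_zero)
  next
    case False
    then obtain \<mu> where \<mu>: "poly Q \<mu> = 0" using fundamental_theorem_of_algebra constant_degree by metis
    let ?k = "order \<mu> Q"
    obtain R where R: "Q = [:- \<mu>, 1:] ^ ?k * R" "\<not> [:- \<mu>, 1:] dvd R"
      using order_decomp[OF less.prems(1)] by blast
    then have R\<mu>: "poly R \<mu> \<noteq> 0" by (simp add: poly_eq_0_iff_dvd)
    have R0: "R \<noteq> 0" using R(1) less.prems(1) by auto
    have "?k \<noteq> 0" using \<mu> less.prems(1) order_root by blast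
    moreover have "degree Q = ?k + degree R"
      by (subst (1) R(1)) (use R0 in \<open>simp add: degree_mult_eq degree_linear_power\<close>)
    ultimately have deg: "degree R < degree Q" by simp
    obtain a b where ab: "a * [:- \<mu>, 1:] ^ ?k + b * R = 1" using bezout_linear_power[OF R\<mu>] by blast
    define y where "y = polyop cscale Mc (a * [:- \<mu>, 1:] ^ ?k) x"
    define z where "z = polyop cscale Mc (b * R) x"
    have xyz: "x = y + z" unfolding y_def z_def by (simp add: ab flip: cplx.polyop_add)
    have "polyop cscale Mc R y = polyop cscale Mc (a * Q) x"
      unfolding y_def by (subst (2) R(1)) (simp add: mult.assoc mult.commute mult.left_commute flip: cplx.polyop_mult[OF clinear_Mc])
    then have "polyop cscale Mc R y = 0" using less.prems(3) by (simp add: cplx.polyop_mult[OF clinear_Mc])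
    moreover have "y \<in> H" unfolding y_def by (rule polyop_in[OF less.prems(2)])
    ultimately have ys: "y \<in> cplx.span (\<Union>\<mu>. gev \<mu>)" using less.hyps[OF deg R0] by blast
    have "polyop cscale Mc ([:- \<mu>, 1:] ^ ?k) z = polyop cscale Mc (b * Q) x"
      unfolding z_def by (subst (2) R(1)) (simp add: mult.assoc mult.commute mult.left_commute flip: cplx.polyop_mult[OF clinear_Mc])
    then have zk: "polyop cscale Mc ([:- \<mu>, 1:] ^ ?k) z = 0"
      using less.prems(3) by (simp add: cplx.polyop_mult[OF clinear_Mc])
    have zH: "z \<in> H" unfolding z_def by (rule polyop_in[OF less.prems(2)])
    have "z \<in> cplx.span (\<Union>\<mu>. gev \<mu>)"
    proof (cases "\<mu> = 0")
      case True
      have "(polyop cscale Mc [:0, 1:] ^^ j) z = 0 \<Longrightarrow> z = 0" for j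
        using zH
      proof (induction j arbitrary: z)
        case (Suc j)
        then have "Mc z = 0" using Mc_in by (simp add: funpow_swap1)
        then show ?case using Mc_eq_0 Suc.prems by blast
      qed simp
      then have "z = 0" using zk True by (simp add: cplx.polyop_power[OF clinear_Mc])
      then show ?thesis by (simp add: cplx.span_zero)
    next
      case False
      then have "z \<in> gev \<mu>" using zk zH tw_pow_zero_iff gevI by blast
      then show ?thesis by (intro cplx.span_base) blast
    qed
    then show ?thesis unfolding xyz using ys by (rule cplx.span_add[rotated])
  qed
qed

lemma span_gev: "cplx.span (\<Union>\<mu>. gev \<mu>) = H"
proof
  show "cplx.span (\<Union>\<mu>. gev \<mu>) \<subseteq> H"
    by (rule cplx.span_minimal[OF _ subspace_H]) (auto simp: gev_def)
  show "H \<subseteq> cplx.span (\<Union>\<mu>. gev \<mu>)"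
    using exists_annihilator span_gev_polyop by blast
qed

lemma H_induct:
  assumes "x \<in> H" and "cplx.subspace {x. P x}" and "\<And>\<mu> x. \<mu> \<noteq> 0 \<Longrightarrow> x \<in> gev \<mu> \<Longrightarrow> P x"
  shows "P x"
proof -
  have "P x" if "x \<in> gev \<mu>" for \<mu> x
    using assms(3)[OF _ that] gev_zero[of x] that cplx.subspace_0[OF assms(2)] by (cases "\<mu> = 0") auto
  then have "cplx.span (\<Union>\<mu>. gev \<mu>) \<subseteq> {x. P x}" using assms(2) by (intro cplx.span_minimal) auto
  then show ?thesis using assms(1) span_gev by auto
qed

text \<open>By the Chinese remainder theorem there are polynomials congruent to \<open>\<mu>\<close> and
  to \<open>X / \<mu>\<close> modulo a high power of \<open>X - \<mu>\<close>, for all eigenvalues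
  \<open>\<mu>\<close> simultaneously. Being polynomials in \<open>M\<close>, the semisimple and
  unipotent part commute with everything that commutes with \<open>M\<close>.\<close>

lemma exists_ss_unip_polynomials:
  "\<exists>s u K. \<forall>\<mu>. \<forall>x\<in>gev \<mu>. polyop cscale Mc s x = cscale \<mu> x \<and>
     polyop cscale Mc u x = cscale (1 / \<mu>) (Mc x) \<and> (tw M \<mu> ^^ K) x = 0"
proof -
  note [simp] = clinear_0[OF cplx.linear_polyop[OF clinear_Mc]]
  obtain Q where Q: "Q \<noteq> 0" "\<And>x. x \<in> H \<Longrightarrow> polyop cscale Mc Q x = 0" using exists_annihilator by blast
  let ?R = "{\<mu>. poly Q \<mu> = 0}"
  let ?K = "degree Q"
  have fR: "finite ?R" using Q(1) by (rule poly_roots_finite)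
  obtain s where s: "\<forall>c\<in>?R. [:- c, 1:] ^ ?K dvd s - [:c:]"
    using chinese_remainder_linear_powers[OF fR, of ?K "\<lambda>c. [:c:]"] by blast
  obtain u where u: "\<forall>c\<in>?R. [:- c, 1:] ^ ?K dvd u - [:0, 1 / c:]"
    using chinese_remainder_linear_powers[OF fR, of ?K "\<lambda>c. [:0, 1 / c:]"] by blast
  have K: "polyop cscale Mc ([:- \<mu>, 1:] ^ ?K) x = 0" and root: "x \<noteq> 0 \<Longrightarrow> \<mu> \<in> ?R"
    if x: "x \<in> gev \<mu>" "\<mu> \<noteq> 0" for \<mu> x
  proof -
    have z: "polyop cscale Mc ([:- \<mu>, 1:] ^ order \<mu> Q) x = 0"
      by (rule gev_annihilator_order[OF Q(1) _ x]) (use Q(2) x gev_in in blast)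
    have "?K = (?K - order \<mu> Q) + order \<mu> Q" using order_degree[OF Q(1)] by simp
    then have "[:- \<mu>, 1:] ^ ?K = [:- \<mu>, 1:] ^ (?K - order \<mu> Q) * [:- \<mu>, 1:] ^ order \<mu> Q"
      by (metis power_add)
    then show "polyop cscale Mc ([:- \<mu>, 1:] ^ ?K) x = 0"
      using z by (simp add: cplx.polyop_mult[OF clinear_Mc])
    show "\<mu> \<in> ?R" if "x \<noteq> 0"
    proof (rule ccontr)
      assume "\<mu> \<notin> ?R"
      then have "order \<mu> Q = 0" by (simp add: order_0I)
      then show False using z that by simp
    qed
  qed
  have eq: "polyop cscale Mc p x = polyop cscale Mc r x"
    if x: "x \<in> gev \<mu>" "\<mu> \<noteq> 0" and dvd: "[:- \<mu>, 1:] ^ ?K dvd p - r" for \<mu> x p r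
  proof -
    obtain a where "p - r = a * [:- \<mu>, 1:] ^ ?K" using dvd by (metis dvdE mult.commute)
    then have "polyop cscale Mc (p - r) x = 0" using K[OF x] by (simp add: cplx.polyop_mult[OF clinear_Mc])
    then show ?thesis by (simp add: cplx.polyop_diff)
  qed
  show ?thesis
  proof (intro exI allI ballI)
    fix \<mu> x assume x: "x \<in> gev \<mu>"
    show "polyop cscale Mc s x = cscale \<mu> x \<and> polyop cscale Mc u x = cscale (1 / \<mu>) (Mc x) \<and>
      (tw M \<mu> ^^ ?K) x = 0"
    proof (cases "x = 0")
      case True
      then show ?thesis using clinear_0[OF clinear_Mc] clinear_0[OF clinear_tw_pow] by (auto simp del: map_prod_simp)
    next
      case False
      then have \<mu>: "\<mu> \<noteq> 0" using x gev_zero by blast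
      have "\<mu> \<in> ?R" using root[OF x \<mu> False] .
      then show ?thesis
        using eq[OF x \<mu>, of s "[:\<mu>:]"] eq[OF x \<mu>, of u "[:0, 1 / \<mu>:]"] s u K[OF x \<mu>] tw_pow_zero_iff[OF \<mu>]
        by simp
    qed
  qed
qed

end

lemma clin_endoD:
  assumes "clin_endo A f"
  shows "x \<in> A \<Longrightarrow> f x \<in> A" "x \<in> A \<Longrightarrow> y \<in> A \<Longrightarrow> f (x + y) = f x + f y"
    "x \<in> A \<Longrightarrow> f (cscale c x) = cscale c (f x)"
  using assms unfolding clin_endo_def by blast+

lemma clin_endo_equalizer:
  assumes A: "cplx.subspace A" and f: "clin_endo A f" and g: "clin_endo A g"
  shows "cplx.subspace {x \<in> A. f x = g x}"
proof (rule cplx.subspaceI)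
  note [simp del] = mem_Sigma_iff
  have "0 \<in> A" by (rule cplx.subspace_0[OF A])
  then show "0 \<in> {x \<in> A. f x = g x}"
    using clin_endoD(3)[OF f, of 0 0] clin_endoD(3)[OF g, of 0 0] by simp
  show "x + y \<in> {x \<in> A. f x = g x}" if "x \<in> {x \<in> A. f x = g x}" "y \<in> {x \<in> A. f x = g x}" for x y
    using that cplx.subspace_add[OF A, of x y] clin_endoD(2)[OF f, of x y] clin_endoD(2)[OF g, of x y] by simp
  show "cscale c x \<in> {x \<in> A. f x = g x}" if "x \<in> {x \<in> A. f x = g x}" for c x
    using that cplx.subspace_scale[OF A, of x c] clin_endoD(3)[OF f, of x c] clin_endoD(3)[OF g, of x c] by simp
qed

context seif
begin

lemma clinear_eq_on_H:
  assumes f: "clinear f" and g: "clinear g" and x: "x \<in> H"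
    and eq: "\<And>\<mu> x. \<mu> \<noteq> 0 \<Longrightarrow> x \<in> gev \<mu> \<Longrightarrow> f x = g x"
  shows "f x = g x"
  using x
proof (rule H_induct)
  show "cplx.subspace {x. f x = g x}"
    by (rule cplx.subspaceI) (simp_all add: clinear_0[OF f] clinear_0[OF g] clinear_add[OF f] clinear_add[OF g]
        clinear_scale[OF f] clinear_scale[OF g])
qed (rule eq)

lemma clin_endo_polyop: "clin_endo H (polyop cscale Mc s)"
  using polyop_in cplx.linear_polyop[OF clinear_Mc, of s]
  unfolding clin_endo_def by (simp add: clinear_add clinear_scale del: mem_Sigma_iff)

definition unip_poly :: "complex poly" where
  "unip_poly = (SOME u. \<forall>\<mu>. \<forall>x\<in>gev \<mu>. polyop cscale Mc u x = cscale (1 / \<mu>) (Mc x))"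

text \<open>The unipotent part minus the identity, see \<open>unip_part_eq\<close> below. The definition
  as a polynomial in \<open>M\<close> makes it linear on the whole type.\<close>

definition T :: "'a \<times> 'a \<Rightarrow> 'a \<times> 'a" where
  "T x = polyop cscale Mc unip_poly x - x"

lemma polyop_unip: "x \<in> gev \<mu> \<Longrightarrow> polyop cscale Mc unip_poly x = cscale (1 / \<mu>) (Mc x)"
proof -
  have "\<exists>u. \<forall>\<mu>. \<forall>x\<in>gev \<mu>. polyop cscale Mc u x = cscale (1 / \<mu>) (Mc x)"
    using exists_ss_unip_polynomials by blast
  from someI_ex[OF this] show "x \<in> gev \<mu> \<Longrightarrow> polyop cscale Mc unip_poly x = cscale (1 / \<mu>) (Mc x)"
    unfolding unip_poly_def by blast
qed

lemma clinear_T: "clinear T"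
proof -
  note lin = cplx.linear_polyop[OF clinear_Mc, of unip_poly]
  have "clinear (\<lambda>x. polyop cscale Mc unip_poly x - x)"
    by (simp add: clinear_iff clinear_add[OF lin] clinear_scale[OF lin] cplx.scale_right_diff_distrib)
  then show ?thesis by (simp add: T_def[abs_def])
qed

lemmas clinear_T_pow = clinear_funpow[OF clinear_T]

lemma T_in: "x \<in> H \<Longrightarrow> T x \<in> H"
  unfolding T_def by (intro cplx.subspace_diff[OF subspace_H] polyop_in)

lemma T_pow_in: "x \<in> H \<Longrightarrow> (T ^^ k) x \<in> H"
  by (rule funpow_in[OF T_in])

lemma T_gev: "x \<in> gev \<mu> \<Longrightarrow> T x = tw M \<mu> x"
  by (simp add: T_def tw_def polyop_unip)

lemma tw_gev: "x \<in> gev \<mu> \<Longrightarrow> tw M \<mu> x \<in> gev \<mu>"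
proof -
  assume "x \<in> gev \<mu>"
  then obtain k where k: "x \<in> H" "(tw M \<mu> ^^ k) x = 0" by (auto simp: gev_def)
  then have "(tw M \<mu> ^^ k) (tw M \<mu> x) = 0"
    by (metis clinear_0[OF clinear_tw] funpow_swap1)
  then show "tw M \<mu> x \<in> gev \<mu>" using k tw_in gevI by blast
qed

lemma tw_pow_gev: "x \<in> gev \<mu> \<Longrightarrow> (tw M \<mu> ^^ k) x \<in> gev \<mu>"
  by (rule funpow_in[OF tw_gev])

lemma T_pow_gev: "x \<in> gev \<mu> \<Longrightarrow> (T ^^ k) x = (tw M \<mu> ^^ k) x"
  by (induction k) (auto simp: T_gev tw_pow_gev)

lemma T_nilpotent: "\<exists>K. \<forall>x\<in>H. (T ^^ K) x = 0"
proof -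
  obtain K where K: "\<And>\<mu> x. x \<in> gev \<mu> \<Longrightarrow> (tw M \<mu> ^^ K) x = 0"
    using exists_ss_unip_polynomials by blast
  have "(T ^^ K) x = 0" if "x \<in> H" for x
    using that
  proof (rule H_induct)
    show "cplx.subspace {x. (T ^^ K) x = 0}"
      using clinear_T_pow[of K] by (simp add: cplx.subspace_def clinear_0 clinear_add clinear_scale)
  qed (simp add: T_pow_gev K)
  then show ?thesis by blast
qed

lemma T_commute:
  assumes A: "clinear A" "\<And>x. x \<in> H \<Longrightarrow> A (Mc x) = Mc (A x)" and x: "x \<in> H"
  shows "A (T x) = T (A x)"
  using cplx.polyop_commute_on[OF A(1), of H Mc Mc x unip_poly] Mc_in A(2) x
  by (simp add: T_def clinear_diff[OF A(1)])

lemma T_pow_zero_mono: "(T ^^ k) x = 0 \<Longrightarrow> k \<le> l \<Longrightarrow> (T ^^ l) x = 0"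
  using clinear_0[OF clinear_T_pow, of "l - k"] funpow_add[of "l - k" k T] by simp

text \<open>The polynomials in \<open>M\<close> give a Jordan--Chevalley decomposition, and any other one agrees with it:
  an eigenvector of its semisimple part for \<open>\<mu>\<close> is a generalized eigenvector of \<open>M\<close> for \<open>\<mu>\<close>.\<close>

lemma ss_unip_unique:
  assumes dec: "ss_unip_decomp H (monodromy_cplx V L) S U"
  shows "x \<in> H \<Longrightarrow> S x = cscale \<mu> x \<Longrightarrow> x \<in> gev \<mu>"
    and "x \<in> gev \<mu> \<Longrightarrow> S x = cscale \<mu> x"
    and "x \<in> gev \<mu> \<Longrightarrow> U x = x + T x"
proof -
  have S: "clin_endo H S" "cplx.span {x \<in> H. \<exists>\<mu>. S x = cscale \<mu> x} = H"
    and U: "clin_endo H U" "\<exists>k. \<forall>x\<in>H. ((\<lambda>y. U y - y) ^^ k) x = 0"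
    and SU: "\<And>x. x \<in> H \<Longrightarrow> Mc x = S (U x)" "\<And>x. x \<in> H \<Longrightarrow> Mc x = U (S x)"
    using dec by (auto simp: ss_unip_decomp_def semisimple_on_def unipotent_on_def monodromy_cplx_eq simp del: mem_Sigma_iff map_prod_simp)
  obtain s where s: "\<And>\<mu> x. x \<in> gev \<mu> \<Longrightarrow> polyop cscale Mc s x = cscale \<mu> x"
    using exists_ss_unip_polynomials by blast
  note Ul = clin_endoD[OF U(1)] and Sl = clin_endoD[OF S(1)]
  have zero: "0 \<in> H" by (rule cplx.subspace_0[OF subspace_H])
  have ev: "x \<in> gev \<mu>" if x: "x \<in> H" "S x = cscale \<mu> x" for x \<mu>
  proof (cases "x = 0")
    case True
    then show ?thesis using cplx.subspace_0[OF subspace_gev] by simp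
  next
    case False
    have Mx: "Mc y = cscale \<mu> (U y)" if "y \<in> H" "S y = cscale \<mu> y" for y
      using SU(2)[OF that(1)] Ul(3)[OF that(1)] that(2) by simp
    have \<mu>: "\<mu> \<noteq> 0" using Mx[OF x] Mc_eq_0[OF x(1)] False by auto
    define K where "K = {y \<in> H. S y = cscale \<mu> y}"
    have UK: "U y \<in> H \<and> S (U y) = cscale \<mu> (U y)" if "y \<in> K" for y
    proof -
      have y: "y \<in> H" "S y = cscale \<mu> y" using that by (simp_all add: K_def)
      have "S (U y) = Mc y" using SU(1)[OF y(1)] by simp
      then show ?thesis using Mx[OF y] Ul(1)[OF y(1)] by simp
    qed
    have UmK: "U y - y \<in> K" if "y \<in> K" for y
    proof -
      have y: "y \<in> H" "S y = cscale \<mu> y" using that by (simp_all add: K_def)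
      have my: "cscale (- 1) y \<in> H" by (rule cplx.subspace_scale[OF subspace_H y(1)])
      have eq: "U y - y = U y + cscale (- 1) y" by simp
      have "S (U y - y) = S (U y) + S (cscale (- 1) y)"
        unfolding eq by (rule Sl(2)) (use UK[OF that] my in blast)+
      also have "\<dots> = cscale \<mu> (U y) + cscale (- 1) (S y)" using Sl(3)[OF y(1)] UK[OF that] by (simp only:)
      also have "\<dots> = cscale \<mu> (U y - y)" using y(2) by (simp add: cplx.scale_right_diff_distrib)
      finally show ?thesis
        using UK[OF that] y(1) cplx.subspace_diff[OF subspace_H] by (simp add: K_def del: mem_Sigma_iff)
    qed
    have tw: "tw M \<mu> y = U y - y" if "y \<in> K" for y
      using that Mx[of y] \<mu> by (simp add: tw_def K_def del: mem_Sigma_iff)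
    have "(tw M \<mu> ^^ k) y = ((\<lambda>y. U y - y) ^^ k) y \<and> ((\<lambda>y. U y - y) ^^ k) y \<in> K" if "y \<in> K" for k y
      by (induction k) (simp_all add: that tw UmK)
    moreover have "x \<in> K" using x by (simp add: K_def del: mem_Sigma_iff)
    moreover obtain k where "((\<lambda>y. U y - y) ^^ k) x = 0" using U(2) x(1) by blast
    ultimately have "(tw M \<mu> ^^ k) x = 0" by simp
    then show ?thesis by (rule gevI[OF x(1)])
  qed
  then show "x \<in> H \<Longrightarrow> S x = cscale \<mu> x \<Longrightarrow> x \<in> gev \<mu>" .
  have Ss: "S x = polyop cscale Mc s x" if "x \<in> H" for x
  proof -
    let ?P = "{x\<in>H. S x = polyop cscale Mc s x}"
    have "cplx.subspace ?P" by (rule clin_endo_equalizer[OF subspace_H S(1) clin_endo_polyop])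
    moreover have "{x \<in> H. \<exists>\<mu>. S x = cscale \<mu> x} \<subseteq> ?P"
    proof (rule subsetI)
      fix x assume "x \<in> {x \<in> H. \<exists>\<mu>. S x = cscale \<mu> x}"
      then obtain \<mu> where x: "x \<in> H" "S x = cscale \<mu> x" by blast
      then show "x \<in> ?P" using s[OF ev[OF x]] by simp
    qed
    ultimately have "cplx.span {x \<in> H. \<exists>\<mu>. S x = cscale \<mu> x} \<subseteq> ?P" by (rule cplx.span_minimal[rotated])
    then show ?thesis using that S(2) by blast
  qed
  show Sg: "S x = cscale \<mu> x" if "x \<in> gev \<mu>" for x \<mu>
    using Ss[OF gev_in[OF that]] s[OF that] by simp
  show "U x = x + T x" if x: "x \<in> gev \<mu>" for x \<mu>
  proof (cases "\<mu> = 0")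
    case True
    have "U 0 = 0" using Ul(3)[OF zero, of 0] by simp
    moreover have "x = 0" using x True gev_zero by blast
    ultimately show ?thesis using clinear_0[OF clinear_T] by simp
  next
    case False
    have "Mc x = U (cscale \<mu> x)" using SU(2)[OF gev_in[OF x]] Sg[OF x] by simp
    also have "\<dots> = cscale \<mu> (U x)" by (rule Ul(3)[OF gev_in[OF x]])
    finally have "U x = cscale (1 / \<mu>) (Mc x)" using False by simp
    then show ?thesis using T_gev[OF x] by (simp add: tw_def)
  qed
qed

lemma ss_unip_exists:
  "\<exists>S. ss_unip_decomp H (monodromy_cplx V L) S (restrict (\<lambda>x. x + T x) H)"
proof -
  obtain s where s: "\<And>\<mu> x. x \<in> gev \<mu> \<Longrightarrow> polyop cscale Mc s x = cscale \<mu> x"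
    using exists_ss_unip_polynomials by blast
  let ?s = "polyop cscale Mc s" and ?U = "\<lambda>x. x + T x"
  note lin = cplx.linear_polyop[OF clinear_Mc, of s]
  note sub = cplx.subspace_add[OF subspace_H] cplx.subspace_scale[OF subspace_H]
  have sH: "?s x \<in> H" if "x \<in> H" for x by (rule polyop_in[OF that])
  have UH: "?U x \<in> H" if "x \<in> H" for x by (rule cplx.subspace_add[OF subspace_H that T_in[OF that]])
  have lU: "clinear ?U" by (rule clinear_plus[OF clinear_id clinear_T])
  have eq: "Mc x = ?s (?U x)" "Mc x = ?U (?s x)" if "x \<in> H" for x
  proof -
    have step: "Mc x = ?s (?U x) \<and> Mc x = ?U (?s x)" if \<mu>: "\<mu> \<noteq> 0" and x: "x \<in> gev \<mu>" for \<mu> x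
    proof -
      have Tx: "T x \<in> gev \<mu>" using T_gev[OF x] tw_gev[OF x] by simp
      have "Mc x = cscale \<mu> (?U x)" using \<mu> T_gev[OF x] by (simp add: tw_def)
      then show ?thesis
        using s[OF x] s[OF Tx] by (simp add: clinear_add[OF lin] clinear_scale[OF clinear_T] cplx.scale_right_distrib)
    qed
    show "Mc x = ?s (?U x)"
      by (rule clinear_eq_on_H[OF clinear_Mc clinear_compose[OF lin lU] that]) (use step in blast)
    show "Mc x = ?U (?s x)"
      by (rule clinear_eq_on_H[OF clinear_Mc clinear_compose[OF lU lin] that]) (use step in blast)
  qed
  have "ss_unip_decomp H (monodromy_cplx V L) (restrict ?s H) (restrict ?U H)"
    unfolding ss_unip_decomp_def
  proof (intro conjI)
    show "semisimple_on H (restrict ?s H)"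
      unfolding semisimple_on_def
    proof
      show "clin_endo H (restrict ?s H)"
        using sH sub unfolding clin_endo_def by (auto simp: clinear_add[OF lin] clinear_scale[OF lin] simp del: mem_Sigma_iff)
      let ?E = "{x \<in> H. \<exists>\<mu>. restrict ?s H x = cscale \<mu> x}"
      have "(\<Union>\<mu>. gev \<mu>) \<subseteq> ?E"
      proof (rule subsetI)
        fix x assume "x \<in> (\<Union>\<mu>. gev \<mu>)"
        then obtain \<mu> where x: "x \<in> gev \<mu>" by blast
        have "restrict ?s H x = cscale \<mu> x" using s[OF x] gev_in[OF x] by simp
        then show "x \<in> ?E" using gev_in[OF x] by blast
      qed
      from cplx.span_mono[OF this] have "H \<subseteq> cplx.span ?E" unfolding span_gev .
      moreover have "cplx.span ?E \<subseteq> H" by (rule cplx.span_minimal[OF _ subspace_H]) blast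
      ultimately show "cplx.span ?E = H" by blast
    qed
    show "unipotent_on H (restrict ?U H)"
      unfolding unipotent_on_def
    proof
      show "clin_endo H (restrict ?U H)"
        using UH sub unfolding clin_endo_def
          by (auto simp: clinear_add[OF clinear_T] clinear_scale[OF clinear_T]
            cplx.scale_right_distrib algebra_simps simp del: mem_Sigma_iff)
      obtain K where K: "\<And>x. x \<in> H \<Longrightarrow> (T ^^ K) x = 0" using T_nilpotent by blast
      have pw: "((\<lambda>y. restrict ?U H y - y) ^^ k) x = (T ^^ k) x \<and> (T ^^ k) x \<in> H" if "x \<in> H" for k x
        by (induction k) (simp_all add: that T_in del: mem_Sigma_iff)
      then show "\<exists>k. \<forall>x\<in>H. ((\<lambda>y. restrict ?U H y - y) ^^ k) x = 0"
        using conjunct1[OF pw] K by (intro exI[of _ K] ballI) (simp del: mem_Sigma_iff)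
    qed
  qed (use eq sH UH in \<open>auto simp: monodromy_cplx_eq simp del: mem_Sigma_iff map_prod_simp\<close>)
  then show ?thesis by blast
qed

lemma ss_unip_decompD:
  assumes "ss_unip_decomp H (monodromy_cplx V L) S U" "ss_unip_decomp H (monodromy_cplx V L) S' U'"
  shows "S = S'" "U = U'"
proof -
  have ext: "f = g" if fg: "f \<in> extensional H" "g \<in> extensional H" "clin_endo H f" "clin_endo H g"
    and eq: "\<And>\<mu> x. x \<in> gev \<mu> \<Longrightarrow> f x = g x" for f g :: "'a \<times> 'a \<Rightarrow> 'a \<times> 'a"
  proof (rule extensionalityI[OF fg(1,2)])
    let ?P = "{x\<in>H. f x = g x}"
    have sub: "cplx.subspace ?P" by (rule clin_endo_equalizer[OF subspace_H fg(3,4)])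
    fix x assume "x \<in> H"
    have "cplx.span (\<Union>\<mu>. gev \<mu>) \<subseteq> ?P"
      by (rule cplx.span_minimal[OF _ sub]) (use eq gev_in in blast)
    then show "f x = g x" using \<open>x \<in> H\<close> span_gev by blast
  qed
  show "S = S'"
    using assms by (intro ext) (auto simp: ss_unip_decomp_def semisimple_on_def
        ss_unip_unique(2)[OF assms(1)] ss_unip_unique(2)[OF assms(2)] simp del: mem_Sigma_iff)
  show "U = U'"
    using assms by (intro ext) (auto simp: ss_unip_decomp_def unipotent_on_def
        ss_unip_unique(3)[OF assms(1)] ss_unip_unique(3)[OF assms(2)] simp del: mem_Sigma_iff)
qed

lemma ss_unip_parts: "ss_unip_decomp H (monodromy_cplx V L) (ss_part V L) (unip_part V L)"
  and unip_part_eq: "x \<in> H \<Longrightarrow> unip_part V L x = x + T x"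
proof -
  obtain S where S: "ss_unip_decomp H (monodromy_cplx V L) S (restrict (\<lambda>x. x + T x) H)"
    using ss_unip_exists by blast
  have s: "ss_part V L = S"
    unfolding ss_part_def by (rule the_equality) (use S ss_unip_decompD(1)[OF _ S] in blast)+
  have u: "unip_part V L = restrict (\<lambda>x. x + T x) H"
    unfolding unip_part_def by (rule the_equality) (use S ss_unip_decompD(2)[OF _ S] in blast)+
  show "ss_unip_decomp H (monodromy_cplx V L) (ss_part V L) (unip_part V L)"
    using S by (simp add: s u)
  show "x \<in> H \<Longrightarrow> unip_part V L x = x + T x" by (simp add: u del: mem_Sigma_iff)
qed

lemma gen_eigenspace_eq: "gen_eigenspace V L \<mu> = gev \<mu>"
proof (rule Set.set_eqI)
  fix x
  show "x \<in> gen_eigenspace V L \<mu> \<longleftrightarrow> x \<in> gev \<mu>"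
    unfolding gen_eigenspace_def
    using ss_unip_unique(1)[OF ss_unip_parts, of x \<mu>] ss_unip_unique(2)[OF ss_unip_parts, of x \<mu>] gev_in[of x \<mu>]
    by blast
qed

text \<open>A polynomial in the semisimple part that vanishes at all eigenvalues in \<open>I\<close>
  except \<open>\<nu>\<close> isolates the summand \<open>y \<nu>\<close>.\<close>

lemma gev_sum_eq_0:
  assumes "finite I" "\<And>\<mu>. \<mu> \<in> I \<Longrightarrow> y \<mu> \<in> gev \<mu>" "(\<Sum>\<mu>\<in>I. y \<mu>) = 0" "\<nu> \<in> I"
  shows "y \<nu> = 0"
proof -
  obtain s where s: "\<And>\<mu> x. x \<in> gev \<mu> \<Longrightarrow> polyop cscale Mc s x = cscale \<mu> x"
    using exists_ss_unip_polynomials by blast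
  let ?S = "polyop cscale Mc s"
  note lin = cplx.linear_polyop[OF clinear_Mc, of s]
  have ev: "polyop cscale ?S q x = cscale (poly q \<mu>) x" if "x \<in> gev \<mu>" for q x \<mu>
    using that
  proof (induction q arbitrary: x)
    case 0 then show ?case by simp
  next
    case (pCons a q)
    have "cscale \<mu> x \<in> gev \<mu>" using pCons.prems by (rule cplx.subspace_scale[OF subspace_gev])
    then show ?case
      using pCons s[OF pCons.prems] by (simp add: cplx.polyop_pCons cplx.scale_left_distrib mult.commute)
  qed
  define q where "q = (\<Prod>c\<in>I - {\<nu>}. [:- c, 1:])"
  have q\<nu>: "poly q \<nu> \<noteq> 0" using assms(1) by (auto simp: q_def poly_prod)
  have q0: "poly q \<mu> = 0" if "\<mu> \<in> I" "\<mu> \<noteq> \<nu>" for \<mu>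
    unfolding q_def poly_prod by (rule prod_zero) (use that assms(1) in auto)
  have "0 = polyop cscale ?S q (\<Sum>\<mu>\<in>I. y \<mu>)"
    using assms(3) clinear_0[OF cplx.linear_polyop[OF lin]] by simp
  also have "\<dots> = (\<Sum>\<mu>\<in>I. cscale (poly q \<mu>) (y \<mu>))"
    unfolding clinear_sum[OF cplx.linear_polyop[OF lin]] by (rule sum.cong) (use ev assms(2) in auto)
  also have "\<dots> = cscale (poly q \<nu>) (y \<nu>)"
    using assms(1,4) q0 by (subst sum.remove[of _ \<nu>]) auto
  finally show ?thesis using q\<nu> by simp
qed


text \<open>The logarithm \<open>N\<close> is \<open>T\<close> times a unipotent operator. So \<open>N\<close> and \<open>T\<close> have the same image, and their
  \<open>(n - 1)\<close>-st powers agree where \<open>T ^ n = 0\<close>.\<close>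

lemma nilp_part_eq:
  "\<exists>W. clinear W \<and> (\<forall>x\<in>H. W x \<in> H \<and> W (T x) = T (W x) \<and> nilp_part V L x = T x + T (T (W x)))"
proof -
  define c where "c k = ((- 1) ^ (k + 1) / of_nat k :: complex)" for k
  define W where "W x = (\<Sum>k = 2..dim V. cscale (c k) ((T ^^ (k - 2)) x))" for x
  have lin: "clinear W"
    by (auto simp: clinear_iff W_def clinear_add[OF clinear_T_pow] clinear_scale[OF clinear_T_pow]
        cplx.scale_right_distrib sum.distrib cplx.scale_sum_right mult.commute)
  have WH: "W x \<in> H" if "x \<in> H" for x
    unfolding W_def by (intro cplx.subspace_sum[OF subspace_H] cplx.subspace_scale[OF subspace_H] T_pow_in that)
  have WT: "W (T x) = T (W x)" for x
    by (simp add: W_def clinear_sum[OF clinear_T] clinear_scale[OF clinear_T] funpow_swap1)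
  have "nilp_part V L x = T x + T (T (W x))" if x: "x \<in> H" for x
  proof -
    have pw: "((\<lambda>y. unip_part V L y - y) ^^ k) x = (T ^^ k) x" for k
      by (induction k) (simp_all add: unip_part_eq T_pow_in[OF x] del: mem_Sigma_iff)
    have nx: "nilp_part V L x = (\<Sum>k = 1..dim V. cscale (c k) ((T ^^ k) x))"
      by (simp add: nilp_part_def pw c_def)
    show ?thesis
    proof (cases "dim V = 0")
      case True
      obtain B where "finite B" "span B = V" "card B = dim V" using fin_dim_basis[OF fin] by metis
      then have "V = {0}" using True by auto
      then have "x = 0" using x by (auto simp: zero_prod_def)
      then show ?thesis unfolding nx using True clinear_0[OF lin] clinear_0[OF clinear_T] by simp
    next
      case False
      then have "{1..dim V} = insert 1 {2..dim V}" by auto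
      then have "nilp_part V L x = T x + (\<Sum>k = 2..dim V. cscale (c k) ((T ^^ k) x))"
        unfolding nx by (simp add: c_def)
      also have "(\<Sum>k = 2..dim V. cscale (c k) ((T ^^ k) x)) = T (T (W x))"
        unfolding W_def clinear_sum[OF clinear_T] clinear_scale[OF clinear_T]
      proof (rule sum.cong)
        fix k assume "k \<in> {2..dim V}"
        then obtain j where "k = Suc (Suc j)" by (metis Suc_le_D atLeastAtMost_iff numeral_2_eq_2 Suc_le_mono)
        then show "cscale (c k) ((T ^^ k) x) = cscale (c k) (T (T ((T ^^ (k - 2)) x)))" by simp
      qed simp
      finally show ?thesis .
    qed
  qed
  then show ?thesis using lin WH WT by blast
qed

lemma nilp_part_pow:
  assumes "x \<in> H" "(T ^^ Suc j) x = 0"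
  shows "(nilp_part V L ^^ j) x = (T ^^ j) x"
proof -
  obtain W where W: "clinear W" "\<And>x. x \<in> H \<Longrightarrow> W x \<in> H" "\<And>x. x \<in> H \<Longrightarrow> W (T x) = T (W x)"
    "\<And>x. x \<in> H \<Longrightarrow> nilp_part V L x = T x + T (T (W x))"
    using nilp_part_eq by blast
  have WT: "W ((T ^^ k) x) = (T ^^ k) (W x)" if "x \<in> H" for k x
    by (rule funpow_commute_on[of H T W T x k, OF T_in W(3) that])
  show ?thesis
    using assms
  proof (induction j arbitrary: x)
    case (Suc j)
    have x: "x \<in> H" by fact
    have Wz: "(T ^^ Suc (Suc j)) (W x) = 0"
      using WT[OF x, of "Suc (Suc j)"] Suc.prems(2) clinear_0[OF W(1)] by simp
    let ?y = "nilp_part V L x"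
    have y: "?y = T x + T (T (W x))" by (rule W(4)[OF x])
    have yH: "?y \<in> H" unfolding y by (intro cplx.subspace_add[OF subspace_H] T_in W(2) x)
    have "(T ^^ Suc j) ?y = (T ^^ Suc (Suc j)) x + (T ^^ Suc (Suc (Suc j))) (W x)"
      unfolding y clinear_add[OF clinear_T_pow] by (simp add: funpow_swap1)
    also have "\<dots> = 0" using Suc.prems(2) Wz clinear_0[OF clinear_T] by simp
    finally have "(nilp_part V L ^^ j) ?y = (T ^^ j) ?y" by (rule Suc.IH[OF yH])
    also have "\<dots> = (T ^^ Suc j) x + (T ^^ Suc (Suc j)) (W x)"
      unfolding y clinear_add[OF clinear_T_pow] by (simp add: funpow_swap1)
    finally show ?case using Wz by (simp add: funpow_swap1)
  qed simp
qed

text \<open>One inclusion is the formula for \<open>N\<close>. For the other one, \<open>T (T ^ k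
  x)\<close> is \<open>N (T ^ k x)\<close> up to an element of the image of \<open>T ^ (k + 2)\<close>;
  descend from a power of \<open>T\<close> that vanishes.\<close>

lemma nilp_part_image: "nilp_part V L ` H = T ` H"
proof -
  let ?N = "nilp_part V L"
  obtain W where W: "clinear W" "\<And>x. x \<in> H \<Longrightarrow> W x \<in> H" "\<And>x. x \<in> H \<Longrightarrow> W (T x) = T (W x)"
    "\<And>x. x \<in> H \<Longrightarrow> ?N x = T x + T (T (W x))"
    using nilp_part_eq by blast
  obtain K where K: "\<And>x. x \<in> H \<Longrightarrow> (T ^^ K) x = 0" using T_nilpotent by blast
  have zero: "0 \<in> H" by (rule cplx.subspace_0[OF subspace_H])
  have N0: "?N 0 = 0" using W(4)[OF zero] clinear_0[OF W(1)] clinear_0[OF clinear_T] by simp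
  have Ndiff: "?N x - ?N y = ?N (x - y)" if "x \<in> H" "y \<in> H" for x y
    using W(4)[OF that(1)] W(4)[OF that(2)] W(4)[OF cplx.subspace_diff[OF subspace_H that]]
    by (simp add: clinear_diff[OF W(1)] clinear_diff[OF clinear_T])
  have "\<forall>x\<in>H. T ((T ^^ k) x) \<in> ?N ` H" if "k \<le> K" for k
    using that
  proof (induction k rule: inc_induct)
    case base
    show ?case
    proof
      fix x assume "x \<in> H"
      then have "T ((T ^^ K) x) = ?N 0" using K[of x] N0 clinear_0[OF clinear_T] by simp
      then show "T ((T ^^ K) x) \<in> ?N ` H" using imageI[OF zero, of ?N] by simp
    qed
  next
    case (step k)
    show ?case
    proof
      fix x assume x: "x \<in> H"
      have tx: "(T ^^ k) x \<in> H" by (rule T_pow_in[OF x])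
      have "W ((T ^^ k) x) = (T ^^ k) (W x)"
        by (rule funpow_commute_on[of H T W T x k, OF T_in W(3) x])
      then have "T ((T ^^ k) x) = ?N ((T ^^ k) x) - T ((T ^^ Suc k) (W x))"
        using W(4)[OF tx] by simp
      moreover obtain z where "T ((T ^^ Suc k) (W x)) = ?N z" "z \<in> H"
        using bspec[OF step.IH W(2)[OF x]] by (rule imageE)
      ultimately have "T ((T ^^ k) x) = ?N ((T ^^ k) x - z)" "(T ^^ k) x - z \<in> H"
        using Ndiff[OF tx] cplx.subspace_diff[OF subspace_H tx] by (simp_all del: mem_Sigma_iff)
      then show "T ((T ^^ k) x) \<in> ?N ` H" by (rule image_eqI)
    qed
  qed
  from this[of 0] have "T ` H \<subseteq> ?N ` H" by (auto simp del: mem_Sigma_iff)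
  moreover have "?N x = T (x + T (W x))" "x + T (W x) \<in> H" if "x \<in> H" for x
    using W(4)[OF that] T_in[OF W(2)[OF that]] cplx.subspace_add[OF subspace_H that]
    by (simp_all add: clinear_add[OF clinear_T] del: mem_Sigma_iff)
  then have "?N ` H \<subseteq> T ` H" by blast
  ultimately show ?thesis by blast
qed

end

section \<open>Orthogonality relations\<close>

context seif
begin

text \<open>Expand \<open>L x y = L (M x) (M y)\<close> with \<open>M = \<mu> (1 + tw M \<mu>)\<close> on
  the left and \<open>M = \<nu> (1 + tw M \<nu>)\<close> on the right; by induction only \<open>\<mu>
  \<nu> L x y\<close> remains.\<close>

lemma tw_pow_orthogonal:
  assumes "\<mu> \<noteq> 0" "\<nu> \<noteq> 0" "\<mu> * \<nu> \<noteq> 1"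
    and "x \<in> H" "y \<in> H" "(tw M \<mu> ^^ k) x = 0" "(tw M \<nu> ^^ l) y = 0"
  shows "LC x y = 0"
  using assms(4-)
proof (induction "k + l" arbitrary: k l x y rule: less_induct)
  case less
  show ?case
  proof (cases "k = 0 \<or> l = 0")
    case True
    then show ?thesis using less.prems by (auto simp: LC_simps)
  next
    case False
    then obtain k' l' where kl: "k = Suc k'" "l = Suc l'" by (metis not0_implies_Suc)
    let ?x = "tw M \<mu> x" and ?y = "tw M \<nu> y"
    have H: "?x \<in> H" "?y \<in> H" by (intro tw_in less.prems)+
    have z: "(tw M \<mu> ^^ k') ?x = 0" "(tw M \<nu> ^^ l') ?y = 0"
      using less.prems(3,4) by (simp_all add: kl funpow_swap1)
    have "LC x y = LC (Mc x) (Mc y)" using Mc_isometry less.prems(1,2) by simp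
    also have "\<dots> = \<mu> * \<nu> * (LC x y + LC x ?y + LC ?x y + LC ?x ?y)"
      unfolding Mc_tw[OF assms(1), of x] Mc_tw[OF assms(2), of y] by (simp add: LC_simps algebra_simps)
    also have "LC x ?y = 0" by (rule less.hyps[OF _ less.prems(1) H(2) less.prems(3) z(2)]) (simp add: kl)
    also have "LC ?x y = 0" by (rule less.hyps[OF _ H(1) less.prems(2) z(1) less.prems(4)]) (simp add: kl)
    also have "LC ?x ?y = 0" by (rule less.hyps[OF _ H z]) (simp add: kl)
    finally have "(1 - \<mu> * \<nu>) * LC x y = 0" by (simp add: algebra_simps)
    then show ?thesis using assms(3) by simp
  qed
qed

lemma gev_orthogonal:
  assumes "x \<in> gev \<mu>" "y \<in> gev \<nu>" "\<mu> * \<nu> \<noteq> 1"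
  shows "LC x y = 0"
proof (cases "\<mu> = 0 \<or> \<nu> = 0")
  case True
  then have "x = 0 \<or> y = 0" using gev_zero assms(1,2) by blast
  then show ?thesis by (auto simp: LC_simps)
next
  case False
  then show ?thesis using assms tw_pow_orthogonal[of \<mu> \<nu> x y] unfolding gev_def by blast
qed

lemma add_add_eq_0D: "a + (b + c) = 0 \<Longrightarrow> a = - b - c" for a b c :: complex
  by (metis add.assoc add_diff_cancel_right' diff_0 add.commute)

text \<open>To leading order, \<open>tw M \<mu>\<close> and \<open>tw M (1 / \<mu>)\<close> are skew adjoint.\<close>

lemma tw_adjoint:
  assumes "\<mu> \<noteq> 0" "x \<in> H" "y \<in> H"
  shows "LC (tw M \<mu> x) y = - LC x (tw M (1 / \<mu>) y) - LC (tw M \<mu> x) (tw M (1 / \<mu>) y)"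
proof -
  have "LC x y = LC (Mc x) (Mc y)" using Mc_isometry assms by simp
  also have "Mc x = cscale \<mu> (x + tw M \<mu> x)" by (rule Mc_tw[OF assms(1)])
  also have "Mc y = cscale (1 / \<mu>) (y + tw M (1 / \<mu>) y)" by (rule Mc_tw) (use assms(1) in simp)
  finally have "LC x y = LC (x + tw M \<mu> x) (y + tw M (1 / \<mu>) y)"
    using assms(1) by (simp add: LC_simps(5,6))
  then have sum: "LC (tw M \<mu> x) y + (LC x (tw M (1 / \<mu>) y) + LC (tw M \<mu> x) (tw M (1 / \<mu>) y)) = 0"
    by (simp add: LC_simps algebra_simps)
  show ?thesis by (rule add_add_eq_0D[OF sum])
qed

text \<open>Moving powers from one argument to the other: all that matters is that \<open>f\<close> and \<open>- g\<close> are
  adjoint up to a term of higher order.\<close>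

lemma skew_pow_form_zero:
  assumes adj: "\<And>u w. u \<in> H \<Longrightarrow> w \<in> H \<Longrightarrow> LC (f u) w = - LC u (g w) - LC (f u) (g w)"
    and f: "\<And>u. u \<in> H \<Longrightarrow> f u \<in> H" and g: "\<And>u. u \<in> H \<Longrightarrow> g u \<in> H"
    and xy: "x \<in> H" "y \<in> H" and zero: "\<And>k. n \<le> k \<Longrightarrow> (g ^^ k) y = 0"
    and "n \<le> i + j"
  shows "LC ((f ^^ i) x) ((g ^^ j) y) = 0"
  using \<open>n \<le> i + j\<close>
proof (induction i arbitrary: j)
  case 0
  then have "(g ^^ j) y = 0" using zero by simp
  then show ?case by (simp add: LC_simps)
next
  case (Suc i)
  show ?case
  proof (cases "j \<ge> n")
    case True
    then show ?thesis by (simp add: zero LC_simps)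
  next
    case False
    then have "j \<le> n" by simp
    then have "n \<le> Suc i + j \<longrightarrow> LC ((f ^^ Suc i) x) ((g ^^ j) y) = 0"
    proof (induction j rule: inc_induct)
      case base
      show ?case by (simp add: zero LC_simps)
    next
      case (step j)
      show ?case
      proof
        assume le: "n \<le> Suc i + j"
        have "LC ((f ^^ Suc i) x) ((g ^^ j) y)
            = - LC ((f ^^ i) x) ((g ^^ Suc j) y) - LC ((f ^^ Suc i) x) ((g ^^ Suc j) y)"
          using adj[OF funpow_in[where k = i, OF f xy(1)] funpow_in[where k = j, OF g xy(2)]] by simp
        then show "LC ((f ^^ Suc i) x) ((g ^^ j) y) = 0"
          using Suc.IH[of "Suc j"] step.IH le by simp
      qed
    qed
    then show ?thesis using Suc.prems by simp
  qed
qed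

lemma skew_pow_form_shift:
  assumes adj: "\<And>u w. u \<in> H \<Longrightarrow> w \<in> H \<Longrightarrow> LC (f u) w = - LC u (g w) - LC (f u) (g w)"
    and f: "\<And>u. u \<in> H \<Longrightarrow> f u \<in> H" and g: "\<And>u. u \<in> H \<Longrightarrow> g u \<in> H"
    and xy: "x \<in> H" "y \<in> H" and zero: "\<And>k. n \<le> k \<Longrightarrow> (g ^^ k) y = 0"
    and "n = Suc (i + j)"
  shows "LC ((f ^^ i) x) ((g ^^ j) y) = (- 1) ^ i * LC x ((g ^^ (n - 1)) y)"
  using \<open>n = Suc (i + j)\<close>
proof (induction i arbitrary: j)
  case 0
  then show ?case by simp
next
  case (Suc i)
  have "LC ((f ^^ Suc i) x) ((g ^^ j) y)
      = - LC ((f ^^ i) x) ((g ^^ Suc j) y) - LC ((f ^^ Suc i) x) ((g ^^ Suc j) y)"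
    using adj[OF funpow_in[where k = i, OF f xy(1)] funpow_in[where k = j, OF g xy(2)]] by simp
  also have "LC ((f ^^ Suc i) x) ((g ^^ Suc j) y) = 0"
    by (rule skew_pow_form_zero[where n = n and f = f and g = g, OF adj f g xy zero]) (use Suc.prems in simp_all)
  also have "LC ((f ^^ i) x) ((g ^^ Suc j) y) = (- 1) ^ i * LC x ((g ^^ (n - 1)) y)"
    by (rule Suc.IH) (use Suc.prems in simp)
  finally show ?case by simp
qed

lemma tw_pow_form_zero:
  assumes "\<mu> \<noteq> 0" "x \<in> H" "y \<in> H" "(tw M (1 / \<mu>) ^^ n) y = 0" "n \<le> i + j"
  shows "LC ((tw M \<mu> ^^ i) x) ((tw M (1 / \<mu>) ^^ j) y) = 0"
  by (rule skew_pow_form_zero[OF tw_adjoint[OF assms(1)] tw_in tw_in assms(2,3)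
        tw_pow_zero_mono[OF assms(4)] assms(5)])

lemma tw_pow_form_shift:
  assumes "\<mu> \<noteq> 0" "x \<in> H" "y \<in> H" "(tw M (1 / \<mu>) ^^ n) y = 0" "n = Suc (i + j)"
  shows "LC ((tw M \<mu> ^^ i) x) ((tw M (1 / \<mu>) ^^ j) y) = (- 1) ^ i * LC x ((tw M (1 / \<mu>) ^^ (n - 1)) y)"
  by (rule skew_pow_form_shift[OF tw_adjoint[OF assms(1)] tw_in tw_in assms(2,3)
        tw_pow_zero_mono[OF assms(4)] assms(5)])

text \<open>The vector \<open>(tw M \<mu> ^^ (n - 1)) x\<close> is an eigenvector of \<open>M\<close>, so
  the defining property of the monodromy exchanges the arguments at the price of a factor
  \<open>\<mu>\<close>; moving the power back gives the sign. For \<open>\<mu> = \<plusminus>1\<close>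
  this factor decides between one and two Jordan blocks.\<close>

lemma leading_form_swap:
  assumes "\<mu> \<noteq> 0" "x \<in> H" "y \<in> H" "(tw M \<mu> ^^ n) x = 0" "(tw M (1 / \<mu>) ^^ n) y = 0" "n \<ge> 1"
  shows "LC y ((tw M \<mu> ^^ (n - 1)) x) = \<mu> * (- 1) ^ (n - 1) * LC x ((tw M (1 / \<mu>) ^^ (n - 1)) y)"
proof -
  let ?z = "(tw M \<mu> ^^ (n - 1)) x"
  have "tw M \<mu> ?z = (tw M \<mu> ^^ Suc (n - 1)) x" by simp
  also have "\<dots> = 0" using assms(4,6) by (metis Suc_pred' less_eq_Suc_le One_nat_def)
  finally have "Mc ?z = cscale \<mu> ?z" using Mc_tw[OF assms(1), of ?z] by simp
  then have "LC y ?z = \<mu> * LC ?z y" using Mc_form[OF tw_pow_in[OF assms(2)] assms(3), of "n - 1" \<mu>] by (simp add: LC_simps)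
  also have "LC ?z y = (- 1) ^ (n - 1) * LC x ((tw M (1 / \<mu>) ^^ (n - 1)) y)"
    using tw_pow_form_shift[OF assms(1-3,5), of "n - 1" 0] assms(6) by simp
  finally show ?thesis by simp
qed

end


section \<open>Frames\<close>

text \<open>The Jordan blocks of each type are numbered by \<open>i < nblocks p\<close>. All have the size \<open>bsize p\<close>, and \<open>bev p i\<close>
  is the eigenvalue. The form pairs the block \<open>i\<close> with \<open>bdual p i\<close>, and conjugation maps it to \<open>bconj p i\<close>.
  The leading coefficient \<open>bform p i\<close> is normalized on one block, and \<open>leading_form_swap\<close> and conjugation
  determine it on the others.\<close>

fun nblocks :: "seif_type \<Rightarrow> nat" where
  "nblocks (Seif1 lam n \<epsilon>) = 1"
| "nblocks (Seif2 lam n) = 2"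
| "nblocks (Seif3 lam n \<zeta>) = 2"
| "nblocks (Seif4 lam n) = 2"
| "nblocks (Seif5 lam n) = 4"

fun bsize :: "seif_type \<Rightarrow> nat" where
  "bsize (Seif1 lam n \<epsilon>) = n"
| "bsize (Seif2 lam n) = n"
| "bsize (Seif3 lam n \<zeta>) = n"
| "bsize (Seif4 lam n) = n"
| "bsize (Seif5 lam n) = n"

fun bev :: "seif_type \<Rightarrow> nat \<Rightarrow> complex" where
  "bev (Seif1 lam n \<epsilon>) i = of_real lam"
| "bev (Seif2 lam n) i = of_real lam"
| "bev (Seif3 lam n \<zeta>) i = (if i = 0 then lam else cnj lam)"
| "bev (Seif4 lam n) i = (if i = 0 then of_real lam else 1 / of_real lam)"
| "bev (Seif5 lam n) i = (if i = 0 then lam else if i = 1 then 1 / lam else if i = 2 then cnj lam else 1 / cnj lam)"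

fun bdual :: "seif_type \<Rightarrow> nat \<Rightarrow> nat" where
  "bdual (Seif1 lam n \<epsilon>) i = i"
| "bdual (Seif2 lam n) i = 1 - i"
| "bdual (Seif3 lam n \<zeta>) i = 1 - i"
| "bdual (Seif4 lam n) i = 1 - i"
| "bdual (Seif5 lam n) i = (if i = 0 then 1 else if i = 1 then 0 else if i = 2 then 3 else 2)"

fun bconj :: "seif_type \<Rightarrow> nat \<Rightarrow> nat" where
  "bconj (Seif1 lam n \<epsilon>) i = i"
| "bconj (Seif2 lam n) i = i"
| "bconj (Seif3 lam n \<zeta>) i = 1 - i"
| "bconj (Seif4 lam n) i = i"
| "bconj (Seif5 lam n) i = (if i = 0 then 2 else if i = 1 then 3 else if i = 2 then 0 else 1)"

fun bform :: "seif_type \<Rightarrow> nat \<Rightarrow> complex" where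
  "bform (Seif1 lam n \<epsilon>) i = of_real \<epsilon>"
| "bform (Seif2 lam n) i = (if i = 0 then 1 else - 1)"
| "bform (Seif3 lam n \<zeta>) i = (if i = 0 then \<zeta> else cnj \<zeta>)"
| "bform (Seif4 lam n) i = (if i = 0 then 1 else of_real lam * (- 1) ^ (n - 1))"
| "bform (Seif5 lam n) i = (if i = 0 \<or> i = 2 then 1 else if i = 1 then lam * (- 1) ^ (n - 1)
      else cnj lam * (- 1) ^ (n - 1))"

lemma less_cases: "i < (2::nat) \<Longrightarrow> i = 0 \<or> i = 1" "i < (4::nat) \<Longrightarrow> i = 0 \<or> i = 1 \<or> i = 2 \<or> i = 3"
  by auto

lemma unit_circle: "cmod z = 1 \<Longrightarrow> cnj z = 1 / z" "cmod z = 1 \<Longrightarrow> z \<noteq> 0"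
  by (auto simp: complex_div_cnj[of 1 z] divide_simps)

lemma block_data:
  assumes "admissible p"
  shows "bsize p \<ge> 1" "nblocks p \<ge> 1"
    and "i < nblocks p \<Longrightarrow> bdual p i < nblocks p"
    and "i < nblocks p \<Longrightarrow> bconj p i < nblocks p"
    and "i < nblocks p \<Longrightarrow> bdual p (bdual p i) = i"
    and "i < nblocks p \<Longrightarrow> bev p i \<noteq> 0"
    and "i < nblocks p \<Longrightarrow> bev p (bdual p i) = 1 / bev p i"
    and "i < nblocks p \<Longrightarrow> bev p (bconj p i) = cnj (bev p i)"
    and "i < nblocks p \<Longrightarrow> bform p i \<noteq> 0"
    and "i < nblocks p \<Longrightarrow> bdual p (bconj p i) = bconj p (bdual p i)"
proof -
  show "bsize p \<ge> 1" "nblocks p \<ge> 1" using assms by (cases p; auto)+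
  assume i: "i < nblocks p"
  show "bdual p i < nblocks p" "bconj p i < nblocks p" "bdual p (bdual p i) = i"
    "bdual p (bconj p i) = bconj p (bdual p i)"
    using i by (cases p; auto dest: less_cases)+
  show "bev p i \<noteq> 0" "bform p i \<noteq> 0"
    using assms by (cases p; auto)+
  show "bev p (bconj p i) = cnj (bev p i)"
    using i by (cases p; auto dest: less_cases)
  show "bev p (bdual p i) = 1 / bev p i"
  proof (cases p)
    case (Seif3 lam n \<zeta>)
    then have "cnj lam = 1 / lam" "lam \<noteq> 0" using assms unit_circle[of lam] by auto
    then show ?thesis using i Seif3 by (auto dest: less_cases)
  next
    case (Seif2 lam n)
    then show ?thesis using assms by auto
  qed (use assms i in \<open>auto dest: less_cases\<close>)
qed

text \<open>The leading coefficients pair the blocks \<open>i\<close> and \<open>bdual p i\<close> only: other blocks either have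
  orthogonal eigenspaces, or coincide and carry a skew symmetric leading form.\<close>

lemma block_orthogonal:
  assumes "admissible p" "i < nblocks p" "j < nblocks p" "j \<noteq> bdual p i"
  shows "bev p i * bev p j \<noteq> 1 \<or> i = j \<and> bev p i * (- 1) ^ (bsize p - 1) \<noteq> 1"
proof (cases p)
  case (Seif1 lam n \<epsilon>)
  then show ?thesis using assms by auto
next
  case (Seif2 lam n)
  then have n: "n \<ge> 1" and l: "lam = 1 \<and> even n \<or> lam = - 1 \<and> odd n" using assms by auto
  then have "of_real lam * (- 1) ^ (n - 1) = (- 1 :: complex)" by (cases n) auto
  then show ?thesis using assms Seif2 by (auto dest!: less_cases)
next
  case (Seif3 lam n \<zeta>)
  then have "cmod lam = 1" "lam \<noteq> 1" "lam \<noteq> - 1" using assms by auto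
  then have "lam * lam \<noteq> 1" "cnj lam * cnj lam \<noteq> 1"
    by (metis square_eq_1_iff) (metis \<open>lam \<noteq> - 1\<close> \<open>lam \<noteq> 1\<close> complex_cnj_cancel_iff complex_cnj_mult complex_cnj_one square_eq_1_iff)
  then show ?thesis using assms Seif3 by (auto dest!: less_cases)
next
  case (Seif4 lam n)
  then have l: "lam > 1 \<or> lam < - 1" using assms by auto
  then have "lam * lam \<noteq> 1" using less_1_mult[of lam lam] less_1_mult[of "- lam" "- lam"] by auto
  then have "complex_of_real lam * complex_of_real lam \<noteq> 1" by (metis of_real_eq_1_iff of_real_mult)
  then show ?thesis using assms Seif4 l by (auto dest!: less_cases simp: divide_simps)
next
  case (Seif5 lam n)
  then have l: "cmod lam > 1" "Im lam > 0" using assms by auto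
  then have l0: "lam \<noteq> 0" by auto
  have "cmod (lam * lam) > 1" "cmod (lam * cnj lam) > 1" "cmod (cnj lam * cnj lam) > 1"
    using l(1) by (auto simp: norm_mult intro: less_1_mult)
  then have ne: "lam * lam \<noteq> 1" "lam * cnj lam \<noteq> 1" "cnj lam * cnj lam \<noteq> 1" "cnj lam * lam \<noteq> 1"
    by (auto simp: mult.commute)
  have ne2: "lam \<noteq> cnj lam" using l(2) by (auto simp: complex_eq_iff)
  have inv: "1 / lam * (1 / lam) \<noteq> 1" "1 / cnj lam * (1 / cnj lam) \<noteq> 1" "1 / lam * (1 / cnj lam) \<noteq> 1"
    "1 / cnj lam * (1 / lam) \<noteq> 1" "lam * (1 / cnj lam) \<noteq> 1" "1 / cnj lam * lam \<noteq> 1"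
    "cnj lam * (1 / lam) \<noteq> 1" "1 / lam * cnj lam \<noteq> 1"
    using ne ne2 ne2[symmetric] l0 by simp_all
  have ij: "i = 0 \<or> i = 1 \<or> i = 2 \<or> i = 3" "j = 0 \<or> j = 1 \<or> j = 2 \<or> j = 3"
    using assms(2,3) Seif5 less_cases(2) by simp_all
  have nd: "j \<noteq> bdual (Seif5 lam n) i" using assms(4) Seif5 by simp
  from ij show ?thesis
    unfolding Seif5 by (elim disjE; insert nd; hypsubst) (simp_all only: bev.simps bdual.simps ne inv if_True if_False simp_thms
        one_neq_zero numeral_eq_iff num.distinct num.inject zero_neq_one zero_neq_numeral[symmetric] zero_neq_numeral
        one_eq_numeral_iff numeral_eq_one_iff not_False_eq_True)
qed

text \<open>What holds for one block and is inherited by dual and conjugate blocks holds for all.\<close>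

lemma block_transitive:
  assumes "admissible p" "P 0" "\<And>i. i < nblocks p \<Longrightarrow> P i \<Longrightarrow> P (bdual p i)"
    "\<And>i. i < nblocks p \<Longrightarrow> P i \<Longrightarrow> P (bconj p i)" "i < nblocks p"
  shows "P i"
proof (cases p)
  case (Seif1 lam n \<epsilon>)
  then show ?thesis using assms by auto
next
  case (Seif2 lam n)
  then show ?thesis using assms(2,5) assms(3)[of 0] by (auto dest!: less_cases)
next
  case (Seif3 lam n \<zeta>)
  then show ?thesis using assms(2,5) assms(3)[of 0] by (auto dest!: less_cases)
next
  case (Seif4 lam n)
  then show ?thesis using assms(2,5) assms(3)[of 0] by (auto dest!: less_cases)
next
  case (Seif5 lam n)
  then show ?thesis using assms(2,5) assms(3)[of 0] assms(4)[of 0] assms(4)[of 1] by (auto dest!: less_cases)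
qed

text \<open>The vector \<open>x i\<close> generates the block \<open>i\<close>. Only the operators
  \<open>tw M \<mu>\<close> occur, so a frame remains a frame after restriction to an invariant subspace
  that contains it.\<close>

definition frame ::
  "'a::real_vector set \<Rightarrow> ('a \<Rightarrow> 'a \<Rightarrow> real) \<Rightarrow> ('a \<Rightarrow> 'a) \<Rightarrow> seif_type \<Rightarrow> (nat \<Rightarrow> 'a \<times> 'a) \<Rightarrow> bool"
where
  "frame V L M p x \<longleftrightarrow> (\<forall>i<nblocks p.
     x i \<in> V \<times> V \<and> (tw M (bev p i) ^^ bsize p) (x i) = 0 \<and> x (bconj p i) = cconj (x i) \<and>
     form_cplx L (x i) ((tw M (bev p (bdual p i)) ^^ (bsize p - 1)) (x (bdual p i))) = bform p i)"

definition chain ::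
  "('a::real_vector \<Rightarrow> 'a) \<Rightarrow> seif_type \<Rightarrow> (nat \<Rightarrow> 'a \<times> 'a) \<Rightarrow> nat \<times> nat \<Rightarrow> 'a \<times> 'a"
where
  "chain M p x q = (tw M (bev p (fst q)) ^^ snd q) (x (fst q))"

definition chain_index :: "seif_type \<Rightarrow> (nat \<times> nat) set" where
  "chain_index p = {..<nblocks p} \<times> {..<bsize p}"

lemma finite_chain_index [simp]: "finite (chain_index p)"
  and card_chain_index: "card (chain_index p) = nblocks p * bsize p"
  by (simp_all add: chain_index_def)

context seif
begin

context
  fixes p x
  assumes p: "admissible p" and fr: "frame V L M p x"
begin

lemma frameD:
  assumes "i < nblocks p"
  shows "x i \<in> H" "(tw M (bev p i) ^^ bsize p) (x i) = 0" "x (bconj p i) = cconj (x i)"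
    "LC (x i) ((tw M (bev p (bdual p i)) ^^ (bsize p - 1)) (x (bdual p i))) = bform p i"
  using fr assms unfolding frame_def by blast+

lemma frame_gev: "i < nblocks p \<Longrightarrow> x i \<in> gev (bev p i)"
  using frameD(1,2) gevI by blast

lemma frame_leading_zero:
  assumes "i < nblocks p" "j < nblocks p" "j \<noteq> bdual p i"
  shows "LC (x i) ((tw M (bev p j) ^^ (bsize p - 1)) (x j)) = 0"
  using block_orthogonal[OF p assms]
proof
  assume "bev p i * bev p j \<noteq> 1"
  then show ?thesis using gev_orthogonal frame_gev assms tw_pow_gev by metis
next
  assume *: "i = j \<and> bev p i * (- 1) ^ (bsize p - 1) \<noteq> 1"
  show ?thesis
  proof (cases "bev p i * bev p j = 1")
    case True
    then have i: "1 / bev p i = bev p i" using * by (metis nonzero_eq_divide_eq block_data(6)[OF p assms(1)])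
    then show ?thesis
      using leading_form_swap[OF block_data(6)[OF p assms(1)] frameD(1)[OF assms(1)] frameD(1)[OF assms(1)], of "bsize p"]
        frameD(2)[OF assms(1)] block_data(1)[OF p] conjunct1[OF *] conjunct2[OF *] by auto
  next
    case False
    then show ?thesis using gev_orthogonal frame_gev assms tw_pow_gev by metis
  qed
qed

lemma chain_in: "q \<in> chain_index p \<Longrightarrow> chain M p x q \<in> H"
  unfolding chain_def by (rule tw_pow_in, rule frameD(1)) (auto simp: chain_index_def)

lemma chain_gev: "q \<in> chain_index p \<Longrightarrow> chain M p x q \<in> gev (bev p (fst q))"
  unfolding chain_def by (rule tw_pow_gev, rule frame_gev) (auto simp: chain_index_def)

text \<open>The Gram matrix of the chain vectors is antitriangular.\<close>

lemma chain_form_zero: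
  assumes "(j, l) \<in> chain_index p" "(i, k) \<in> chain_index p" "bsize p \<le> l + k \<or> bsize p = Suc (l + k) \<and> i \<noteq> bdual p j"
  shows "LC (chain M p x (j, l)) (chain M p x (i, k)) = 0"
proof (cases "bev p j * bev p i = 1")
  case False
  then show ?thesis using gev_orthogonal[OF chain_gev[OF assms(1)] chain_gev[OF assms(2)]] by simp
next
  case True
  have ij: "i < nblocks p" "j < nblocks p" using assms by (auto simp: chain_index_def)
  note j0 = block_data(6)[OF p ij(2)]
  have i: "bev p i = 1 / bev p j" using True j0 by (simp add: divide_simps mult.commute)
  note z = frameD(2)[OF ij(1), unfolded i]
  from assms(3) show ?thesis
  proof
    assume "bsize p \<le> l + k"
    then show ?thesis using tw_pow_form_zero[OF j0 frameD(1)[OF ij(2)] frameD(1)[OF ij(1)] z, of l k]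
      by (simp add: chain_def i)
  next
    assume *: "bsize p = Suc (l + k) \<and> i \<noteq> bdual p j"
    then have "LC (x j) ((tw M (1 / bev p j) ^^ (bsize p - 1)) (x i)) = 0"
      using frame_leading_zero[OF ij(2,1)] by (simp add: i)
    then show ?thesis using tw_pow_form_shift[OF j0 frameD(1)[OF ij(2)] frameD(1)[OF ij(1)] z, of l k] *
      by (simp add: chain_def i)
  qed
qed

lemma chain_form_dual:
  assumes "j < nblocks p" "bsize p = Suc (l + k)"
  shows "LC (chain M p x (j, l)) (chain M p x (bdual p j, k)) = (- 1) ^ l * bform p j"
proof -
  note d = block_data(3)[OF p assms(1)] and i = block_data(7)[OF p assms(1)]
  show ?thesis
    using tw_pow_form_shift[OF block_data(6)[OF p assms(1)] frameD(1)[OF assms(1)] frameD(1)[OF d]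
        frameD(2)[OF d, unfolded i] assms(2)] frameD(4)[OF assms(1)]
    by (simp add: chain_def i)
qed

text \<open>Test the combination with the vectors of the dual blocks: against the power complementary to
  \<open>k\<close>, all terms of higher order vanish, and those of lower order vanish by
  induction.\<close>

lemma chain_nondegenerate:
  assumes z: "\<And>u. u \<in> chain_index p \<Longrightarrow> LC (chain M p x u) (\<Sum>q\<in>chain_index p. cscale (c q) (chain M p x q)) = 0"
  shows "\<forall>q\<in>chain_index p. c q = 0"
proof -
  have "\<forall>i<nblocks p. c (i, k) = 0" if "k < bsize p" for k
    using that
  proof (induction k rule: less_induct)
    case (less k)
    show ?case
    proof (intro allI impI)
      fix i assume i: "i < nblocks p"
      define j l where "j = bdual p i" and "l = bsize p - Suc k"
      have j: "j < nblocks p" "bdual p j = i" using block_data(3,5)[OF p i] by (simp_all add: j_def)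
      have l: "bsize p = Suc (l + k)" using less.prems by (simp add: l_def)
      have jl: "(j, l) \<in> chain_index p" and ik: "(i, k) \<in> chain_index p"
        using j i l by (auto simp: chain_index_def)
      have "0 = LC (chain M p x (j, l)) (\<Sum>q\<in>chain_index p. cscale (c q) (chain M p x q))" using z[OF jl] by simp
      also have "\<dots> = (\<Sum>q\<in>chain_index p. c q * LC (chain M p x (j, l)) (chain M p x q))"
        by (simp add: LC_sum LC_simps)
      also have "\<dots> = c (i, k) * LC (chain M p x (j, l)) (chain M p x (i, k))"
      proof (subst sum.remove[OF finite_chain_index ik], subst sum.neutral)
        show "\<forall>q\<in>chain_index p - {(i, k)}. c q * LC (chain M p x (j, l)) (chain M p x q) = 0"
        proof
          fix q assume q: "q \<in> chain_index p - {(i, k)}"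
          obtain i' k' where q': "q = (i', k')" by fastforce
          show "c q * LC (chain M p x (j, l)) (chain M p x q) = 0"
          proof (cases "k' < k")
            case True
            then show ?thesis using less.IH[of k'] less.prems q q' by (auto simp: chain_index_def)
          next
            case False
            then have "bsize p \<le> l + k' \<or> bsize p = Suc (l + k') \<and> i' \<noteq> bdual p j" using q q' l j by auto
            then show ?thesis using chain_form_zero[OF jl, of i' k'] q q' by auto
          qed
        qed
      qed simp
      also have "LC (chain M p x (j, l)) (chain M p x (i, k)) = (- 1) ^ l * bform p j"
        using chain_form_dual[OF j(1) l] j(2) by simp
      finally show "c (i, k) = 0" using block_data(9)[OF p j(1)] by simp
    qed
  qed
  then show ?thesis by (auto simp: chain_index_def)
qed

lemma chain_independent:
  "inj_on (chain M p x) (chain_index p)" "cplx.independent (chain M p x ` chain_index p)"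
proof -
  have *: "(\<Sum>q\<in>chain_index p. cscale (c q) (chain M p x q)) = 0 \<Longrightarrow> \<forall>q\<in>chain_index p. c q = 0" for c
    by (rule chain_nondegenerate) (simp add: LC_simps)
  show "inj_on (chain M p x) (chain_index p)" "cplx.independent (chain M p x ` chain_index p)"
    by (rule indexed_independent[OF finite_chain_index *]; assumption)+
qed

lemma card_chain: "card (chain M p x ` chain_index p) = nblocks p * bsize p"
  using card_image[OF chain_independent(1)] card_chain_index by simp

lemma chain_subset: "chain M p x ` chain_index p \<subseteq> V \<times> V"
  using chain_in by (rule image_subsetI)

lemma frame_dim: "nblocks p * bsize p \<le> dim V"
  using Times_independent_card(2)[OF fin chain_independent(2) chain_subset] card_chain by simp

lemma full_frame_span: "dim V = nblocks p * bsize p \<Longrightarrow> cplx.span (chain M p x ` chain_index p) = H"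
  using Times_independent_card(3)[OF fin chain_independent(2) chain_subset] card_chain by simp

lemma span_chain_eq: "cplx.span (chain M p x ` chain_index p) = {\<Sum>q\<in>chain_index p. cscale (c q) (chain M p x q) |c. True}"
proof -
  note inj = chain_independent(1)
  show ?thesis
  proof (intro subset_antisym subsetI)
    fix y assume "y \<in> cplx.span (chain M p x ` chain_index p)"
    then obtain c where "y = (\<Sum>v\<in>chain M p x ` chain_index p. cscale (c v) v)"
      by (auto simp: cplx.span_finite)
    then have "y = (\<Sum>q\<in>chain_index p. cscale (c (chain M p x q)) (chain M p x q))"
      by (simp add: sum.reindex[OF inj])
    then show "y \<in> {\<Sum>q\<in>chain_index p. cscale (c q) (chain M p x q) |c. True}"
      by (intro CollectI exI[of _ "\<lambda>q. c (chain M p x q)"]) simp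
  next
    fix y assume "y \<in> {\<Sum>q\<in>chain_index p. cscale (c q) (chain M p x q) |c. True}"
    then obtain c where y: "y = (\<Sum>q\<in>chain_index p. cscale (c q) (chain M p x q))" by blast
    show "y \<in> cplx.span (chain M p x ` chain_index p)"
      unfolding y by (intro cplx.span_sum cplx.span_scale cplx.span_base imageI)
  qed
qed

text \<open>The span of the chains is invariant under conjugation and under \<open>M\<close>, so it is
  the complexification of a real invariant subspace \<open>Y\<close>.\<close>

lemma frame_subpair:
  obtains Y where "subspace Y" "Y \<subseteq> V" "\<And>y. y \<in> Y \<Longrightarrow> M y \<in> Y" "Y \<noteq> {0}"
    "\<And>b. b \<in> Y \<Longrightarrow> (\<And>a. a \<in> Y \<Longrightarrow> L a b = 0) \<Longrightarrow> b = 0"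
    "frame Y L M p x" "dim Y = nblocks p * bsize p"
proof -
  let ?S = "chain M p x ` chain_index p"
  let ?C = "cplx.span ?S"
  have sC: "cplx.subspace ?C" by simp
  have CH: "?C \<subseteq> H" by (rule cplx.span_minimal[OF chain_subset subspace_H])
  have chC: "chain M p x q \<in> ?C" if "q \<in> chain_index p" for q
    using that by (intro cplx.span_base imageI)
  have img: "f y \<in> ?C" if f: "\<And>x y. f (x + y) = f x + f y" "\<And>c x. \<exists>d. f (cscale c x) = cscale d (f x)"
      and ch: "\<And>q. q \<in> chain_index p \<Longrightarrow> f (chain M p x q) \<in> ?C" and y: "y \<in> ?C" for f y
  proof -
    have f0: "f 0 = 0" using f(1)[of 0 0] by simp
    have "cplx.subspace {y. f y \<in> ?C}"
    proof (rule cplx.subspaceI)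
      show "0 \<in> {y. f y \<in> ?C}" using f0 cplx.span_zero by simp
      show "x + y \<in> {y. f y \<in> ?C}" if "x \<in> {y. f y \<in> ?C}" "y \<in> {y. f y \<in> ?C}" for x y
        using that f(1) cplx.span_add by simp
      show "cscale c x \<in> {y. f y \<in> ?C}" if "x \<in> {y. f y \<in> ?C}" for c x
      proof -
        obtain d where "f (cscale c x) = cscale d (f x)" using f(2) by blast
        then show ?thesis using that cplx.span_scale by simp
      qed
    qed
    then have "?C \<subseteq> {y. f y \<in> ?C}" by (rule cplx.span_minimal[rotated]) (use ch in blast)
    then show ?thesis using y by blast
  qed
  have MC: "Mc y \<in> ?C" if "y \<in> ?C" for y
  proof (rule img[OF clinear_add[OF clinear_Mc] _ _ that])
    show "\<exists>d. Mc (cscale c x) = cscale d (Mc x)" for c x using clinear_scale[OF clinear_Mc] by blast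
    fix q assume q: "q \<in> chain_index p"
    obtain i k where ik: "q = (i, k)" "i < nblocks p" "k < bsize p" using q by (auto simp: chain_index_def)
    have "tw M (bev p i) (chain M p x q) = chain M p x (i, Suc k)" by (simp add: chain_def ik)
    moreover have "chain M p x (i, Suc k) \<in> ?C"
    proof (cases "Suc k = bsize p")
      case True
      then have "chain M p x (i, Suc k) = 0" using frameD(2)[OF ik(2)] by (simp add: chain_def)
      then show ?thesis using cplx.span_zero by simp
    next
      case False
      then show ?thesis using ik by (intro chC) (auto simp: chain_index_def)
    qed
    ultimately show "Mc (chain M p x q) \<in> ?C"
      using Mc_tw[OF block_data(6)[OF p ik(2)], of "chain M p x q"] chC[OF q]
      by (simp add: cplx.span_add cplx.span_scale)
  qed
  have conjC: "cconj y \<in> ?C" if "y \<in> ?C" for y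
  proof (rule img[OF _ _ _ that])
    show "\<exists>d. cconj (cscale c x) = cscale d (cconj x)" for c and x :: "'a \<times> 'a" by auto
    fix q assume q: "q \<in> chain_index p"
    obtain i k where ik: "q = (i, k)" "i < nblocks p" "k < bsize p" using q by (auto simp: chain_index_def)
    have "cconj (chain M p x q) = chain M p x (bconj p i, k)"
      using frameD(3)[OF ik(2)] block_data(8)[OF p ik(2)] by (simp add: chain_def ik flip: tw_pow_cconj)
    then show "cconj (chain M p x q) \<in> ?C"
      using chC[of "(bconj p i, k)"] ik block_data(4)[OF p ik(2)] by (simp add: chain_index_def)
  qed simp
  define Y where "Y = {v. (v, 0) \<in> ?C}"
  have CY: "?C = Y \<times> Y" "subspace Y"
    unfolding Y_def using conj_closed_eq_Times[OF sC conjC] by blast+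
  show ?thesis
  proof (rule that[of Y])
    show "subspace Y" by (rule CY(2))
    show YV: "Y \<subseteq> V" using CH by (auto simp: Y_def)
    show "M y \<in> Y" if "y \<in> Y" for y
      using MC[of "(y, 0)"] that by (simp add: Y_def linear_0[OF lin_M])
    have xY: "x i \<in> Y \<times> Y" if "i < nblocks p" for i
    proof -
      have "(i, 0) \<in> chain_index p" using that block_data(1)[OF p] by (simp add: chain_index_def)
      from chC[OF this] have "chain M p x (i, 0) \<in> Y \<times> Y" using CY(1) by blast
      moreover have "chain M p x (i, 0) = x i" by (simp add: chain_def)
      ultimately show ?thesis by simp
    qed
    then show "frame Y L M p x" using fr unfolding frame_def by blast
    have fY: "fin_dim_space Y" by (rule fin_dim_subspace[OF fin CY(2) YV])
    have "?S \<subseteq> Y \<times> Y" using cplx.span_superset[of ?S] CY(1) by blast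
    from Times_independent_card(4)[OF fY chain_independent(2) this CY(1)]
    show dY: "dim Y = nblocks p * bsize p" using card_chain by simp
    show "Y \<noteq> {0}"
    proof
      assume "Y = {0}"
      then have "x 0 = 0" using xY[of 0] block_data(2)[OF p] by (auto simp: zero_prod_def)
      then have "bform p 0 = 0" using frameD(4)[of 0] block_data(2)[OF p] by (simp add: LC_simps)
      then show False using block_data(2)[OF p] block_data(9)[OF p, of 0] by simp
    qed
    fix b assume b: "b \<in> Y" "\<And>a. a \<in> Y \<Longrightarrow> L a b = 0"
    then have "(b, 0) \<in> ?C" by (simp add: Y_def)
    then obtain c where c: "(b, 0) = (\<Sum>q\<in>chain_index p. cscale (c q) (chain M p x q))"
      unfolding span_chain_eq by auto
    have "LC u (b, 0) = 0" if "u \<in> ?C" for u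
    proof -
      have "u \<in> Y \<times> Y" using that CY(1) by blast
      then have "fst u \<in> Y" "snd u \<in> Y" by auto
      then show ?thesis using b(2) by (simp add: form_cplx_def L_simps complex_eq_iff)
    qed
    then have "\<forall>q\<in>chain_index p. c q = 0" using chC by (intro chain_nondegenerate) (simp flip: c)
    then have "(b, 0) = (0 :: 'a \<times> 'a)" unfolding c by (intro sum.neutral) simp
    then show "b = 0" by (simp add: zero_prod_def)
  qed
qed

end

end

section \<open>Full frames\<close>

context seif
begin

text \<open>For generalized eigenvectors this is \<open>tw_adjoint\<close> or orthogonality; both sides
  are bilinear.\<close>

lemma T_adjoint:
  assumes "u \<in> H" "w \<in> H"
  shows "LC (T u) w = - LC u (T w) - LC (T u) (T w)"
proof -
  define \<phi> where "\<phi> u w = LC (T u) w + LC u (T w) + LC (T u) (T w)" for u w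
  note T_lin = clinear_0[OF clinear_T] clinear_add[OF clinear_T] clinear_scale[OF clinear_T]
  have lin: "\<phi> 0 w = 0" "\<phi> (u + v) w = \<phi> u w + \<phi> v w" "\<phi> (cscale c u) w = c * \<phi> u w"
    "\<phi> u 0 = 0" "\<phi> u (v + w) = \<phi> u v + \<phi> u w" "\<phi> u (cscale c w) = c * \<phi> u w" for u v w c
    by (simp_all add: \<phi>_def T_lin LC_simps algebra_simps)
  have "\<phi> u w = 0"
    using assms(1)
  proof (rule H_induct)
    show "cplx.subspace {u. \<phi> u w = 0}" by (rule cplx.subspaceI) (simp_all add: lin)
    fix \<mu> u assume \<mu>: "\<mu> \<noteq> 0" and u: "u \<in> gev \<mu>"
    show "\<phi> u w = 0"
      using assms(2)
    proof (rule H_induct)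
      show "cplx.subspace {w. \<phi> u w = 0}" by (rule cplx.subspaceI) (simp_all add: lin)
      fix \<nu> w assume \<nu>: "\<nu> \<noteq> 0" and w: "w \<in> gev \<nu>"
      show "\<phi> u w = 0"
      proof (cases "\<mu> * \<nu> = 1")
        case True
        then have "\<nu> = 1 / \<mu>" using \<mu> by (simp add: divide_simps mult.commute)
        then show ?thesis
          using tw_adjoint[OF \<mu> gev_in[OF u] gev_in[OF w]] T_gev[OF u] T_gev[OF w] by (simp add: \<phi>_def)
      next
        case False
        note o = gev_orthogonal[OF _ _ False]
        show ?thesis
          using o[OF tw_gev[OF u] w] o[OF u tw_gev[OF w]] o[OF tw_gev[OF u] tw_gev[OF w]]
          by (simp add: \<phi>_def T_gev[OF u] T_gev[OF w])
      qed
    qed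
  qed
  then show ?thesis unfolding \<phi>_def add.assoc by (rule add_add_eq_0D)
qed

context
  fixes p x
  assumes p: "admissible p" and fr: "frame V L M p x" and full: "dim V = nblocks p * bsize p"
begin

lemma clinear_eq_on_chain:
  assumes f: "clinear f" and g: "clinear g" and u: "u \<in> H"
    and eq: "\<And>q. q \<in> chain_index p \<Longrightarrow> f (chain M p x q) = g (chain M p x q)"
  shows "f u = g u"
proof -
  have "cplx.subspace {u. f u = g u}"
    by (rule cplx.subspaceI) (simp_all add: clinear_0[OF f] clinear_0[OF g] clinear_add[OF f] clinear_add[OF g]
        clinear_scale[OF f] clinear_scale[OF g])
  then have "cplx.span (chain M p x ` chain_index p) \<subseteq> {u. f u = g u}"
    by (rule cplx.span_minimal[rotated]) (use eq in blast)
  then show ?thesis using u full_frame_span[OF p fr full] by blast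
qed

lemma T_pow_chain: "(i, k) \<in> chain_index p \<Longrightarrow> (T ^^ j) (chain M p x (i, k)) = chain M p x (i, k + j)"
  using T_pow_gev[OF chain_gev[OF p fr], of "(i, k)" j] funpow_add[of j k "tw M (bev p i)"]
  by (simp add: chain_def add.commute)

lemma chain_beyond: "i < nblocks p \<Longrightarrow> bsize p \<le> k \<Longrightarrow> chain M p x (i, k) = 0"
  using tw_pow_zero_mono[OF frameD(2)[OF p fr], of i k] by (simp add: chain_def)

lemma T_pow_frame: "i < nblocks p \<Longrightarrow> (T ^^ j) (x i) = (tw M (bev p i) ^^ j) (x i)"
  by (rule T_pow_gev[OF frame_gev[OF p fr]])

lemma T_bsize: "u \<in> H \<Longrightarrow> bsize p \<le> k \<Longrightarrow> (T ^^ k) u = 0"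
proof (rule T_pow_zero_mono)
  assume u: "u \<in> H"
  have z: "clinear (\<lambda>u::'a \<times> 'a. 0::'a \<times> 'a)" by (rule clinearI) simp_all
  show "(T ^^ bsize p) u = 0"
  proof (rule clinear_eq_on_chain[OF clinear_T_pow z u])
    fix q assume "q \<in> chain_index p"
    then obtain i k where "q = (i, k)" "i < nblocks p" "(i, k) \<in> chain_index p" by (auto simp: chain_index_def)
    then show "(T ^^ bsize p) (chain M p x q) = 0" using T_pow_chain chain_beyond by simp
  qed
qed

text \<open>The frame vectors span \<open>H\<close> modulo the image of \<open>T\<close>.\<close>

lemma frame_mod_T:
  assumes "u \<in> H"
  obtains a z where "z \<in> H" "u = (\<Sum>i<nblocks p. cscale (a i) (x i)) + T z"
proof -
  let ?f = "\<lambda>a. \<Sum>i<nblocks p. cscale (a i) (x i)"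
  let ?P = "{u. \<exists>a. \<exists>z\<in>H. u = ?f a + T z}"
  have "cplx.subspace ?P"
  proof (rule cplx.subspaceI)
    show "0 \<in> ?P"
      using cplx.subspace_0[OF subspace_H] clinear_0[OF clinear_T]
      by (intro CollectI exI[of _ "\<lambda>_. 0"] bexI[of _ 0]) simp_all
  next
    fix u v assume "u \<in> ?P" "v \<in> ?P"
    then obtain a z b w where *: "z \<in> H" "u = ?f a + T z" "w \<in> H" "v = ?f b + T w" by blast
    then have "u + v = ?f (\<lambda>i. a i + b i) + T (z + w)"
      by (simp add: clinear_add[OF clinear_T] cplx.scale_left_distrib sum.distrib)
    then show "u + v \<in> ?P" using cplx.subspace_add[OF subspace_H *(1,3)]
      by (intro CollectI exI[of _ "\<lambda>i. a i + b i"] bexI[of _ "z + w"])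
  next
    fix c u assume "u \<in> ?P"
    then obtain a z where *: "z \<in> H" "u = ?f a + T z" by blast
    then have "cscale c u = ?f (\<lambda>i. c * a i) + T (cscale c z)"
      by (simp add: clinear_scale[OF clinear_T] cplx.scale_right_distrib cplx.scale_sum_right)
    then show "cscale c u \<in> ?P" using cplx.subspace_scale[OF subspace_H *(1)]
      by (intro CollectI exI[of _ "\<lambda>i. c * a i"] bexI[of _ "cscale c z"])
  qed
  moreover have "chain M p x ` chain_index p \<subseteq> ?P"
  proof (rule image_subsetI)
    fix q assume q: "q \<in> chain_index p"
    then obtain i k where ik: "q = (i, k)" "i < nblocks p" by (auto simp: chain_index_def)
    show "chain M p x q \<in> ?P"
    proof (cases k)
      case 0
      have "?f (\<lambda>j. if j = i then 1 else 0) = x i"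
        using ik(2) by (simp add: if_distrib[of "\<lambda>c. cscale c _"] sum.delta cong: if_cong)
      then have "chain M p x q = ?f (\<lambda>j. if j = i then 1 else 0) + T 0"
        using clinear_0[OF clinear_T] by (simp add: chain_def ik 0)
      then show ?thesis using cplx.subspace_0[OF subspace_H]
        by (intro CollectI exI[of _ "\<lambda>j. if j = i then 1 else 0"] bexI[of _ 0])
    next
      case (Suc k')
      have q': "(i, k') \<in> chain_index p" using q ik Suc by (simp add: chain_index_def)
      have "chain M p x q = ?f (\<lambda>_. 0) + T (chain M p x (i, k'))"
        using T_pow_chain[OF q', of 1] by (simp add: ik Suc)
      then show ?thesis using chain_in[OF p fr q']
        by (intro CollectI exI[of _ "\<lambda>_. 0"] bexI[of _ "chain M p x (i, k')"])
    qed
  qed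
  ultimately have "cplx.span (chain M p x ` chain_index p) \<subseteq> ?P" by (rule cplx.span_minimal[rotated])
  then have "u \<in> ?P" using assms full_frame_span[OF p fr full] by blast
  then show ?thesis using that by blast
qed

lemma T_pow_top_eq_0:
  assumes "z \<in> H"
  shows "(T ^^ (bsize p - 1)) (T z) = 0"
proof -
  have "(T ^^ (bsize p - 1)) (T z) = (T ^^ Suc (bsize p - 1)) z" by (simp add: funpow_swap1)
  then show ?thesis using T_bsize[OF assms, of "bsize p"] block_data(1)[OF p] by simp
qed

lemma leading_form_sum:
  assumes "z \<in> H"
  shows "LC u ((T ^^ (bsize p - 1)) ((\<Sum>i<nblocks p. cscale (a i) (x i)) + T z))
    = (\<Sum>i<nblocks p. a i * LC u ((T ^^ (bsize p - 1)) (x i)))"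
  using T_pow_top_eq_0[OF assms]
  by (simp add: clinear_add[OF clinear_T_pow] clinear_sum[OF clinear_T_pow] clinear_scale[OF clinear_T_pow]
      LC_simps LC_sum)

lemma frame_leading:
  assumes "i < nblocks p" "j < nblocks p"
  shows "LC (x i) ((T ^^ (bsize p - 1)) (x j)) = (if j = bdual p i then bform p i else 0)"
  using frame_leading_zero[OF p fr assms] frameD(4)[OF p fr assms(1)] T_pow_frame[OF assms(2)] by simp

lemma T_pow_top_kernel:
  assumes u: "u \<in> H" "(T ^^ (bsize p - 1)) u = 0"
  obtains z where "z \<in> H" "u = T z"
proof -
  obtain a z where z: "z \<in> H" "u = (\<Sum>i<nblocks p. cscale (a i) (x i)) + T z" using frame_mod_T[OF u(1)] .
  have "a i = 0" if i: "i < nblocks p" for i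
  proof -
    note d = block_data(3)[OF p i]
    have "0 = LC (x (bdual p i)) ((T ^^ (bsize p - 1)) u)" using u(2) by (simp add: LC_simps)
    also have "\<dots> = (\<Sum>j<nblocks p. a j * LC (x (bdual p i)) ((T ^^ (bsize p - 1)) (x j)))"
      unfolding z(2) by (rule leading_form_sum[OF z(1)])
    also have "\<dots> = (\<Sum>j<nblocks p. if j = i then a j * bform p (bdual p i) else 0)"
      by (rule sum.cong) (simp_all add: frame_leading d block_data(5)[OF p i] del: One_nat_def)
    also have "\<dots> = a i * bform p (bdual p i)" using i by simp
    finally show ?thesis using block_data(9)[OF p d] by simp
  qed
  then have "u = T z" using z(2) by simp
  then show ?thesis using that z(1) by blast
qed

text \<open>If the leading matrix of \<open>A\<close> vanishes, then \<open>T ^ (n - 1) A = 0\<close> by nondegeneracy, so \<open>A\<close> maps \<open>H\<close> to the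
  kernel of \<open>T ^ (n - 1)\<close>, which is the image of \<open>T\<close>. As \<open>A\<close> commutes with \<open>T\<close>, its powers \<open>A ^ k\<close> map to
  the image of \<open>T ^ k\<close>.\<close>

lemma leading_zero_nilpotent:
  assumes A: "clinear A" "\<And>u. u \<in> H \<Longrightarrow> A u \<in> H" "\<And>u. u \<in> H \<Longrightarrow> A (T u) = T (A u)"
    and z: "\<And>i j. i < nblocks p \<Longrightarrow> j < nblocks p \<Longrightarrow> LC (A (x i)) ((T ^^ (bsize p - 1)) (x j)) = 0"
    and u: "u \<in> H"
  shows "(A ^^ bsize p) u = 0"
proof -
  let ?n = "bsize p"
  have xH: "x i \<in> H" if "i < nblocks p" for i by (rule frameD(1)[OF p fr that])
  have Ax: "(T ^^ (?n - 1)) (A (x i)) = 0" if i: "i < nblocks p" for i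
  proof (rule LC_nondeg(1)[OF T_pow_in[OF A(2)[OF xH[OF i]]]])
    fix w assume w: "w \<in> H"
    obtain b v where v: "v \<in> H" "w = (\<Sum>i<nblocks p. cscale (b i) (x i)) + T v" using frame_mod_T[OF w] .
    have "LC ((T ^^ (?n - 1)) (A (x i))) w = (- 1) ^ (?n - 1) * LC (A (x i)) ((T ^^ (?n - 1)) w)"
      using skew_pow_form_shift[OF T_adjoint T_in T_in A(2)[OF xH[OF i]] w T_bsize[OF w], of "?n" "?n - 1" 0]
        block_data(1)[OF p] by simp
    also have "LC (A (x i)) ((T ^^ (?n - 1)) w) = 0"
      unfolding v(2) leading_form_sum[OF v(1)] by (rule sum.neutral) (use z[OF i] in simp)
    finally show "LC ((T ^^ (?n - 1)) (A (x i))) w = 0" by simp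
  qed
  have TA: "(T ^^ k) (A v) = A ((T ^^ k) v)" if "v \<in> H" for k v
    by (rule sym, rule funpow_commute_on[of H T A T v k, OF T_in A(3) that])
  have top: "\<exists>z\<in>H. A w = T z" if w: "w \<in> H" for w
  proof -
    obtain b v where v: "v \<in> H" "w = (\<Sum>i<nblocks p. cscale (b i) (x i)) + T v" using frame_mod_T[OF w] .
    have "(T ^^ (?n - 1)) (A w) = (T ^^ (?n - 1)) (T (A v))"
      unfolding v(2) clinear_add[OF A(1)] clinear_sum[OF A(1)] clinear_scale[OF A(1)] A(3)[OF v(1)]
        clinear_add[OF clinear_T_pow] clinear_sum[OF clinear_T_pow] clinear_scale[OF clinear_T_pow]
      by (simp add: Ax del: One_nat_def)
    also have "\<dots> = 0" by (rule T_pow_top_eq_0[OF A(2)[OF v(1)]])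
    finally show ?thesis using T_pow_top_kernel[OF A(2)[OF w]] by metis
  qed
  have "\<exists>z\<in>H. (A ^^ k) u = (T ^^ k) z" for k
  proof (induction k)
    case 0
    show ?case using u by auto
  next
    case (Suc k)
    then obtain z where z: "z \<in> H" "(A ^^ k) u = (T ^^ k) z" by blast
    obtain z' where z': "z' \<in> H" "A z = T z'" using top[OF z(1)] by blast
    have "(A ^^ Suc k) u = (T ^^ Suc k) z'" using z(2) z'(2) TA[OF z(1), of k] by (simp add: funpow_swap1)
    then show ?case using z'(1) by blast
  qed
  then obtain z where "z \<in> H" "(A ^^ ?n) u = (T ^^ ?n) z" by blast
  then show ?thesis using T_bsize[of z ?n] by simp
qed

end


section \<open>A pair with a full frame is irreducible\<close>

lemma map_prod_commute: "(\<And>a. a \<in> V \<Longrightarrow> A (M a) = M (A a)) \<Longrightarrow> u \<in> H \<Longrightarrow> map_prod A A (Mc u) = Mc (map_prod A A u)"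
  by auto

text \<open>The orthogonal projection \<open>\<pi>\<close> to a summand is self adjoint and commutes with
  \<open>M\<close>. In the leading form it acts on the frame vectors by scalars \<open>c i\<close>:
  blocks that are not dual to each other remain orthogonal, for two blocks with a skew symmetric leading
  form because \<open>\<omega> (\<pi> x) x = \<omega> x (\<pi> x)\<close>. Self adjointness gives
  \<open>c (bdual p i) = c i\<close>, realness gives \<open>c (bconj p i) = cnj (c i)\<close>,
  idempotence gives \<open>c i \<in> {0, 1}\<close>. So \<open>\<pi>\<close> or \<open>\<pi> - 1\<close>
  is nilpotent.\<close>

lemma frame_irreducible:
  assumes p: "admissible p" and fr: "frame V L M p x" and full: "dim V = nblocks p * bsize p"
  shows "irreducible_pair V L"
  unfolding irreducible_pair_def
proof
  let ?n = "bsize p"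
  let ?t = "T ^^ (?n - 1)"
  have m: "0 < nblocks p" using block_data(2)[OF p] by simp
  have xH: "x i \<in> H" if "i < nblocks p" for i by (rule frameD(1)[OF p fr that])
  note leading = frame_leading[OF p fr full]
  show "V \<noteq> {0}"
  proof
    assume "V = {0}"
    then have "x 0 = 0" using xH[OF m] by (auto simp: zero_prod_def)
    then have "bform p 0 = 0" using frameD(4)[OF p fr m] by (simp add: LC_simps)
    then show False using block_data(9)[OF p m] by simp
  qed
  show "\<not> (\<exists>V1 V2. subspace V1 \<and> subspace V2 \<and> V1 \<noteq> {0} \<and> V2 \<noteq> {0} \<and>
          V = {x + y | x y. x \<in> V1 \<and> y \<in> V2} \<and> V1 \<inter> V2 = {0} \<and>
          (\<forall>x\<in>V1. \<forall>y\<in>V2. L x y = 0 \<and> L y x = 0))"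
  proof
    assume "\<exists>V1 V2. subspace V1 \<and> subspace V2 \<and> V1 \<noteq> {0} \<and> V2 \<noteq> {0} \<and>
          V = {x + y | x y. x \<in> V1 \<and> y \<in> V2} \<and> V1 \<inter> V2 = {0} \<and>
          (\<forall>x\<in>V1. \<forall>y\<in>V2. L x y = 0 \<and> L y x = 0)"
    then obtain V1 V2 where s: "subspace V1" "subspace V2" "V1 \<noteq> {0}" "V2 \<noteq> {0}"
      and V: "V = {x + y | x y. x \<in> V1 \<and> y \<in> V2}"
      and o: "\<And>a b. a \<in> V1 \<Longrightarrow> b \<in> V2 \<Longrightarrow> L a b = 0" "\<And>a b. a \<in> V1 \<Longrightarrow> b \<in> V2 \<Longrightarrow> L b a = 0"
      by (elim exE conjE) blast
    have V1: "V1 \<subseteq> V" using subspace_0[OF s(2)] unfolding V by force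
    have V2: "V2 \<subseteq> V" using subspace_0[OF s(1)] unfolding V by force
    have nd1: "a = 0" if a: "a \<in> V1" "\<And>b. b \<in> V1 \<Longrightarrow> L a b = 0" for a
    proof (rule nondeg_left)
      show "a \<in> V" using a(1) V1 by blast
      fix b assume "b \<in> V"
      then obtain b1 b2 where "b = b1 + b2" "b1 \<in> V1" "b2 \<in> V2" unfolding V by blast
      then show "L a b = 0" using a o(1)[OF a(1)] by (simp add: L_simps)
    qed
    have f1: "fin_dim_space V1" by (rule fin_dim_subspace[OF fin s(1) V1])
    obtain \<pi> where \<pi>: "linear \<pi>" "\<And>c. \<pi> c \<in> V1" "\<And>c b. b \<in> V1 \<Longrightarrow> L (\<pi> c) b = L c b"
      using bilinear_representation[OF f1 bil bil nd1] by metis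
    have \<pi>1: "\<pi> a = a" if "a \<in> V1" for a
    proof -
      have "\<pi> a - a \<in> V1" by (intro subspace_diff[OF s(1)] \<pi>(2) that)
      then show ?thesis using nd1[of "\<pi> a - a"] \<pi>(3) by (simp add: L_simps)
    qed
    have \<pi>2: "\<pi> b = 0" if "b \<in> V2" for b
      by (rule nd1[OF \<pi>(2)]) (simp add: \<pi>(3) o(2)[OF _ that])
    have \<pi>V: "\<pi> a \<in> V" for a using \<pi>(2) V1 by blast
    have self: "L (\<pi> a) b = L a (\<pi> b)" if "a \<in> V" "b \<in> V" for a b
    proof -
      obtain a1 a2 where a: "a = a1 + a2" "a1 \<in> V1" "a2 \<in> V2" using \<open>a \<in> V\<close> unfolding V by blast
      obtain b1 b2 where b: "b = b1 + b2" "b1 \<in> V1" "b2 \<in> V2" using \<open>b \<in> V\<close> unfolding V by blast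
      note * = a b
      have "\<pi> a = a1" "\<pi> b = b1" using * \<pi>1 \<pi>2 by (simp_all add: linear_add[OF \<pi>(1)])
      then show ?thesis using * o by (simp add: L_simps)
    qed
    have comm: "\<pi> (M a) = M (\<pi> a)" if a: "a \<in> V" for a
    proof -
      have "L (\<pi> (M a) - M (\<pi> a)) b = 0" if b: "b \<in> V" for b
      proof -
        have "L (\<pi> (M a)) b = L (M a) (\<pi> b)" by (rule self[OF M_in[OF a] b])
        also have "\<dots> = L (\<pi> b) a" by (rule M_form[OF a \<pi>V])
        also have "\<dots> = L b (\<pi> a)" by (rule self[OF b a])
        also have "\<dots> = L (M (\<pi> a)) b" using M_form[OF \<pi>V b] by simp
        finally show ?thesis by (simp add: L_simps)
      qed
      moreover have "\<pi> (M a) - M (\<pi> a) \<in> V" by (intro subspace_diff[OF subspace_V] \<pi>V M_in)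
      ultimately show ?thesis using nondeg_left[of "\<pi> (M a) - M (\<pi> a)"] by simp
    qed
    define P where "P = map_prod \<pi> \<pi>"
    have lP: "clinear P" unfolding P_def by (rule clinear_map_prod[OF \<pi>(1)])
    have PH: "P u \<in> H" for u unfolding P_def using \<pi>V by (cases u) simp
    have PM: "P (Mc u) = Mc (P u)" if "u \<in> H" for u
      unfolding P_def by (rule map_prod_commute[where A = \<pi>, OF comm that])
    have PT: "P (T u) = T (P u)" if "u \<in> H" for u by (rule T_commute[OF lP PM that])
    have Pt: "P (?t u) = ?t (P u)" if "u \<in> H" for u
      by (rule funpow_commute_on[of H T P T u, OF T_in PT that])
    have Pself: "LC (P u) w = LC u (P w)" if "u \<in> H" "w \<in> H" for u w
      using that self by (auto simp: P_def form_cplx_def)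
    have PP: "P (P u) = P u" for u using \<pi>1[OF \<pi>(2)] by (cases u) (simp add: P_def)
    have Pgev: "P u \<in> gev \<mu>" if u: "u \<in> gev \<mu>" for u \<mu>
    proof -
      have uH: "u \<in> H" by (rule gev_in[OF u])
      have tw: "P (tw M \<mu> v) = tw M \<mu> (P v)" if "v \<in> H" for v
        using PM[OF that] by (simp add: tw_def clinear_diff[OF lP] clinear_scale[OF lP])
      obtain k where k: "(tw M \<mu> ^^ k) u = 0" using u by (auto simp: gev_def)
      have "(tw M \<mu> ^^ k) (P u) = P ((tw M \<mu> ^^ k) u)"
        by (rule sym, rule funpow_commute_on[of H "tw M \<mu>" P "tw M \<mu>" u, OF tw_in tw uH])
      then show ?thesis using k clinear_0[OF lP] by (intro gevI[OF PH]) simp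
    qed
    have Pn: "(tw M (bev p i) ^^ ?n) (P (x i)) = 0" if "i < nblocks p" for i
      by (rule trans[OF sym[OF T_pow_gev[OF Pgev[OF frame_gev[OF p fr that]]]] T_bsize[OF p fr full PH order_refl]])
    \<comment> \<open>\<open>P\<close> has no leading coefficient between blocks that are not dual to each other\<close>
    have off: "LC (P (x i)) (?t (x j)) = 0" if ij: "i < nblocks p" "j < nblocks p" "j \<noteq> bdual p i" for i j
    proof (cases "bev p i * bev p j = 1")
      case False
      then show ?thesis
        using gev_orthogonal[OF Pgev[OF frame_gev[OF p fr ij(1)]] tw_pow_gev[OF frame_gev[OF p fr ij(2)]]]
          T_pow_frame[OF p fr full ij(2)] by (simp del: One_nat_def)
    next
      case True
      then have *: "i = j" "bev p i * (- 1) ^ (?n - 1) \<noteq> 1" using block_orthogonal[OF p ij] by auto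
      note i0 = block_data(6)[OF p ij(1)]
      have i: "1 / bev p i = bev p i" using True *(1) i0 by (simp add: divide_simps)
      have "LC (P (x i)) (?t (x i)) = LC (x i) (?t (P (x i)))"
        using Pself[OF xH[OF ij(1)] T_pow_in[OF xH[OF ij(1)]]] Pt[OF xH[OF ij(1)]] by (simp del: One_nat_def)
      also have "\<dots> = bev p i * (- 1) ^ (?n - 1) * LC (P (x i)) (?t (x i))"
        using leading_form_swap[OF i0 PH xH[OF ij(1)] Pn[OF ij(1)], unfolded i, OF frameD(2)[OF p fr ij(1)] block_data(1)[OF p]]
          T_pow_frame[OF p fr full ij(1)] T_pow_gev[OF Pgev[OF frame_gev[OF p fr ij(1)]]] by (simp del: One_nat_def)
      finally show ?thesis using *(1,2) by (simp del: One_nat_def)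
    qed
    define c where "c i = LC (P (x i)) (?t (x (bdual p i))) / bform p i" for i
    have lead: "LC (P (x i)) (?t (x j)) = (if j = bdual p i then c i * bform p i else 0)"
      if "i < nblocks p" "j < nblocks p" for i j
      using off[OF that] block_data(9)[OF p that(1)] by (simp add: c_def)
    have c_dual: "c (bdual p i) = c i" if i: "i < nblocks p" for i
    proof -
      note d = block_data(3)[OF p i] and i0 = block_data(6)[OF p i]
      have swap: "LC (x (bdual p i)) (?t v) = bev p i * (- 1) ^ (?n - 1) * LC v (?t (x (bdual p i)))"
        if v: "v \<in> gev (bev p i)" for v
      proof -
        have "(tw M (bev p i) ^^ ?n) v = 0"
          by (rule trans[OF sym[OF T_pow_gev[OF v]] T_bsize[OF p fr full gev_in[OF v] order_refl]])
        from leading_form_swap[OF i0 gev_in[OF v] xH[OF d] this frameD(2)[OF p fr d, unfolded block_data(7)[OF p i]] block_data(1)[OF p]]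
        show ?thesis unfolding T_pow_gev[OF v] T_pow_frame[OF p fr full d] block_data(7)[OF p i] .
      qed
      have "c (bdual p i) * bform p (bdual p i) = LC (P (x (bdual p i))) (?t (x i))"
        using lead[OF d i] block_data(5)[OF p i] by (simp del: One_nat_def)
      also have "\<dots> = LC (x (bdual p i)) (?t (P (x i)))"
        using Pself[OF xH[OF d] T_pow_in[OF xH[OF i]]] Pt[OF xH[OF i]] by (simp del: One_nat_def)
      also have "\<dots> = bev p i * (- 1) ^ (?n - 1) * (c i * bform p i)"
        using swap[OF Pgev[OF frame_gev[OF p fr i]]] lead[OF i d] by (simp del: One_nat_def)
      also have "\<dots> = c i * (bev p i * (- 1) ^ (?n - 1) * LC (x i) (?t (x (bdual p i))))"
        using leading[OF i d] by (simp del: One_nat_def)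
      also have "\<dots> = c i * LC (x (bdual p i)) (?t (x i))" using swap[OF frame_gev[OF p fr i]] by (simp del: One_nat_def)
      also have "\<dots> = c i * bform p (bdual p i)" using leading[OF d i] block_data(5)[OF p i] by (simp del: One_nat_def)
      finally show ?thesis using block_data(9)[OF p d] by (simp del: One_nat_def)
    qed
    have c_conj: "c (bconj p i) = cnj (c i)" if i: "i < nblocks p" for i
    proof -
      note d = block_data(3)[OF p i] and b = block_data(4)[OF p i]
      note db = block_data(3)[OF p b]
      have xb: "x (bconj p i) = cconj (x i)" "x (bdual p (bconj p i)) = cconj (x (bdual p i))"
        using frameD(3)[OF p fr i] frameD(3)[OF p fr d] block_data(10)[OF p i] by simp_all
      have tb: "?t (x (bdual p (bconj p i))) = cconj (?t (x (bdual p i)))"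
        using T_pow_frame[OF p fr full d] T_pow_frame[OF p fr full db] xb(2) block_data(8)[OF p d] block_data(10)[OF p i]
          tw_pow_cconj by (simp del: One_nat_def)
      have Pb: "P (x (bconj p i)) = cconj (P (x i))"
        unfolding xb(1) P_def by (simp add: cconj_map_prod[OF \<pi>(1)])
      have fb: "bform p (bconj p i) = cnj (bform p i)"
        using leading[OF b db] leading[OF i d] tb xb(1) by (simp add: LC_cconj)
      show ?thesis unfolding c_def tb Pb fb by (simp add: LC_cconj)
    qed
    \<comment> \<open>modulo the radical of the leading form, \<open>P (x i) = c i x i\<close>\<close>
    have c01: "c i = 0 \<or> c i = 1" if i: "i < nblocks p" for i
    proof -
      note d = block_data(3)[OF p i]
      let ?y = "P (x i) - cscale (c i) (x i)"
      have yz: "LC ?y (?t w) = 0" if w: "w \<in> H" for w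
      proof -
        obtain b v where v: "v \<in> H" "w = (\<Sum>i<nblocks p. cscale (b i) (x i)) + T v"
          using frame_mod_T[OF p fr full w] .
        show ?thesis unfolding v(2) leading_form_sum[OF p fr full v(1)]
          by (rule sum.neutral) (use lead[OF i] leading[OF i] in \<open>simp add: LC_simps\<close>)
      qed
      have "P ?y = cscale (1 - c i) (P (x i))"
        by (simp add: clinear_diff[OF lP] clinear_scale[OF lP] PP cplx.scale_left_diff_distrib)
      then have "(1 - c i) * (c i * bform p i) = LC (P ?y) (?t (x (bdual p i)))"
        using lead[OF i d] by (simp add: LC_simps)
      also have "\<dots> = LC ?y (?t (P (x (bdual p i))))"
      proof -
        have "?y \<in> H" by (intro cplx.subspace_diff[OF subspace_H] cplx.subspace_scale[OF subspace_H] PH xH i)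
        then show ?thesis using Pself[OF _ T_pow_in[OF xH[OF d]]] Pt[OF xH[OF d]] by (simp del: One_nat_def)
      qed
      also have "\<dots> = 0" by (rule yz[OF PH])
      finally show ?thesis using block_data(9)[OF p i] by auto
    qed
    have const: "c i = c 0" if "i < nblocks p" for i
    proof -
      have "c i = c 0 \<and> i < nblocks p"
      proof (rule block_transitive[OF p _ _ _ that])
        show "c (bdual p i) = c 0 \<and> bdual p i < nblocks p" if "i < nblocks p" "c i = c 0 \<and> i < nblocks p" for i
          using c_dual that block_data(3)[OF p] by (simp del: One_nat_def)
        show "c (bconj p i) = c 0 \<and> bconj p i < nblocks p" if "i < nblocks p" "c i = c 0 \<and> i < nblocks p" for i
          using c_conj[of i] that block_data(4)[OF p] c01[OF m] by auto
      qed (use m in simp)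
      then show ?thesis by blast
    qed
    define A where "A u = P u - cscale (c 0) u" for u
    have lA: "clinear A"
      by (rule clinearI) (simp_all add: A_def clinear_add[OF lP] clinear_scale[OF lP] cplx.scale_right_distrib
          cplx.scale_right_diff_distrib mult.commute)
    have AH: "A u \<in> H" if "u \<in> H" for u
      unfolding A_def by (intro cplx.subspace_diff[OF subspace_H] cplx.subspace_scale[OF subspace_H] PH that)
    have AT: "A (T u) = T (A u)" if "u \<in> H" for u
      using PT[OF that] by (simp add: A_def clinear_diff[OF clinear_T] clinear_scale[OF clinear_T])
    have nil: "(A ^^ ?n) u = 0" if "u \<in> H" for u
    proof (rule leading_zero_nilpotent[where A = A, OF p fr full lA AH AT _ that])
      fix i j assume ij: "i < nblocks p" "j < nblocks p"
      have "LC (A (x i)) (?t (x j)) = LC (P (x i)) (?t (x j)) - c 0 * LC (x i) (?t (x j))"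
        by (simp add: A_def LC_simps)
      also have "\<dots> = 0" unfolding lead[OF ij] leading[OF ij] const[OF ij(1)] by simp
      finally show "LC (A (x i)) (?t (x j)) = 0" .
    qed
    from c01[OF m] show False
    proof
      assume c0: "c 0 = 0"
      have "v = 0" if "v \<in> V1" for v
      proof -
        have "A (v, 0) = (v, 0)" using \<pi>1[OF that] by (simp add: A_def c0 P_def linear_0[OF \<pi>(1)])
        then have "(A ^^ k) (v, 0) = (v, 0)" for k by (induction k) simp_all
        moreover have "(v, 0) \<in> H" using that V1 subspace_0[OF subspace_V] by auto
        ultimately show ?thesis using nil[of "(v, 0)"] by (simp add: zero_prod_def)
      qed
      then show False using s(1,3) subspace_0 by blast
    next
      assume c1: "c 0 = 1"
      have "v = 0" if "v \<in> V2" for v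
      proof -
        have "A (v, 0) = cscale (- 1) (v, 0)" using \<pi>2[OF that] by (simp add: A_def c1 P_def linear_0[OF \<pi>(1)] cscale_def)
        then have "(A ^^ k) (v, 0) = cscale ((- 1) ^ k) (v, 0)" for k
          by (induction k) (simp_all add: clinear_scale[OF lA], simp add: cscale_def)
        moreover have "(v, 0) \<in> H" using that V2 subspace_0[OF subspace_V] by auto
        ultimately have "cscale ((- 1) ^ ?n) (v, 0) = 0" using nil[of "(v, 0)"] by simp
        then have "(v, 0) = (0 :: 'a \<times> 'a)" by simp
        then show ?thesis by (simp add: zero_prod_def)
      qed
      then show False using s(2,4) subspace_0 by blast
    qed
  qed
qed

end

section \<open>Pairs with full frames of the same type are isomorphic\<close>

text \<open>Newton iteration: the correction \<open>- X ^ n r(0) / 2\<close> improves an approximate root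
  with error \<open>X ^ n r\<close> and constant term \<open>1\<close> by one order.\<close>

lemma sqrt_one_plus_X:
  "\<exists>s :: real poly. [:0, 1:] ^ Suc n dvd s * s - [:1, 1:] \<and> poly s 0 = 1"
proof (induction n)
  case 0
  have "(1 :: real poly) * 1 - [:1, 1:] = [:0, 1:] ^ Suc 0 * [:- 1:]" by (simp add: one_pCons)
  then show ?case by (metis dvd_triv_left poly_1)
next
  case (Suc n)
  then obtain s r :: "real poly" where s: "s * s - [:1, 1:] = [:0, 1:] ^ Suc n * r" "poly s 0 = 1"
    by (auto elim: dvdE)
  define X c where "X = ([:0, 1:] :: real poly) ^ Suc n" and "c = [:poly r 0 / 2:]"
  define s' where "s' = s - X * c"
  have "s' * s' - [:1, 1:] = (s * s - [:1, 1:]) + X * (X * (c * c) - 2 * s * c)"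
    by (simp add: s'_def algebra_simps)
  also have "\<dots> = X * (r + X * (c * c) - 2 * s * c)"
    unfolding s(1) X_def[symmetric] by (simp add: algebra_simps)
  finally have eq: "s' * s' - [:1, 1:] = X * (r + X * (c * c) - 2 * s * c)" .
  have X0: "poly X 0 = 0" by (simp add: X_def)
  have "poly (r + X * (c * c) - 2 * s * c) 0 = 0" using s(2) X0 by (simp add: c_def)
  then have "[:0, 1:] dvd r + X * (c * c) - 2 * s * c" unfolding poly_eq_0_iff_dvd by simp
  then obtain t where "r + X * (c * c) - 2 * s * c = [:0, 1:] * t" by (elim dvdE)
  then have "s' * s' - [:1, 1:] = [:0, 1:] ^ Suc (Suc n) * t"
    unfolding eq by (simp add: X_def mult.assoc mult.left_commute)
  moreover have "poly s' 0 = 1" using s(2) X0 by (simp add: s'_def)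
  ultimately show ?case by (metis dvd_triv_left)
qed

lemma map_prod_funpow:
  fixes f :: "'a \<Rightarrow> 'a"
  shows "(map_prod f f ^^ k) (a, b) = ((f ^^ k) a, (f ^^ k) b)"
  by (induction k) auto

context seif
begin

text \<open>The square root \<open>h\<close> of \<open>1 + A\<close> is a polynomial in \<open>A\<close>, hence self adjoint like \<open>A\<close>, so that
  \<open>L (h u) (h v) = L (h (h u)) v\<close>.\<close>

lemma sqrt_of_unipotent:
  assumes A: "linear A" "\<And>v. v \<in> V \<Longrightarrow> A v \<in> V" "\<And>v. v \<in> V \<Longrightarrow> (A ^^ n) v = 0"
    and self: "\<And>u v. u \<in> V \<Longrightarrow> v \<in> V \<Longrightarrow> L (A u) v = L u (A v)"
  obtains h where "linear h" "\<And>v. v \<in> V \<Longrightarrow> h v \<in> V"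
    "\<And>u v. u \<in> V \<Longrightarrow> v \<in> V \<Longrightarrow> L (h u) (h v) = L (u + A u) v"
proof -
  obtain s r :: "real poly" where s: "s * s - [:1, 1:] = [:0, 1:] ^ Suc n * r"
    using sqrt_one_plus_X[of n] by (auto elim: dvdE)
  define h where "h = polyop scaleR A s"
  have lh: "linear h" unfolding h_def by (rule linear_polyop[OF A(1)])
  have hV: "h v \<in> V" if "v \<in> V" for v unfolding h_def by (rule polyop_subspace[OF subspace_V A(2) that])
  have AX: "polyop scaleR A [:0, 1:] = A" by (rule ext) simp
  have hh: "h (h v) = v + A v" if v: "v \<in> V" for v
  proof -
    let ?w = "polyop scaleR A r v"
    have w: "?w \<in> V" by (rule polyop_subspace[OF subspace_V A(2) v])
    have "h (h v) = polyop scaleR A (s * s) v" unfolding h_def by (rule polyop_mult[OF A(1), symmetric])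
    also have "s * s = [:1, 1:] + [:0, 1:] ^ Suc n * r" using s by (metis diff_add_cancel add.commute)
    also have "polyop scaleR A \<dots> v = v + A v + (A ^^ Suc n) ?w"
      unfolding polyop_add polyop_mult[OF A(1)] polyop_power[OF A(1)] AX by simp
    also have "(A ^^ Suc n) ?w = 0" using A(3)[OF w] linear_0[OF A(1)] by simp
    finally show ?thesis by simp
  qed
  have hself: "L (polyop scaleR A q u) v = L u (polyop scaleR A q v)" if "u \<in> V" "v \<in> V" for q u v
    using that
  proof (induction q arbitrary: u v)
    case 0 then show ?case by (simp add: L_simps)
  next
    case (pCons a q)
    have "A (polyop scaleR A q v) = polyop scaleR A q (A v)"
      by (rule polyop_commute_on[where S = V and f = A and g = A and f' = A, OF A(1,2) refl pCons.prems(2)])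
    then show ?case
      using pCons.IH[OF A(2)[OF pCons.prems(1)] pCons.prems(2)] self[OF pCons.prems(1), of "polyop scaleR A q v"]
        polyop_subspace[where q = q, OF subspace_V A(2) pCons.prems(2)]
      by (simp add: polyop_pCons L_simps)
  qed
  show ?thesis
  proof (rule that[OF lh hV])
    fix u v assume uv: "u \<in> V" "v \<in> V"
    have "L (h u) (h v) = L (h (h u)) v" unfolding h_def by (rule hself[symmetric]) (use hV[unfolded h_def] uv in auto)
    then show "L (h u) (h v) = L (u + A u) v" using hh[OF uv(1)] by simp
  qed
qed

end

text \<open>Both chain bases have the same multiplication table for \<open>T\<close> and the same leading
  matrix. So the linear map between them is compatible with the monodromies, and it changes the form by a
  unipotent factor only, which \<open>sqrt_of_unipotent\<close> removes.\<close>

lemma frames_isomorphic: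
  fixes V :: "'a::real_vector set" and W :: "'b::real_vector set"
  assumes sV: "seif V L M" and sW: "seif W K N" and p: "admissible p"
    and fx: "frame V L M p x" and fy: "frame W K N p y"
    and dV: "dim V = nblocks p * bsize p" and dW: "dim W = nblocks p * bsize p"
  shows "isomorphic_pairs V L W K"
proof -
  interpret v: seif V L M by (rule sV)
  interpret w: seif W K N by (rule sW)
  let ?I = "chain_index p" and ?n = "bsize p"
  let ?ex = "chain M p x" and ?ey = "chain N p y"
  note vI = v.chain_independent[OF p fx] and vS = v.full_frame_span[OF p fx dV]
  note wI = w.chain_independent[OF p fy] and wS = w.full_frame_span[OF p fy dW]
  \<comment> \<open>the complex linear map taking one chain basis to the other\<close>
  obtain f where f: "clinear f" "\<forall>e\<in>?ex ` ?I. f e = ?ey (the_inv_into ?I ?ex e)"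
    using cpair.linear_independent_extend[OF vI(2), of "\<lambda>e. ?ey (the_inv_into ?I ?ex e)"] by blast
  have fe: "f (?ex q) = ?ey q" if "q \<in> ?I" for q
    using f(2) that the_inv_into_f_f[OF vI(1) that] by simp
  have feS: "f (?ex (i, k)) = ?ey (i, k)" if "i < nblocks p" for i k
  proof (cases "k < ?n")
    case True
    then show ?thesis using fe that by (simp add: chain_index_def)
  next
    case False
    then show ?thesis
      using v.chain_beyond[OF p fx dV that] w.chain_beyond[OF p fy dW that] clinear_0[OF f(1)] by simp
  qed
  have eqI: "g u = g' u" if g: "clinear g" and g': "clinear g'" and u: "u \<in> V \<times> V"
    and eq: "\<And>q. q \<in> ?I \<Longrightarrow> g (?ex q) = g' (?ex q)"
    for g g' :: "'a \<times> 'a \<Rightarrow> 'b \<times> 'b" and u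
  proof -
    have "cplx.subspace {u. g u = g' u}"
      by (rule cplx.subspaceI) (simp_all add: clinear_0[OF g] clinear_0[OF g'] clinear_add[OF g] clinear_add[OF g']
          clinear_scale[OF g] clinear_scale[OF g'])
    then have "cplx.span (?ex ` ?I) \<subseteq> {u. g u = g' u}" by (rule cplx.span_minimal[rotated]) (use eq in blast)
    then show ?thesis using u vS by blast
  qed
  have fH: "f u \<in> W \<times> W" if "u \<in> V \<times> V" for u
  proof -
    have "cplx.subspace {u. f u \<in> W \<times> W}"
      using cplx.subspace_0[OF w.subspace_H] cplx.subspace_add[OF w.subspace_H] cplx.subspace_scale[OF w.subspace_H]
      by (intro cplx.subspaceI) (simp_all add: clinear_0[OF f(1)] clinear_add[OF f(1)] clinear_scale[OF f(1)] del: mem_Sigma_iff)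
    moreover have "?ex ` ?I \<subseteq> {u. f u \<in> W \<times> W}"
      by (rule image_subsetI) (use fe w.chain_in[OF p fy] in \<open>simp del: mem_Sigma_iff\<close>)
    ultimately have "cplx.span (?ex ` ?I) \<subseteq> {u. f u \<in> W \<times> W}" by (rule cplx.span_minimal[rotated])
    then show ?thesis using that vS by blast
  qed
  have fM: "f (map_prod M M u) = map_prod N N (f u)" if "u \<in> V \<times> V" for u
  proof (rule eqI[OF clinear_compose[OF f(1) v.clinear_Mc] clinear_compose[OF w.clinear_Mc f(1)] that])
    fix q assume q: "q \<in> ?I"
    then obtain i k where ik: "q = (i, k)" "i < nblocks p" by (auto simp: chain_index_def)
    note i0 = block_data(6)[OF p ik(2)]
    have "map_prod M M (?ex q) = cscale (bev p i) (?ex q + ?ex (i, Suc k))"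
      using v.Mc_tw[OF i0, of "?ex q"] by (simp add: chain_def ik)
    moreover have "map_prod N N (?ey q) = cscale (bev p i) (?ey q + ?ey (i, Suc k))"
      using w.Mc_tw[OF i0, of "?ey q"] by (simp add: chain_def ik)
    ultimately show "f (map_prod M M (?ex q)) = map_prod N N (f (?ex q))"
      using feS[OF ik(2)] by (simp add: clinear_scale[OF f(1)] clinear_add[OF f(1)] ik(1) fe[OF q, unfolded ik(1)])
  qed
  have fconj: "f (cconj u) = cconj (f u)" if "u \<in> V \<times> V" for u
  proof -
    have lc: "clinear (\<lambda>u. cconj (f (cconj u)))"
      by (rule clinearI) (simp_all add: clinear_add[OF f(1)] clinear_scale[OF f(1)])
    have "f u = cconj (f (cconj u))"
    proof (rule eqI[OF f(1) lc that])
      fix q assume "q \<in> ?I"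
      then obtain i k where ik: "q = (i, k)" "i < nblocks p" by (auto simp: chain_index_def)
      have "cconj (?ex q) = ?ex (bconj p i, k)"
        using v.frameD(3)[OF p fx ik(2)] block_data(8)[OF p ik(2)] by (simp add: chain_def ik flip: v.tw_pow_cconj)
      moreover have "cconj (?ey q) = ?ey (bconj p i, k)"
        using w.frameD(3)[OF p fy ik(2)] block_data(8)[OF p ik(2)] by (simp add: chain_def ik flip: w.tw_pow_cconj)
      ultimately show "f (?ex q) = cconj (f (cconj (?ex q)))"
        using feS[OF block_data(4)[OF p ik(2)], of k] feS[OF ik(2), of k] ik(1)
        by (metis cconj_simps(1))
    qed
    then show ?thesis by (metis cconj_simps(1))
  qed
  \<comment> \<open>\<open>f\<close> commutes with conjugation, so it is the complexification of a real map \<open>r\<close>\<close>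
  define r where "r a = fst (f (a, 0))" for a
  have lr: "linear r"
  proof (rule linearI)
    show "r (a + b) = r a + r b" for a b
      using clinear_add[OF f(1), of "(a, 0)" "(b, 0)"] by (simp add: r_def)
    show "r (c *\<^sub>R a) = c *\<^sub>R r a" for c a
      using clinear_scale[OF f(1), of "of_real c" "(a, 0)"] by (simp add: r_def cscale_def)
  qed
  have V0: "(a, 0) \<in> V \<times> V" if "a \<in> V" for a using that subspace_0[OF v.subspace_V] by simp
  have fr0: "f (a, 0) = (r a, 0)" if a: "a \<in> V" for a
  proof -
    have "f (a, 0) = cconj (f (a, 0))" using fconj[OF V0[OF a]] by simp
    then have "snd (f (a, 0)) = - snd (f (a, 0))" by (metis cconj_def snd_conv)
    then have "snd (f (a, 0)) + snd (f (a, 0)) = 0" by (metis add.left_inverse)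
    then have "snd (f (a, 0)) = 0" by (simp flip: scaleR_2)
    then show ?thesis by (simp add: r_def prod_eq_iff)
  qed
  have fr: "f u = map_prod r r u" if u: "u \<in> V \<times> V" for u
  proof -
    obtain a b where ab: "u = (a, b)" "a \<in> V" "b \<in> V" using u by blast
    have "u = (a, 0) + cscale \<i> (b, 0)" by (simp add: ab cscale_def)
    then show ?thesis using fr0[OF ab(2)] fr0[OF ab(3)]
      by (simp add: clinear_add[OF f(1)] clinear_scale[OF f(1)] ab(1)) (simp add: cscale_def)
  qed
  have rW: "r a \<in> W" if "a \<in> V" for a using fH[OF V0[OF that]] fr0[OF that] by simp
  have rinj: "a = 0" if a: "a \<in> V" "r a = 0" for a
  proof -
    have "(a, 0) \<in> cplx.span (?ex ` ?I)" using V0[OF a(1)] vS by simp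
    then obtain c where c: "(a, 0) = (\<Sum>q\<in>?I. cscale (c q) (?ex q))"
      unfolding v.span_chain_eq[OF p fx] by blast
    have "(\<Sum>q\<in>?I. cscale (c q) (?ey q)) = f (a, 0)"
      unfolding c clinear_sum[OF f(1)] clinear_scale[OF f(1)] by (simp add: fe)
    also have "\<dots> = 0" using fr0[OF a(1)] a(2) by (simp add: zero_prod_def)
    finally have "\<forall>q\<in>?I. c q = 0"
      by (intro w.chain_nondegenerate[OF p fy]) (simp add: w.LC_simps)
    then have "(a, 0) = (0 :: 'a \<times> 'a)" unfolding c by (intro sum.neutral) simp
    then show ?thesis by (simp add: zero_prod_def)
  qed
  have bij_r: "bij_betw r V W"
    by (rule fin_dim_inj_onto[OF v.fin w.fin _ lr rW rinj]) (use dV dW in simp_all)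
  have rM: "r (M a) = N (r a)" if "a \<in> V" for a
    using fM[OF V0[OF that]] fr0[OF that] fr0[OF v.M_in[OF that]] linear_0[OF v.lin_M] by simp
  \<comment> \<open>the pulled back form is \<open>L (G a) b\<close>; the plan is to show that \<open>G\<close> is unipotent\<close>
  have bK: "bilinear_form (\<lambda>a b. K (r a) (r b))"
    unfolding bilinear_form_def by (auto intro!: linearI simp: linear_add[OF lr] linear_scale[OF lr] w.L_simps)
  obtain G where G: "linear G" "\<And>c. G c \<in> V" "\<And>c b. b \<in> V \<Longrightarrow> L (G c) b = K (r c) (r b)"
  proof (rule bilinear_representation[OF v.fin v.bil bK v.nondeg_left])
    fix G assume *: "linear G" "\<And>c. G c \<in> V" "\<And>c b. b \<in> V \<Longrightarrow> L (G c) b = K (r c) (r b)"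
    show ?thesis by (rule that[OF *])
  qed
  have GM: "G (M a) = M (G a)" if a: "a \<in> V" for a
  proof -
    have "L (G (M a) - M (G a)) b = 0" if b: "b \<in> V" for b
    proof -
      obtain b' where b': "b' \<in> V" "M b' = b" using v.bij_M b by (metis bij_betw_imp_surj_on imageE)
      have "L (M (G a)) b = L (G a) b'" using v.M_isometry[OF G(2) b'(1)] b'(2) by simp
      also have "\<dots> = K (r a) (r b')" by (rule G(3)[OF b'(1)])
      also have "\<dots> = K (r (M a)) (r b)" using w.M_isometry[OF rW[OF a] rW[OF b'(1)]] rM[OF a] rM[OF b'(1)] b'(2) by simp
      also have "\<dots> = L (G (M a)) b" using G(3)[OF b] by simp
      finally show ?thesis by (simp add: v.L_simps)
    qed
    moreover have "G (M a) - M (G a) \<in> V" by (intro subspace_diff[OF v.subspace_V] G(2) v.M_in)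
    ultimately show ?thesis using v.nondeg_left[of "G (M a) - M (G a)"] by simp
  qed
  define A where "A a = G a - a" for a
  have lA: "linear A" by (rule linearI) (simp_all add: A_def linear_add[OF G(1)] linear_scale[OF G(1)] scaleR_diff_right)
  have AV: "A a \<in> V" if "a \<in> V" for a unfolding A_def by (intro subspace_diff[OF v.subspace_V] G(2) that)
  have Aform: "L (A a) b = K (r a) (r b) - L a b" if "b \<in> V" for a b
    using G(3)[OF that] by (simp add: A_def v.L_simps)
  have Aself: "L (A a) b = L a (A b)" if a: "a \<in> V" and b: "b \<in> V" for a b
  proof -
    have "L a (G b) = L (M (G b)) a" using v.M_form[OF G(2) a] by simp
    also have "\<dots> = K (r (M b)) (r a)" using GM[OF b] G(3)[OF a, of "M b"] by simp
    also have "\<dots> = K (r a) (r b)" using rM[OF b] w.M_form[OF rW[OF b] rW[OF a]] by simp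
    finally show ?thesis using Aform[OF b] by (simp add: A_def v.L_simps)
  qed
  define P where "P = map_prod A A"
  have lP: "clinear P" unfolding P_def by (rule clinear_map_prod[OF lA])
  have PH: "P u \<in> V \<times> V" if "u \<in> V \<times> V" for u using that AV by (auto simp: P_def)
  have PM: "P (map_prod M M u) = map_prod M M (P u)" if "u \<in> V \<times> V" for u
    unfolding P_def by (rule v.map_prod_commute[where A = A, OF _ that]) (simp add: A_def GM linear_diff[OF v.lin_M])
  have Pform: "v.LC (P u) t = w.LC (f u) (f t) - v.LC u t" if "u \<in> V \<times> V" "t \<in> V \<times> V" for u t
    using that fr Aform by (auto simp: P_def form_cplx_def complex_eq_iff)
  \<comment> \<open>the leading matrices of the two forms agree, so that of \<open>A = G - 1\<close> vanishes\<close>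
  have nil: "(P ^^ ?n) u = 0" if u: "u \<in> V \<times> V" for u
  proof (rule v.leading_zero_nilpotent[where A = P, OF p fx dV lP PH v.T_commute[OF lP PM] _ u])
    fix i j assume ij: "i < nblocks p" "j < nblocks p"
    have t: "(v.T ^^ (?n - 1)) (x j) = ?ex (j, ?n - 1)" "(w.T ^^ (?n - 1)) (y j) = ?ey (j, ?n - 1)"
      using v.T_pow_frame[OF p fx dV ij(2)] w.T_pow_frame[OF p fy dW ij(2)] by (simp_all add: chain_def)
    have x0: "x i = ?ex (i, 0)" "y i = ?ey (i, 0)" by (simp_all add: chain_def)
    note xH = v.frameD(1)[OF p fx ij(1)]
    have tH: "(v.T ^^ (?n - 1)) (x j) \<in> V \<times> V" by (rule v.T_pow_in[OF v.frameD(1)[OF p fx ij(2)]])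
    have "w.LC (f (x i)) (f ((v.T ^^ (?n - 1)) (x j))) = w.LC (y i) ((w.T ^^ (?n - 1)) (y j))"
      unfolding t x0 by (simp add: feS ij)
    also have "\<dots> = v.LC (x i) ((v.T ^^ (?n - 1)) (x j))"
      unfolding v.frame_leading[OF p fx dV ij] w.frame_leading[OF p fy dW ij] ..
    finally show "v.LC (P (x i)) ((v.T ^^ (?n - 1)) (x j)) = 0" using Pform[OF xH tH] by simp
  qed
  have Anil: "(A ^^ ?n) a = 0" if "a \<in> V" for a
    using nil[OF V0[OF that]] unfolding P_def map_prod_funpow by (simp add: zero_prod_def)
  obtain h where h: "linear h" "\<And>a. a \<in> V \<Longrightarrow> h a \<in> V"
    "\<And>a b. a \<in> V \<Longrightarrow> b \<in> V \<Longrightarrow> L (h a) (h b) = L (a + A a) b"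
    using v.sqrt_of_unipotent[OF lA AV Anil Aself] by metis
  have hK: "L (h a) (h b) = K (r a) (r b)" if "a \<in> V" "b \<in> V" for a b
    using h(3)[OF that] G(3)[OF that(2), of a] by (simp add: A_def)
  have hinj: "a = 0" if a: "a \<in> V" "h a = 0" for a
  proof -
    have "K (r a) c = 0" if "c \<in> W" for c
    proof -
      obtain b where "b \<in> V" "r b = c" using bij_r \<open>c \<in> W\<close> by (metis bij_betw_imp_surj_on imageE)
      then show ?thesis using hK[OF a(1), of b] a(2) by (simp add: v.L_simps)
    qed
    then have "r a = 0" using w.nondeg_left[OF rW[OF a(1)]] by blast
    then show ?thesis by (rule rinj[OF a(1)])
  qed
  have bij_h: "bij_betw h V V" by (rule fin_dim_inj_onto[OF v.fin v.fin order_refl h(1,2) hinj])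
  define k where "k = inv_into V h"
  have k: "k a \<in> V" "h (k a) = a" if "a \<in> V" for a
    using bij_betw_imp_surj_on[OF bij_h] that by (auto simp: k_def inv_into_into f_inv_into_f)
  have hh: "a = b" if "a \<in> V" "b \<in> V" "h a = h b" for a b
    using bij_h that by (meson bij_betw_imp_inj_on inj_onD)
  have "lin_iso V W (r \<circ> k)"
    unfolding lin_iso_def
  proof (intro conjI ballI allI)
    have "bij_betw k V V" unfolding k_def by (rule bij_betw_inv_into[OF bij_h])
    then show "bij_betw (r \<circ> k) V W" using bij_r by (rule bij_betw_trans)
    show "(r \<circ> k) (a + b) = (r \<circ> k) a + (r \<circ> k) b" if ab: "a \<in> V" "b \<in> V" for a b
    proof -
      have s: "a + b \<in> V" "k a + k b \<in> V" using ab k(1) subspace_add[OF v.subspace_V] by auto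
      have "k (a + b) = k a + k b"
        by (rule hh[OF k(1)[OF s(1)] s(2)]) (simp add: k(2)[OF s(1)] linear_add[OF h(1)] k(2) ab)
      then show ?thesis by (simp add: linear_add[OF lr])
    qed
    show "(r \<circ> k) (c *\<^sub>R a) = c *\<^sub>R (r \<circ> k) a" if a: "a \<in> V" for c a
    proof -
      have s: "c *\<^sub>R a \<in> V" "c *\<^sub>R k a \<in> V" using a k(1) subspace_scale[OF v.subspace_V] by auto
      have "k (c *\<^sub>R a) = c *\<^sub>R k a"
        by (rule hh[OF k(1)[OF s(1)] s(2)]) (simp add: k(2)[OF s(1)] linear_scale[OF h(1)] k(2) a)
      then show ?thesis by (simp add: linear_scale[OF lr])
    qed
  qed
  moreover have "K ((r \<circ> k) a) ((r \<circ> k) b) = L a b" if "a \<in> V" "b \<in> V" for a b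
    using hK[OF k(1)[OF that(1)] k(1)[OF that(2)]] k(2) that by simp
  ultimately show ?thesis unfolding isomorphic_pairs_def by blast
qed

section \<open>Extracting frames\<close>

lemma admissible_Seif3:
  assumes "n \<ge> 1" "cmod lam = 1" "lam \<notin> {1, - 1}" "\<zeta>\<^sup>2 = cnj lam * (- 1) ^ (n + 1)"
  shows "admissible (Seif3 lam n \<zeta>)"
proof -
  have "cmod (\<zeta>\<^sup>2) = 1" unfolding assms(4) by (simp add: assms(2) norm_mult norm_power)
  then have "cmod \<zeta> ^ 2 = 1" by (simp add: norm_power)
  then have c1: "cmod \<zeta> = 1" by (simp add: power2_eq_1_iff) (metis norm_ge_zero not_one_le_zero neg_0_le_iff_le)
  have "\<zeta> \<notin> {1, - 1}"
  proof
    assume "\<zeta> \<in> {1, - 1}"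
    then have "cnj lam * (- 1) ^ (n + 1) = 1" using assms(4) by auto
    then have "- cnj lam = 1 \<or> cnj lam = 1" by (cases "even n") auto
    then have "cnj lam = - 1 \<or> cnj lam = 1" by (metis minus_minus)
    then show False using assms(3) by (metis complex_cnj_cnj complex_cnj_minus complex_cnj_one insert_iff)
  qed
  then show ?thesis using assms c1 by simp
qed

context seif
begin

text \<open>The leading form for \<open>\<mu>\<close> and order \<open>n\<close> does not vanish. This is
  all that is needed to find a frame.\<close>

definition paired :: "nat \<Rightarrow> complex \<Rightarrow> bool" where
  "paired n \<mu> \<longleftrightarrow> \<mu> \<noteq> 0 \<and> n \<ge> 1 \<and> (\<exists>x\<in>H. \<exists>y\<in>H. (tw M \<mu> ^^ n) x = 0 \<and> (tw M (1 / \<mu>) ^^ n) y = 0 \<and>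
     LC x ((tw M (1 / \<mu>) ^^ (n - 1)) y) \<noteq> 0)"

lemma pairedE:
  assumes "paired n \<mu>"
  obtains x y where "\<mu> \<noteq> 0" "n \<ge> 1" "x \<in> H" "y \<in> H" "(tw M \<mu> ^^ n) x = 0" "(tw M (1 / \<mu>) ^^ n) y = 0"
    "LC x ((tw M (1 / \<mu>) ^^ (n - 1)) y) = 1"
proof -
  obtain x y where xy: "\<mu> \<noteq> 0" "n \<ge> 1" "x \<in> H" "y \<in> H" "(tw M \<mu> ^^ n) x = 0" "(tw M (1 / \<mu>) ^^ n) y = 0"
    "LC x ((tw M (1 / \<mu>) ^^ (n - 1)) y) \<noteq> 0" using assms unfolding paired_def by blast
  let ?y = "cscale (1 / LC x ((tw M (1 / \<mu>) ^^ (n - 1)) y)) y"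
  show ?thesis
  proof (rule that[OF xy(1-3) _ xy(5)])
    show "?y \<in> H" by (rule cplx.subspace_scale[OF subspace_H xy(4)])
    show "(tw M (1 / \<mu>) ^^ n) ?y = 0" "LC x ((tw M (1 / \<mu>) ^^ (n - 1)) ?y) = 1"
      using xy(6,7) by (simp_all add: clinear_scale[OF clinear_tw_pow] LC_simps)
  qed
qed

lemma pairedI:
  assumes "\<mu> \<noteq> 0" "n \<ge> 1" "x \<in> H" "y \<in> H" "(tw M \<mu> ^^ n) x = 0" "(tw M (1 / \<mu>) ^^ n) y = 0"
    "LC x ((tw M (1 / \<mu>) ^^ (n - 1)) y) \<noteq> 0"
  shows "paired n \<mu>"
  using assms unfolding paired_def by blast

lemma paired_inverse: "paired n \<mu> \<Longrightarrow> paired n (1 / \<mu>)"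
proof (erule pairedE)
  fix x y assume xy: "\<mu> \<noteq> 0" "n \<ge> 1" "x \<in> H" "y \<in> H" "(tw M \<mu> ^^ n) x = 0" "(tw M (1 / \<mu>) ^^ n) y = 0"
    "LC x ((tw M (1 / \<mu>) ^^ (n - 1)) y) = 1"
  show "paired n (1 / \<mu>)"
    using leading_form_swap[OF xy(1,3-6,2)] xy
    by (intro pairedI[of _ n y x]) simp_all
qed

lemma paired_cnj: "paired n \<mu> \<Longrightarrow> paired n (cnj \<mu>)"
proof (erule pairedE)
  fix x y assume xy: "\<mu> \<noteq> 0" "n \<ge> 1" "x \<in> H" "y \<in> H" "(tw M \<mu> ^^ n) x = 0" "(tw M (1 / \<mu>) ^^ n) y = 0"
    "LC x ((tw M (1 / \<mu>) ^^ (n - 1)) y) = 1"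
  have c: "1 / cnj \<mu> = cnj (1 / \<mu>)" by simp
  show "paired n (cnj \<mu>)"
    by (rule pairedI[of _ n "cconj x" "cconj y"]) (use xy in \<open>simp_all only: c tw_pow_cconj LC_cconj cconj_in_H cconj_simps
      complex_cnj_zero_iff complex_cnj_one one_neq_zero not_False_eq_True\<close>)
qed

text \<open>For a real eigenvalue everything can be done over the real numbers.\<close>

lemma tw_of_real: "tw M (of_real m) = map_prod (\<lambda>a. (1 / m) *\<^sub>R M a - a) (\<lambda>a. (1 / m) *\<^sub>R M a - a)"
  by (rule ext) (auto simp: tw_def cscale_def)

lemma tw_pow_real: "(tw M (of_real m) ^^ k) (a, 0) = (fst ((tw M (of_real m) ^^ k) (a, 0)), 0)"
proof -
  have "((\<lambda>a. (1 / m) *\<^sub>R M a - a) ^^ k) 0 = 0"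
    by (induction k) (simp_all add: linear_0[OF lin_M])
  then show ?thesis unfolding tw_of_real map_prod_funpow by simp
qed

lemma paired_realE:
  assumes "paired n (of_real m)"
  obtains a b where "m \<noteq> 0" "n \<ge> 1" "a \<in> V" "b \<in> V" "(tw M (of_real m) ^^ n) (a, 0) = 0"
    "(tw M (1 / of_real m) ^^ n) (b, 0) = 0" "LC (a, 0) ((tw M (1 / of_real m) ^^ (n - 1)) (b, 0)) = 1"
proof -
  obtain x y where xy: "of_real m \<noteq> (0 :: complex)" "n \<ge> 1" "x \<in> H" "y \<in> H" "(tw M (of_real m) ^^ n) x = 0"
    "(tw M (1 / of_real m) ^^ n) y = 0" "LC x ((tw M (1 / of_real m) ^^ (n - 1)) y) = 1"
    using assms by (rule pairedE)
  have m': "1 / of_real m = (of_real (1 / m) :: complex)" by simp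
  let ?t = "\<lambda>m a. (1 / m) *\<^sub>R M a - a"
  have pw: "(tw M (of_real m) ^^ k) (a, b) = ((?t m ^^ k) a, (?t m ^^ k) b)" for m k a b
    unfolding tw_of_real map_prod_funpow ..
  have t0: "((\<lambda>a. c *\<^sub>R M a - a) ^^ k) 0 = 0" for c k by (induction k) (simp_all add: linear_0[OF lin_M])
  obtain a b c d where xy': "x = (a, b)" "y = (c, d)" by (metis surj_pair)
  have mem: "a \<in> V" "b \<in> V" "c \<in> V" "d \<in> V" using xy(3,4) xy' by auto
  have zero: "(?t m ^^ n) a = 0" "(?t m ^^ n) b = 0" "(?t (1 / m) ^^ n) c = 0" "(?t (1 / m) ^^ n) d = 0"
    using xy(5,6) unfolding xy' m' pw by (simp_all add: zero_prod_def)
  have "\<exists>u\<in>{a, b}. \<exists>v\<in>{c, d}. L u ((?t (1 / m) ^^ (n - 1)) v) \<noteq> 0"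
  proof (rule ccontr)
    assume "\<not> ?thesis"
    then have "LC x ((tw M (1 / of_real m) ^^ (n - 1)) y) = 0"
      unfolding xy' m' pw by (simp add: form_cplx_def complex_eq_iff)
    then show False using xy(7) by simp
  qed
  then obtain u v where uv: "u \<in> {a, b}" "v \<in> {c, d}" and ne: "L u ((?t (1 / m) ^^ (n - 1)) v) \<noteq> 0" by blast
  define s where "s = 1 / L u ((?t (1 / m) ^^ (n - 1)) v)"
  show ?thesis
  proof (rule that[of u "s *\<^sub>R v"])
    show "m \<noteq> 0" "n \<ge> 1" using xy(1,2) by simp_all
    show "u \<in> V" "s *\<^sub>R v \<in> V" using uv mem subspace_scale[OF subspace_V] by auto
    show "(tw M (of_real m) ^^ n) (u, 0) = 0" unfolding pw using uv(1) zero t0 by (auto simp: zero_prod_def)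
    have sv: "(s *\<^sub>R v, 0) = cscale (of_real s) (v, 0)" by (simp add: cscale_def)
    have "(tw M (1 / of_real m) ^^ n) (v, 0) = 0" unfolding m' pw using uv(2) zero t0 by (auto simp: zero_prod_def)
    then show "(tw M (1 / of_real m) ^^ n) (s *\<^sub>R v, 0) = 0" unfolding sv by (simp add: clinear_scale[OF clinear_tw_pow])
    show "LC (u, 0) ((tw M (1 / of_real m) ^^ (n - 1)) (s *\<^sub>R v, 0)) = 1"
      unfolding sv clinear_scale[OF clinear_tw_pow] LC_simps m' pw t0 LC_real using ne by (simp add: s_def)
  qed
qed

text \<open>The leading form is symmetric, so by polarization some real vector has a nonzero square;
  scale it to \<open>\<plusminus>1\<close>.\<close>

lemma frame_Seif1:
  assumes "paired n (of_real m)" "m = 1 \<or> m = - 1" "m * (- 1) ^ (n - 1) = 1"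
  shows "\<exists>\<epsilon> x. \<epsilon> \<in> {1, - 1} \<and> frame V L M (Seif1 m n \<epsilon>) x"
proof -
  obtain a b where ab: "n \<ge> 1" "a \<in> V" "b \<in> V" "(tw M (of_real m) ^^ n) (a, 0) = 0"
    "(tw M (1 / of_real m) ^^ n) (b, 0) = 0" "LC (a, 0) ((tw M (1 / of_real m) ^^ (n - 1)) (b, 0)) = 1"
    using assms(1) by (rule paired_realE)
  have m1: "1 / of_real m = (of_real m :: complex)" using assms(2) by auto
  let ?t = "tw M (of_real m)"
  let ?w = "\<lambda>u v. LC u ((?t ^^ (n - 1)) v)"
  have V0: "(c, 0) \<in> H" if "c \<in> V" for c using that subspace_0[OF subspace_V] by simp
  note ab' = ab(4-6)[unfolded m1]
  have "of_real m * (- 1) ^ (n - 1) = (1::complex)" using assms(3) by (metis of_real_1 of_real_minus of_real_mult of_real_power)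
  moreover have "of_real m \<noteq> (0::complex)" using assms(2) by auto
  ultimately have sym: "?w (b, 0) (a, 0) = 1"
    using leading_form_swap[of "of_real m" "(a, 0)" "(b, 0)" n] V0 ab(1-3) ab' m1 by simp
  have "\<exists>c\<in>V. (?t ^^ n) (c, 0) = 0 \<and> ?w (c, 0) (c, 0) \<noteq> 0"
  proof (rule ccontr)
    assume "\<not> ?thesis"
    then have *: "?w (c, 0) (c, 0) = 0" if "c \<in> V" "(?t ^^ n) (c, 0) = 0" for c using that by blast
    have e: "(a + b, 0) = (a, 0) + (b, 0 :: 'a)" by simp
    have "(?t ^^ n) (a + b, 0) = 0" unfolding e clinear_add[OF clinear_tw_pow] using ab' by simp
    then have "?w (a + b, 0) (a + b, 0) = 0" using * ab(2,3) subspace_add[OF subspace_V] by blast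
    moreover have "?w (a + b, 0) (a + b, 0)
        = ?w (a, 0) (a, 0) + ?w (a, 0) (b, 0) + (?w (b, 0) (a, 0) + ?w (b, 0) (b, 0))"
      unfolding e clinear_add[OF clinear_tw_pow] LC_simps by (simp only: ac_simps)
    ultimately have "?w (a, 0) (a, 0) + ?w (a, 0) (b, 0) + (?w (b, 0) (a, 0) + ?w (b, 0) (b, 0)) = 0" by simp
    then show False using *[OF ab(2)] *[OF ab(3)] ab' sym by simp
  qed
  then obtain c where c: "c \<in> V" "(?t ^^ n) (c, 0) = 0" "?w (c, 0) (c, 0) \<noteq> 0" by blast
  define r where "r = L c (fst ((?t ^^ (n - 1)) (c, 0)))"
  have r: "?w (c, 0) (c, 0) = of_real r"
    by (subst tw_pow_real) (simp add: LC_real r_def)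
  then have r0: "r \<noteq> 0" using c(3) by auto
  define s :: complex where "s = of_real (1 / sqrt \<bar>r\<bar>)"
  have "s * s * of_real r = of_real (sgn r)"
  proof -
    have "1 / sqrt \<bar>r\<bar> * (1 / sqrt \<bar>r\<bar>) * r = r / (sqrt \<bar>r\<bar> * sqrt \<bar>r\<bar>)" by (simp add: field_simps)
    also have "\<dots> = sgn r" by (simp add: sgn_real_def)
    finally show ?thesis unfolding s_def by (metis of_real_mult)
  qed
  moreover have "cnj s = s" by (simp add: s_def)
  moreover have "cscale s (c, 0) \<in> H" by (rule cplx.subspace_scale[OF subspace_H V0[OF c(1)]])
  ultimately have "frame V L M (Seif1 m n (sgn r)) (\<lambda>_. cscale s (c, 0))"
    using c(2) r by (simp add: frame_def clinear_scale[OF clinear_tw_pow] LC_simps mult.assoc del: mem_Sigma_iff)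
  moreover have "sgn r \<in> {1, - 1}" using r0 by (simp add: sgn_real_def)
  ultimately show ?thesis by blast
qed

text \<open>Two real vectors with leading form \<open>1\<close> suffice; in case of \<open>m =
  \<plusminus>1\<close> their squares vanish by skew symmetry.\<close>

lemma frame_Seif2_4:
  assumes "paired n (of_real m)"
  shows "m = 1 \<or> m = - 1 \<Longrightarrow> m * (- 1) ^ (n - 1) = - 1 \<Longrightarrow> \<exists>x. frame V L M (Seif2 m n) x"
    and "\<exists>x. frame V L M (Seif4 m n) x"
proof -
  obtain a b where ab: "m \<noteq> 0" "n \<ge> 1" "a \<in> V" "b \<in> V" "(tw M (of_real m) ^^ n) (a, 0) = 0"
    "(tw M (1 / of_real m) ^^ n) (b, 0) = 0" "LC (a, 0) ((tw M (1 / of_real m) ^^ (n - 1)) (b, 0)) = 1"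
    using assms(1) by (rule paired_realE)
  have H: "(a, 0) \<in> H" "(b, 0) \<in> H" using ab(3,4) subspace_0[OF subspace_V] by simp_all
  have swap: "LC (b, 0) ((tw M (of_real m) ^^ (n - 1)) (a, 0)) = of_real m * (- 1) ^ (n - 1)"
    using leading_form_swap[of "of_real m" "(a, 0)" "(b, 0)" n] H ab by simp
  let ?x = "\<lambda>i::nat. if i = 0 then (a, 0) else (b, 0)"
  show "\<exists>x. frame V L M (Seif4 m n) x"
    by (rule exI[of _ ?x]) (use ab H swap in \<open>auto simp: frame_def dest!: less_cases\<close>)
  assume m: "m = 1 \<or> m = - 1" "m * (- 1) ^ (n - 1) = - 1"
  have "of_real m * (- 1) ^ (n - 1) = (- 1::complex)" using m(2) by (metis of_real_1 of_real_minus of_real_mult of_real_power)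
  moreover have "1 / of_real m = (of_real m :: complex)" using m(1) by auto
  ultimately show "\<exists>x. frame V L M (Seif2 m n) x"
    by (intro exI[of _ ?x]) (use ab H swap in \<open>auto simp: frame_def dest!: less_cases\<close>)
qed

text \<open>The form \<open>h u v = \<omega> u (cconj v)\<close> is Hermitian up to a constant on the
  unit circle. By polarization some \<open>h u u\<close> is nonzero, and its direction is determined up
  to sign by its conjugate. Scaling makes it a unit.\<close>

lemma frame_Seif3:
  assumes "paired n lam" "cmod lam = 1" "\<zeta>\<^sup>2 = cnj lam * (- 1) ^ (n + 1)"
  shows "\<exists>\<zeta>' x. \<zeta>' \<in> {\<zeta>, - \<zeta>} \<and> frame V L M (Seif3 lam n \<zeta>') x"
proof -
  obtain x y where xy: "lam \<noteq> 0" "n \<ge> 1" "x \<in> H" "y \<in> H" "(tw M lam ^^ n) x = 0"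
    "(tw M (1 / lam) ^^ n) y = 0" "LC x ((tw M (1 / lam) ^^ (n - 1)) y) = 1"
    using assms(1) by (rule pairedE)
  have l: "1 / lam = cnj lam" using unit_circle(1)[OF assms(2)] by simp
  note xy' = xy(6,7)[unfolded l]
  let ?h = "\<lambda>u v. LC u ((tw M (cnj lam) ^^ (n - 1)) (cconj v))"
  let ?K = "{u \<in> H. (tw M lam ^^ n) u = 0}"
  have K: "cplx.subspace ?K"
    using cplx.subspace_0[OF subspace_H] cplx.subspace_add[OF subspace_H] cplx.subspace_scale[OF subspace_H]
    by (intro cplx.subspaceI)
      (simp_all add: clinear_0[OF clinear_tw_pow] clinear_add[OF clinear_tw_pow] clinear_scale[OF clinear_tw_pow] del: mem_Sigma_iff)
  have lin: "?h (u + u') v = ?h u v + ?h u' v" "?h v (u + u') = ?h v u + ?h v u'"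
    "?h (cscale c u) v = c * ?h u v" "?h v (cscale c u) = cnj c * ?h v u" for u u' v c
    by (simp_all add: LC_simps clinear_add[OF clinear_tw_pow] clinear_scale[OF clinear_tw_pow])
  define z where "z = cconj y"
  have yz: "y = cconj z" by (simp add: z_def)
  have xK: "x \<in> ?K" using xy(3,5) by blast
  have zK: "z \<in> ?K"
  proof -
    have "(tw M lam ^^ n) z = 0" using tw_pow_cconj[of n "cnj lam" y] xy'(1) by (simp add: z_def)
    then show ?thesis using xy(4) by (simp add: z_def del: mem_Sigma_iff)
  qed
  have hxz: "?h x z = 1" using xy'(2) by (simp add: yz)
  have "\<exists>u\<in>?K. ?h u u \<noteq> 0"
  proof (rule ccontr)
    assume "\<not> ?thesis"
    then have *: "?h u u = 0" if "u \<in> ?K" for u using that by blast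
    have "?h x z + ?h z x = ?h (x + z) (x + z) - ?h x x - ?h z z" unfolding lin by simp
    also have "\<dots> = 0" unfolding *[OF xK] *[OF zK] *[OF cplx.subspace_add[OF K xK zK]] by simp
    finally have 1: "?h x z + ?h z x = 0" .
    have iz: "cscale \<i> z \<in> ?K" by (rule cplx.subspace_scale[OF K zK])
    have "\<i> * ?h z x - \<i> * ?h x z = ?h (x + cscale \<i> z) (x + cscale \<i> z) - ?h x x - ?h z z"
      unfolding lin by (simp add: algebra_simps)
    also have "\<dots> = 0" unfolding *[OF xK] *[OF zK] *[OF cplx.subspace_add[OF K xK iz]] by simp
    finally have "\<i> * ?h z x - \<i> * ?h x z = 0" .
    then have "?h z x = ?h x z" by simp
    then show False using 1 hxz by simp
  qed
  then obtain u where u: "u \<in> H" "(tw M lam ^^ n) u = 0" "?h u u \<noteq> 0" by blast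
  have cu: "(tw M (cnj lam) ^^ n) (cconj u) = 0" using u(2) by (simp add: tw_pow_cconj)
  have ch: "LC (cconj u) ((tw M lam ^^ (n - 1)) u) = cnj (?h u u)"
    using tw_pow_cconj[of "n - 1" "cnj lam" "cconj u"] by (simp flip: LC_cconj)
  have "LC (cconj u) ((tw M lam ^^ (n - 1)) u) = lam * (- 1) ^ (n - 1) * ?h u u"
    using leading_form_swap[OF xy(1) u(1), of "cconj u" n, unfolded l] u(1,2) cu xy(2) by (simp del: mem_Sigma_iff)
  then have herm: "cnj (?h u u) = lam * (- 1) ^ (n - 1) * ?h u u" using ch by simp
  define r where "r = cmod (?h u u)"
  have r0: "r > 0" using u(3) by (simp add: r_def)
  define \<zeta>' where "\<zeta>' = ?h u u / of_real r"
  have h\<zeta>: "?h u u = of_real r * \<zeta>'" using r0 by (simp add: \<zeta>'_def)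
  have "cmod \<zeta>' = 1" using r0 by (simp add: \<zeta>'_def norm_divide r_def)
  have cz: "cnj \<zeta>' = lam * (- 1) ^ (n - 1) * \<zeta>'" using herm r0 by (simp add: \<zeta>'_def)
  have "1 = cnj \<zeta>' * \<zeta>'" using \<open>cmod \<zeta>' = 1\<close> by (simp add: complex_norm_square[symmetric] mult.commute)
  also have "\<dots> = lam * (- 1) ^ (n - 1) * \<zeta>'\<^sup>2" by (simp add: cz power2_eq_square)
  finally have "cnj lam * (- 1) ^ (n - 1) = (cnj lam * lam) * ((- 1) ^ (n - 1) * (- 1) ^ (n - 1)) * \<zeta>'\<^sup>2"
    by (metis (no_types, lifting) mult.assoc mult.commute mult.left_commute mult_1_right)
  moreover have "cnj lam * lam = 1" using assms(2) by (simp add: complex_norm_square[symmetric] mult.commute)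
  moreover have "(- 1) ^ (n - 1) * (- 1) ^ (n - 1) = (1::complex)" by (simp flip: power_add)
  moreover have "(- 1 :: complex) ^ (n + 1) = (- 1) ^ (n - 1)" using xy(2) by (cases n) auto
  ultimately have "\<zeta>'\<^sup>2 = \<zeta>\<^sup>2" using assms(3) by simp
  then have z': "\<zeta>' \<in> {\<zeta>, - \<zeta>}" by (simp add: power2_eq_iff)
  \<comment> \<open>\<open>h\<close> scales with \<open>s * cnj s\<close>, so its direction \<open>\<zeta>'\<close> persists\<close>
  define s :: complex where "s = of_real (1 / sqrt r)"
  have s: "s * s * of_real r = 1" "cnj s = s"
    using r0 by (simp_all add: s_def real_sqrt_mult_self flip: of_real_mult)
  define v where "v = cscale s u"
  have v: "v \<in> H" "(tw M lam ^^ n) v = 0" "?h v v = \<zeta>'"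
  proof -
    show "v \<in> H" unfolding v_def by (rule cplx.subspace_scale[OF subspace_H u(1)])
    show "(tw M lam ^^ n) v = 0" unfolding v_def by (simp add: clinear_scale[OF clinear_tw_pow] u(2))
    have "?h v v = s * s * ?h u u" unfolding v_def by (simp only: lin s(2) mult.assoc)
    also have "\<dots> = s * s * of_real r * \<zeta>'" unfolding h\<zeta> by (simp only: mult.assoc)
    finally show "?h v v = \<zeta>'" by (simp only: s(1) mult_1_left)
  qed
  have "LC (cconj v) ((tw M lam ^^ (n - 1)) v) = cnj \<zeta>'"
    using tw_pow_cconj[of "n - 1" "cnj lam" "cconj v"] v(3) by (simp add: LC_cconj)
  then have "frame V L M (Seif3 lam n \<zeta>') (\<lambda>i. if i = 0 then v else cconj v)"
    using v tw_pow_cconj[of n lam v] by (auto simp: frame_def dest!: less_cases simp del: mem_Sigma_iff)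
  then show ?thesis using z' by blast
qed

text \<open>Two vectors with leading form \<open>1\<close> and their conjugates form a frame.\<close>

lemma frame_Seif5:
  assumes "paired n lam"
  shows "\<exists>x. frame V L M (Seif5 lam n) x"
proof -
  obtain x y where xy: "lam \<noteq> 0" "n \<ge> 1" "x \<in> H" "y \<in> H" "(tw M lam ^^ n) x = 0"
    "(tw M (1 / lam) ^^ n) y = 0" "LC x ((tw M (1 / lam) ^^ (n - 1)) y) = 1"
    using assms(1) by (rule pairedE)
  have swap: "LC y ((tw M lam ^^ (n - 1)) x) = lam * (- 1) ^ (n - 1)"
    using leading_form_swap[OF xy(1,3-6,2)] xy(7) by simp
  have c: "1 / cnj lam = cnj (1 / lam)" by simp
  let ?x = "\<lambda>i::nat. if i = 0 then x else if i = 1 then y else if i = 2 then cconj x else cconj y"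
  have conj: "(tw M (cnj lam) ^^ n) (cconj x) = 0" "(tw M (1 / cnj lam) ^^ n) (cconj y) = 0"
    "LC (cconj x) ((tw M (1 / cnj lam) ^^ (n - 1)) (cconj y)) = 1"
    "LC (cconj y) ((tw M (cnj lam) ^^ (n - 1)) (cconj x)) = cnj lam * (- 1) ^ (n - 1)"
    unfolding c tw_pow_cconj LC_cconj using xy(5,6,7) swap by simp_all
  have "frame V L M (Seif5 lam n) ?x"
    unfolding frame_def
  proof (intro allI impI)
    fix i assume "i < nblocks (Seif5 lam n)"
    then have "i = 0 \<or> i = 1 \<or> i = 2 \<or> i = 3" by auto
    then show "?x i \<in> H \<and> (tw M (bev (Seif5 lam n) i) ^^ bsize (Seif5 lam n)) (?x i) = 0 \<and>
        ?x (bconj (Seif5 lam n) i) = cconj (?x i) \<and>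
        LC (?x i) ((tw M (bev (Seif5 lam n) (bdual (Seif5 lam n) i)) ^^ (bsize (Seif5 lam n) - 1))
          (?x (bdual (Seif5 lam n) i))) = bform (Seif5 lam n) i"
      by (elim disjE) (use xy conj swap in \<open>simp_all del: mem_Sigma_iff One_nat_def\<close>)
  qed
  then show ?thesis by blast
qed

text \<open>Up to replacing the eigenvalue by its inverse and its conjugate, one of the five cases applies.\<close>

lemma paired_imp_frame:
  assumes "paired n \<mu>"
  shows "\<exists>p x. admissible p \<and> frame V L M p x"
proof -
  have \<mu>: "\<mu> \<noteq> 0" "n \<ge> 1" using assms by (simp_all add: paired_def)
  have "\<exists>l. paired n l \<and> cmod l \<ge> 1 \<and> Im l \<ge> 0"
  proof -
    have 1: "\<exists>l. paired n l \<and> cmod l \<ge> 1"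
    proof (cases "cmod \<mu> \<ge> 1")
      case False
      then have "cmod (1 / \<mu>) \<ge> 1" using \<mu>(1) by (simp add: norm_divide divide_simps)
      then show ?thesis using paired_inverse[OF assms] by blast
    qed (use assms in blast)
    then obtain l where "paired n l" "cmod l \<ge> 1" by blast
    then have "paired n l \<and> cmod l \<ge> 1 \<and> Im l \<ge> 0 \<or> paired n (cnj l) \<and> cmod (cnj l) \<ge> 1 \<and> Im (cnj l) \<ge> 0"
      using paired_cnj[of n l] by auto
    then show ?thesis by blast
  qed
  then obtain l where l: "paired n l" "cmod l \<ge> 1" "Im l \<ge> 0" by blast
  show ?thesis
  proof (cases "Im l = 0")
    case True
    then have lr: "l = of_real (Re l)" by (simp add: complex_eq_iff)
    define m where "m = Re l"
    have pm: "paired n (of_real m)" using l(1) lr m_def by simp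
    have "\<bar>m\<bar> \<ge> 1" using l(2) lr m_def by (metis norm_of_real)
    then consider "m > 1 \<or> m < - 1" | "m = 1 \<or> m = - 1" by linarith
    then show ?thesis
    proof cases
      case 1
      then have "admissible (Seif4 m n)" using \<mu>(2) by simp
      then show ?thesis using frame_Seif2_4(2)[OF pm] by blast
    next
      case 2
      consider "m = 1 \<and> odd n \<or> m = - 1 \<and> even n" | "m = 1 \<and> even n \<or> m = - 1 \<and> odd n" using 2 by blast
      then show ?thesis
      proof cases
        case 1
        then have "m * (- 1) ^ (n - 1) = 1" using \<mu>(2) by (cases n) auto
        from frame_Seif1[OF pm 2 this] obtain \<epsilon> x where "\<epsilon> \<in> {1, - 1}" "frame V L M (Seif1 m n \<epsilon>) x" by blast
        then show ?thesis using 1 \<mu>(2) by (intro exI[of _ "Seif1 m n \<epsilon>"] exI[of _ x]) auto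
      next
        case e2: 2
        then have "m * (- 1) ^ (n - 1) = - 1" using \<mu>(2) by (cases n) auto
        from frame_Seif2_4(1)[OF pm 2 this] obtain x where "frame V L M (Seif2 m n) x" by blast
        then show ?thesis using e2 \<mu>(2) by (intro exI[of _ "Seif2 m n"] exI[of _ x]) auto
      qed
    qed
  next
    case False
    show ?thesis
    proof (cases "cmod l = 1")
      case True
      have ln: "l \<notin> {1, - 1}" using False by auto
      define \<zeta> where "\<zeta> = csqrt (cnj l * (- 1) ^ (n + 1))"
      have z2: "\<zeta>\<^sup>2 = cnj l * (- 1) ^ (n + 1)" by (simp add: \<zeta>_def)
      from frame_Seif3[OF l(1) True z2] obtain \<zeta>' x where
        z: "\<zeta>' \<in> {\<zeta>, - \<zeta>}" "frame V L M (Seif3 l n \<zeta>') x" by blast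
      have z2': "\<zeta>'\<^sup>2 = cnj l * (- 1) ^ (n + 1)" using z(1) z2 by auto
      have "admissible (Seif3 l n \<zeta>')" by (rule admissible_Seif3[OF \<mu>(2) True ln z2'])
      then show ?thesis using z(2) by blast
    next
      case f2: False
      then have "admissible (Seif5 l n)" using l False \<mu>(2) by simp
      then show ?thesis using frame_Seif5[OF l(1)] by blast
    qed
  qed
qed

end

section \<open>Jordan bases\<close>

lemma sum_lessThan_add: "(\<Sum>i<m + l. g i) = (\<Sum>i<m. g i) + (\<Sum>i<l. g (m + i :: nat))"
  for g :: "nat \<Rightarrow> 'a::comm_monoid_add"
  by (induction l) (auto simp: add.assoc)

lemma jordan_matrix_Cons_index:
  assumes "i < m + sum_list (map fst bs)" "j < m + sum_list (map fst bs)"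
  shows "jordan_matrix ((m, a) # bs) $$ (i, j) =
    (if i < m then if j < m then jordan_block m a $$ (i, j) else 0
     else if j < m then 0 else jordan_matrix bs $$ (i - m, j - m))"
proof -
  have "jordan_matrix ((m, a) # bs) = four_block_mat (jordan_block m a)
      (0\<^sub>m m (dim_col (jordan_matrix bs))) (0\<^sub>m (dim_row (jordan_matrix bs)) m) (jordan_matrix bs)"
    by (simp add: jordan_matrix_def Let_def)
  then show ?thesis using assms by (simp add: jordan_matrix_dim)
qed

text \<open>The columns of the matrix condition in \<open>jordan_blocks_on\<close>, separated from the
  condition that \<open>vs\<close> is a basis so that it can be handled by recursion on the list of
  blocks.\<close>

definition jordan_columns ::
  "('a::real_vector \<times> 'a \<Rightarrow> 'a \<times> 'a) \<Rightarrow> (nat \<times> complex) list \<Rightarrow> ('a \<times> 'a) list \<Rightarrow> bool"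
where
  "jordan_columns f bs vs \<longleftrightarrow> length vs = sum_list (map fst bs) \<and>
     (\<forall>j<length vs. f (vs ! j) = (\<Sum>i<length vs. cscale (jordan_matrix bs $$ (i, j)) (vs ! i)))"

definition jordan_string :: "('a::real_vector \<times> 'a \<Rightarrow> 'a \<times> 'a) \<Rightarrow> complex \<Rightarrow> ('a \<times> 'a) list \<Rightarrow> bool" where
  "jordan_string f a us \<longleftrightarrow>
     (\<forall>j<length us. f (us ! j) = cscale a (us ! j) + (if j = 0 then 0 else us ! (j - 1)))"

lemma jordan_columns_Cons:
  assumes m: "length us = m" and l: "length ws = sum_list (map fst bs)"
  shows "jordan_columns f ((m, a) # bs) (us @ ws) \<longleftrightarrow> jordan_string f a us \<and> jordan_columns f bs ws"
proof -
  let ?J = "jordan_matrix ((m, a) # bs)" and ?l = "length ws"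
  have len: "length (us @ ws) = m + ?l" using m by simp
  have first: "(\<Sum>i<m + ?l. cscale (?J $$ (i, j)) ((us @ ws) ! i))
      = cscale a (us ! j) + (if j = 0 then 0 else us ! (j - 1))" if j: "j < m" for j
  proof -
    have "(\<Sum>i<?l. cscale (?J $$ (m + i, j)) ((us @ ws) ! (m + i))) = 0"
      by (rule sum.neutral) (use j l in \<open>simp add: jordan_matrix_Cons_index\<close>)
    moreover have "(\<Sum>i<m. cscale (?J $$ (i, j)) ((us @ ws) ! i))
        = (\<Sum>i<m. (if i = j then cscale a (us ! j) else 0) + (if Suc i = j then us ! i else 0))"
      by (rule sum.cong) (use j l m in \<open>auto simp: jordan_matrix_Cons_index nth_append\<close>)
    moreover have "(\<Sum>i<m. if Suc i = j then us ! i else 0) = (if j = 0 then 0 else us ! (j - 1))"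
    proof (cases j)
      case (Suc j')
      have "(\<Sum>i<m. if Suc i = j then us ! i else 0) = (\<Sum>i<m. if i = j' then us ! i else 0)"
        by (simp add: Suc)
      then show ?thesis using j Suc by simp
    qed simp
    ultimately show ?thesis using j by (simp add: sum_lessThan_add sum.distrib)
  qed
  have second: "(\<Sum>i<m + ?l. cscale (?J $$ (i, m + j)) ((us @ ws) ! i))
      = (\<Sum>i<?l. cscale (jordan_matrix bs $$ (i, j)) (ws ! i))" if j: "j < ?l" for j
  proof -
    have "(\<Sum>i<m. cscale (?J $$ (i, m + j)) ((us @ ws) ! i)) = 0"
      by (rule sum.neutral) (use j l in \<open>simp add: jordan_matrix_Cons_index\<close>)
    moreover have "(\<Sum>i<?l. cscale (?J $$ (m + i, m + j)) ((us @ ws) ! (m + i)))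
        = (\<Sum>i<?l. cscale (jordan_matrix bs $$ (i, j)) (ws ! i))"
      by (rule sum.cong) (use j l m in \<open>auto simp: jordan_matrix_Cons_index nth_append\<close>)
    ultimately show ?thesis by (simp add: sum_lessThan_add)
  qed
  have split: "(\<forall>j<m + ?l. P j) \<longleftrightarrow> (\<forall>j<m. P j) \<and> (\<forall>j<?l. P (m + j))" for P
  proof safe
    fix j assume *: "\<forall>j<m. P j" "\<forall>j<?l. P (m + j)" "j < m + ?l"
    show "P j" using * spec[OF *(2), of "j - m"] by (cases "j < m") auto
  qed auto
  have "jordan_columns f ((m, a) # bs) (us @ ws) \<longleftrightarrow>
      (\<forall>j<m + ?l. f ((us @ ws) ! j) = (\<Sum>i<m + ?l. cscale (?J $$ (i, j)) ((us @ ws) ! i)))"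
    unfolding jordan_columns_def len using l by simp
  also have "\<dots> \<longleftrightarrow> jordan_string f a us \<and> jordan_columns f bs ws"
    unfolding split jordan_string_def jordan_columns_def using first second l m by (simp add: nth_append)
  finally show ?thesis .
qed

lemma jordan_columns_Cons_split:
  assumes "jordan_columns f ((m, a) # bs) vs"
  obtains us ws where "vs = us @ ws" "length us = m" "jordan_string f a us" "jordan_columns f bs ws"
proof -
  have len: "length vs = m + sum_list (map fst bs)" using assms by (simp add: jordan_columns_def)
  have vs: "vs = take m vs @ drop m vs" by simp
  have "length (take m vs) = m" "length (drop m vs) = sum_list (map fst bs)" using len by simp_all
  from jordan_columns_Cons[OF this, of f a] assms vs show ?thesis
    using that[of "take m vs" "drop m vs"] \<open>length (take m vs) = m\<close> by simp
qed

lemma jordan_columns_concat: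
  assumes "\<And>i. i < k \<Longrightarrow> length (u i) = m \<and> jordan_string f (a i) (u i)"
  shows "jordan_columns f (map (\<lambda>i. (m, a i)) [0..<k]) (concat (map u [0..<k]))"
proof -
  have "jordan_columns f (map (\<lambda>i. (m, a i)) is) (concat (map u is))" if "set is \<subseteq> {..<k}" for "is"
    using that
  proof (induction "is")
    case Nil
    show ?case by (simp add: jordan_columns_def)
  next
    case (Cons i "is")
    then have c: "jordan_columns f (map (\<lambda>i. (m, a i)) is) (concat (map u is))" by simp
    then have "length (concat (map u is)) = sum_list (map fst (map (\<lambda>i. (m, a i)) is))"
      by (simp add: jordan_columns_def)
    then show ?case using jordan_columns_Cons[of "u i" m] assms[of i] Cons.prems c by simp
  qed
  then show ?thesis by (simp add: atLeast0LessThan)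
qed

text \<open>In the order of the columns of a Jordan block, \<open>f - a\<close> maps each vector to its predecessor and the first one
  to zero.\<close>

lemma jordan_string_powers:
  assumes us: "jordan_string f a us" and f0: "f 0 = 0" and j: "j < length us"
  defines "D \<equiv> \<lambda>y. f y - cscale a y"
  shows "(D ^^ j) (us ! j) = us ! 0" "(D ^^ Suc j) (us ! j) = 0"
proof -
  have Dj: "D (us ! i) = (if i = 0 then 0 else us ! (i - 1))" if "i < length us" for i
    using us that by (simp add: jordan_string_def D_def)
  have D0: "D 0 = 0" by (simp add: D_def f0)
  have "(D ^^ i) (us ! i) = us ! 0" if "i < length us" for i
    using that by (induction i) (simp_all add: funpow_swap1 Dj)
  then show 1: "(D ^^ j) (us ! j) = us ! 0" using j .
  show "(D ^^ Suc j) (us ! j) = 0" using 1 Dj[of 0] j by (cases us) (simp_all)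
qed

context seif
begin

lemma shift_eq_polyop: "((\<lambda>y. Mc y - cscale a y) ^^ k) x = polyop cscale Mc ([:- a, 1:] ^ k) x"
proof -
  have "polyop cscale Mc [:- a, 1:] = (\<lambda>y. Mc y - cscale a y)" by (rule ext) simp
  then show ?thesis by (simp add: cplx.polyop_power[OF clinear_Mc])
qed

lemma jordan_columns_vectors:
  assumes "jordan_columns Mc bs vs" "set vs \<subseteq> H" "0 \<notin> set vs"
  shows "\<forall>v\<in>set vs. \<exists>b\<in>set bs. snd b \<noteq> 0 \<and> (tw M (snd b) ^^ fst b) v = 0"
    and "\<forall>b\<in>set bs. fst b > 0 \<longrightarrow> snd b \<noteq> 0 \<and>
      (\<exists>v\<in>set vs. (tw M (snd b) ^^ fst b) v = 0 \<and> (tw M (snd b) ^^ (fst b - 1)) v \<noteq> 0)"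
proof -
  have "(\<forall>v\<in>set vs. \<exists>b\<in>set bs. snd b \<noteq> 0 \<and> (tw M (snd b) ^^ fst b) v = 0) \<and>
    (\<forall>b\<in>set bs. fst b > 0 \<longrightarrow> snd b \<noteq> 0 \<and>
      (\<exists>v\<in>set vs. (tw M (snd b) ^^ fst b) v = 0 \<and> (tw M (snd b) ^^ (fst b - 1)) v \<noteq> 0))"
    using assms
  proof (induction bs arbitrary: vs)
    case Nil
    then show ?case by (simp add: jordan_columns_def)
  next
    case (Cons b bs)
    obtain m a where b: "b = (m, a)" by fastforce
    obtain us ws where vs: "vs = us @ ws" "length us = m" "jordan_string Mc a us" "jordan_columns Mc bs ws"
      using jordan_columns_Cons_split[OF Cons.prems(1)[unfolded b]] .
    have IH: "(\<forall>v\<in>set ws. \<exists>b\<in>set bs. snd b \<noteq> 0 \<and> (tw M (snd b) ^^ fst b) v = 0) \<and>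
      (\<forall>b\<in>set bs. fst b > 0 \<longrightarrow> snd b \<noteq> 0 \<and>
        (\<exists>v\<in>set ws. (tw M (snd b) ^^ fst b) v = 0 \<and> (tw M (snd b) ^^ (fst b - 1)) v \<noteq> 0))"
      by (rule Cons.IH[OF vs(4)]) (use Cons.prems vs(1) in auto)
    have block: "m > 0 \<longrightarrow> a \<noteq> 0 \<and> (\<forall>v\<in>set us. (tw M a ^^ m) v = 0) \<and>
      (\<exists>v\<in>set us. (tw M a ^^ m) v = 0 \<and> (tw M a ^^ (m - 1)) v \<noteq> 0)"
    proof
      assume m: "m > 0"
      have u0: "us ! 0 \<in> set us" using m vs(2) by simp
      then have u0': "us ! 0 \<in> H" "us ! 0 \<noteq> 0" using Cons.prems vs(1) by auto
      have "Mc (us ! 0) = cscale a (us ! 0)" using vs(2,3) m by (simp add: jordan_string_def)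
      then have a: "a \<noteq> 0" using Mc_eq_0[OF u0'(1)] u0'(2) by auto
      note pw = jordan_string_powers[OF vs(3) clinear_0[OF clinear_Mc], unfolded shift_eq_polyop vs(2)]
      have z: "(tw M a ^^ m) v = 0" if v: "v \<in> set us" for v
      proof -
        obtain j where j: "j < m" "v = us ! j" using v vs(2) by (auto simp: in_set_conv_nth)
        have "(tw M a ^^ Suc j) v = 0" using pw(2)[OF j(1)] tw_pow_zero_iff[OF a, of "Suc j" v] j(2) by (simp only:)
        then show ?thesis by (rule tw_pow_zero_mono) (use j(1) in simp)
      qed
      have "(tw M a ^^ (m - 1)) (us ! (m - 1)) \<noteq> 0"
        using pw(1)[of "m - 1"] m u0'(2) tw_pow_zero_iff[OF a, of "m - 1" "us ! (m - 1)"] by simp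
      moreover have "us ! (m - 1) \<in> set us" using m vs(2) by simp
      ultimately show "a \<noteq> 0 \<and> (\<forall>v\<in>set us. (tw M a ^^ m) v = 0) \<and>
          (\<exists>v\<in>set us. (tw M a ^^ m) v = 0 \<and> (tw M a ^^ (m - 1)) v \<noteq> 0)"
        using a z by blast
    qed
    show ?case
    proof (intro conjI ballI)
      fix v assume "v \<in> set vs"
      then consider "v \<in> set us" | "v \<in> set ws" using vs(1) by auto
      then show "\<exists>b\<in>set (b # bs). snd b \<noteq> 0 \<and> (tw M (snd b) ^^ fst b) v = 0"
      proof cases
        case 1
        then have "m > 0" using vs(2) by (cases us) auto
        then show ?thesis using block 1 b by auto
      next
        case 2
        then show ?thesis using IH by auto
      qed
    next
      fix b' assume "b' \<in> set (b # bs)"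
      then consider "b' = (m, a)" | "b' \<in> set bs" using b by auto
      then show "0 < fst b' \<longrightarrow> snd b' \<noteq> 0 \<and>
          (\<exists>v\<in>set vs. (tw M (snd b') ^^ fst b') v = 0 \<and> (tw M (snd b') ^^ (fst b' - 1)) v \<noteq> 0)"
      proof cases
        case 1
        then show ?thesis using block vs(1) by auto
      next
        case 2
        then show ?thesis using IH vs(1) by auto
      qed
    qed
  qed
  then show "\<forall>v\<in>set vs. \<exists>b\<in>set bs. snd b \<noteq> 0 \<and> (tw M (snd b) ^^ fst b) v = 0"
    and "\<forall>b\<in>set bs. fst b > 0 \<longrightarrow> snd b \<noteq> 0 \<and>
      (\<exists>v\<in>set vs. (tw M (snd b) ^^ fst b) v = 0 \<and> (tw M (snd b) ^^ (fst b - 1)) v \<noteq> 0)" by blast+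
qed

lemma jordan_blocks_onE:
  assumes "jordan_blocks_on H (monodromy_cplx V L) bs"
  obtains vs where "distinct vs" "cplx.independent (set vs)" "cplx.span (set vs) = H" "set vs \<subseteq> H" "0 \<notin> set vs"
    "jordan_columns Mc bs vs" "length vs = dim V" "\<And>b. b \<in> set bs \<Longrightarrow> fst b > 0"
proof -
  obtain vs where vs: "0 \<notin> fst ` set bs" "distinct vs" "\<not> cplx.dependent (set vs)" "cplx.span (set vs) = H"
    "length vs = dim_row (jordan_matrix bs)"
    "\<forall>j<length vs. monodromy_cplx V L (vs ! j) = (\<Sum>i<length vs. cscale (jordan_matrix bs $$ (i, j)) (vs ! i))"
    using assms unfolding jordan_blocks_on_def by blast
  have sub: "set vs \<subseteq> H" using cplx.span_superset[of "set vs"] vs(4) by blast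
  have "vs ! j \<in> H" if "j < length vs" for j using sub that nth_mem by blast
  then have "jordan_columns Mc bs vs"
    using vs(5,6) monodromy_cplx_eq unfolding jordan_columns_def by (simp del: mem_Sigma_iff)
  moreover have "length vs = dim V"
    using Times_independent_card(4)[OF fin vs(3) sub vs(4)] distinct_card[OF vs(2)] by simp
  moreover have "0 \<notin> set vs" using vs(3) cplx.dependent_zero by blast
  moreover have "fst b > 0" if "b \<in> set bs" for b using vs(1) that by (metis gr0I imageI)
  ultimately show ?thesis using vs sub that by blast
qed

text \<open>Let \<open>y\<close> generate a Jordan block of maximal size. By nondegeneracy some vector \<open>v\<close> of the Jordan basis is
  not orthogonal to the end of its chain; \<open>v\<close> has the inverse eigenvalue, and by maximality it is
  killed by the same power.\<close>

lemma jordan_block_paired: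
  assumes bs: "jordan_blocks_on H (monodromy_cplx V L) bs" and b: "b \<in> set bs"
    and max: "\<And>b'. b' \<in> set bs \<Longrightarrow> fst b' \<le> fst b"
  shows "paired (fst b) (snd b)"
proof -
  obtain vs where vs: "cplx.span (set vs) = H" "set vs \<subseteq> H" "0 \<notin> set vs" "jordan_columns Mc bs vs"
    "\<And>b. b \<in> set bs \<Longrightarrow> fst b > 0"
    using jordan_blocks_onE[OF bs] by metis
  let ?m = "fst b" and ?\<mu> = "snd b"
  obtain y where y: "?\<mu> \<noteq> 0" "y \<in> set vs" "(tw M ?\<mu> ^^ ?m) y = 0" "(tw M ?\<mu> ^^ (?m - 1)) y \<noteq> 0"
    using jordan_columns_vectors(2)[OF vs(4,2,3)] vs(5)[OF b] b by blast
  let ?z = "(tw M ?\<mu> ^^ (?m - 1)) y"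
  have yH: "y \<in> H" using y(2) vs(2) by blast
  have zH: "?z \<in> H" by (rule tw_pow_in[OF yH])
  have "\<exists>v\<in>set vs. LC v ?z \<noteq> 0"
  proof (rule ccontr)
    assume *: "\<not> ?thesis"
    have "cplx.subspace {v. LC v ?z = 0}" by (rule cplx.subspaceI) (simp_all add: LC_simps)
    then have "cplx.span (set vs) \<subseteq> {v. LC v ?z = 0}" by (rule cplx.span_minimal[rotated]) (use * in blast)
    then have "?z = 0" using LC_nondeg(2)[OF zH] vs(1) by blast
    then show False using y(4) by blast
  qed
  then obtain v where v: "v \<in> set vs" "LC v ?z \<noteq> 0" by blast
  have vH: "v \<in> H" using v(1) vs(2) by blast
  obtain b' where b': "b' \<in> set bs" "snd b' \<noteq> 0" "(tw M (snd b') ^^ fst b') v = 0"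
    using jordan_columns_vectors(1)[OF vs(4,2,3)] v(1) by blast
  have zg: "?z \<in> gev ?\<mu>" by (rule tw_pow_gev[OF gevI[OF yH y(3)]])
  have "snd b' * ?\<mu> = 1" using gev_orthogonal[OF gevI[OF vH b'(3)] zg] v(2) by blast
  then have "snd b' = 1 / ?\<mu>" using y(1) by (simp add: divide_simps)
  then have vz: "(tw M (1 / ?\<mu>) ^^ ?m) v = 0" using tw_pow_zero_mono[OF b'(3) max[OF b'(1)]] by simp
  have "paired ?m (1 / ?\<mu>)"
    using y v(2) vz yH vH vs(5)[OF b] by (intro pairedI[of _ _ v y]) simp_all
  from paired_inverse[OF this] show ?thesis by simp
qed

lemma gev_disjoint: "x \<in> gev \<mu> \<Longrightarrow> x \<in> gev \<nu> \<Longrightarrow> x \<noteq> 0 \<Longrightarrow> \<mu> = \<nu>"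
proof (rule ccontr)
  assume x: "x \<in> gev \<mu>" "x \<in> gev \<nu>" "x \<noteq> 0" and ne: "\<mu> \<noteq> \<nu>"
  let ?y = "\<lambda>l. if l = \<mu> then x else - x"
  have "cscale (- 1) x \<in> gev \<nu>" by (rule cplx.subspace_scale[OF subspace_gev x(2)])
  then have "?y \<mu> = 0"
    using x ne by (intro gev_sum_eq_0[of "{\<mu>, \<nu>}" ?y]) (auto simp del: split_paired_All)
  then show False using x(3) by simp
qed

lemma paired_ex: "paired n \<mu> \<Longrightarrow> \<exists>x\<in>gev \<mu>. x \<noteq> 0"
proof (erule pairedE)
  fix x y assume xy: "x \<in> H" "(tw M \<mu> ^^ n) x = 0" "LC x ((tw M (1 / \<mu>) ^^ (n - 1)) y) = 1"
  then have "x \<noteq> 0" by (auto simp: LC_simps)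
  then show "\<exists>x\<in>gev \<mu>. x \<noteq> 0" using gevI[OF xy(1,2)] by blast
qed

text \<open>Otherwise a generalized eigenvector for \<open>\<mu>\<close> would be a sum of generalized
  eigenvectors for other eigenvalues.\<close>

lemma paired_in_spectrum:
  assumes "paired n \<mu>" "direct_sum_of H \<Lambda> (gen_eigenspace V L)"
  shows "\<mu> \<in> \<Lambda>"
proof (rule ccontr)
  assume n: "\<mu> \<notin> \<Lambda>"
  obtain x where x: "x \<in> gev \<mu>" "x \<noteq> 0" using paired_ex[OF assms(1)] by blast
  have "x \<in> H" by (rule gev_in[OF x(1)])
  then obtain y where y: "finite \<Lambda>" "x = (\<Sum>i\<in>\<Lambda>. y i)" "\<forall>i\<in>\<Lambda>. y i \<in> gev i"
    using assms(2) unfolding direct_sum_of_def gen_eigenspace_eq by blast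
  have mx: "- x \<in> gev \<mu>" using cplx.subspace_scale[OF subspace_gev x(1), of "- 1"] by simp
  have "(y(\<mu> := - x)) \<mu> = 0"
  proof (rule gev_sum_eq_0[of "insert \<mu> \<Lambda>" "y(\<mu> := - x)"])
    show "(y(\<mu> := - x)) l \<in> gev l" if "l \<in> insert \<mu> \<Lambda>" for l using that mx y(3) by auto
    have "(\<Sum>l\<in>\<Lambda>. (y(\<mu> := - x)) l) = (\<Sum>l\<in>\<Lambda>. y l)" by (rule sum.cong) (use n in auto)
    then show "(\<Sum>l\<in>insert \<mu> \<Lambda>. (y(\<mu> := - x)) l) = 0" using y(1,2) n by simp
  qed (use y(1) in simp_all)
  then show False using x(2) by simp
qed

end

section \<open>The types in terms of full frames\<close>

context seif
begin

text \<open>On the generalized eigenspace for \<open>\<mu>\<close> conjugation turns \<open>tw M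
  \<mu>\<close> into \<open>tw M (cnj \<mu>)\<close>.\<close>

lemma T_cconj:
  assumes "u \<in> H"
  shows "T (cconj u) = cconj (T u)"
proof -
  have lin: "clinear (\<lambda>u. cconj (T (cconj u)))"
    by (rule clinearI) (simp_all add: clinear_add[OF clinear_T] clinear_scale[OF clinear_T])
  have "T u = cconj (T (cconj u))"
  proof (rule clinear_eq_on_H[OF clinear_T lin assms])
    fix \<mu> x assume "x \<in> gev \<mu>"
    then show "T x = cconj (T (cconj x))"
      using T_gev[of x \<mu>] T_gev[OF gev_cconj, of x \<mu>] tw_cconj[of \<mu> x] by simp
  qed
  then show ?thesis by (metis cconj_simps(1))
qed

context
  fixes p x
  assumes p: "admissible p" and fr: "frame V L M p x" and full: "dim V = nblocks p * bsize p"
begin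

text \<open>The leading form in coordinates: contributions of the image of \<open>T\<close> vanish in
  both arguments.\<close>

lemma leading_form_mod_T:
  assumes "z \<in> H" "w \<in> H"
  shows "LC ((\<Sum>i<nblocks p. cscale (a i) (x i)) + T z)
      ((T ^^ (bsize p - 1)) ((\<Sum>i<nblocks p. cscale (b i) (x i)) + T w))
    = (\<Sum>i<nblocks p. a i * b (bdual p i) * bform p i)"
proof -
  let ?n = "bsize p" and ?m = "nblocks p"
  have left: "LC ((\<Sum>i<?m. cscale (a i) (x i)) + T z) ((T ^^ (?n - 1)) (x j))
      = (\<Sum>i<?m. a i * (if j = bdual p i then bform p i else 0))" if j: "j < ?m" for j
  proof -
    note xj = frameD(1)[OF p fr j]
    have "LC ((T ^^ 1) z) ((T ^^ (?n - 1)) (x j)) = 0"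
      by (rule skew_pow_form_zero[where f = T and g = T and n = ?n, OF T_adjoint T_in T_in assms(1) xj T_bsize[OF p fr full xj]])
        (use block_data(1)[OF p] in simp_all)
    then have "LC (T z) ((T ^^ (?n - 1)) (x j)) = 0" by simp
    then show ?thesis using frame_leading[OF p fr full _ j] by (simp add: LC_simps LC_sum)
  qed
  have "LC ((\<Sum>i<?m. cscale (a i) (x i)) + T z) ((T ^^ (?n - 1)) ((\<Sum>i<?m. cscale (b i) (x i)) + T w))
      = (\<Sum>j<?m. b j * (\<Sum>i<?m. a i * (if j = bdual p i then bform p i else 0)))"
    unfolding leading_form_sum[OF p fr full assms(2)] by (rule sum.cong) (simp_all add: left del: One_nat_def)
  also have "\<dots> = (\<Sum>i<?m. \<Sum>j<?m. if j = bdual p i then a i * b j * bform p i else 0)"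
    unfolding sum_distrib_left by (subst sum.swap) (auto intro!: sum.cong)
  also have "\<dots> = (\<Sum>i<?m. a i * b (bdual p i) * bform p i)"
    by (rule sum.cong) (simp_all add: block_data(3)[OF p])
  finally show ?thesis .
qed

lemma nilp_part_top: "u \<in> H \<Longrightarrow> (nilp_part V L ^^ (bsize p - 1)) u = (T ^^ (bsize p - 1)) u"
proof (rule nilp_part_pow)
  assume "u \<in> H"
  then show "(T ^^ Suc (bsize p - 1)) u = 0" by (rule T_bsize[OF p fr full]) simp
qed

lemma frame_vector_not_in_image:
  assumes "i < nblocks p"
  shows "x i \<notin> nilp_part V L ` H"
proof
  assume "x i \<in> nilp_part V L ` H"
  then obtain z where z: "z \<in> H" "x i = T z" unfolding nilp_part_image by blast
  have "(T ^^ (bsize p - 1)) (x i) = 0" unfolding z(2) by (rule T_pow_top_eq_0[OF p fr full z(1)])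
  moreover note d = block_data(3)[OF p assms]
  ultimately have "bform p (bdual p i) = 0"
    using frame_leading[OF p fr full d assms] block_data(5)[OF p assms] by (simp add: LC_simps)
  then show False using block_data(9)[OF p d] by simp
qed

lemma full_gen_eigenspace:
  assumes "\<And>i. i < nblocks p \<Longrightarrow> bev p i = \<mu>"
  shows "H = gen_eigenspace V L \<mu>"
proof -
  have "cplx.span (chain M p x ` chain_index p) \<subseteq> gev \<mu>"
    by (rule cplx.span_minimal[OF image_subsetI subspace_gev])
      (use chain_gev[OF p fr] assms in \<open>auto simp: chain_index_def\<close>)
  then show ?thesis using full_frame_span[OF p fr full] gev_in unfolding gen_eigenspace_eq by blast
qed

lemma full_direct_sum:
  assumes \<Lambda>: "finite \<Lambda>" "\<And>i. i < nblocks p \<Longrightarrow> bev p i \<in> \<Lambda>"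
  shows "direct_sum_of H \<Lambda> (gen_eigenspace V L)"
  unfolding direct_sum_of_def gen_eigenspace_eq
proof (intro conjI allI impI)
  let ?D = "{\<Sum>i\<in>\<Lambda>. y i |y. \<forall>i\<in>\<Lambda>. y i \<in> gev i}"
  have "cplx.subspace ?D"
  proof (rule cplx.subspaceI)
    have "(\<Sum>i\<in>\<Lambda>. 0) \<in> ?D" using cplx.subspace_0[OF subspace_gev] by blast
    then show "0 \<in> ?D" by simp
  next
    fix u v assume "u \<in> ?D" "v \<in> ?D"
    then obtain y y' where y: "u = (\<Sum>i\<in>\<Lambda>. y i)" "\<forall>i\<in>\<Lambda>. y i \<in> gev i" "v = (\<Sum>i\<in>\<Lambda>. y' i)" "\<forall>i\<in>\<Lambda>. y' i \<in> gev i"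
      by blast
    then have "u + v = (\<Sum>i\<in>\<Lambda>. y i + y' i)" "\<forall>i\<in>\<Lambda>. y i + y' i \<in> gev i"
      using cplx.subspace_add[OF subspace_gev] by (simp_all add: sum.distrib)
    then show "u + v \<in> ?D" by blast
  next
    fix c u assume "u \<in> ?D"
    then obtain y where y: "u = (\<Sum>i\<in>\<Lambda>. y i)" "\<forall>i\<in>\<Lambda>. y i \<in> gev i" by blast
    then have "cscale c u = (\<Sum>i\<in>\<Lambda>. cscale c (y i))" "\<forall>i\<in>\<Lambda>. cscale c (y i) \<in> gev i"
      using cplx.subspace_scale[OF subspace_gev] by (simp_all add: cplx.scale_sum_right)
    then show "cscale c u \<in> ?D" by blast
  qed
  moreover have "chain M p x ` chain_index p \<subseteq> ?D"
  proof (rule image_subsetI)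
    fix q assume q: "q \<in> chain_index p"
    define \<mu> where "\<mu> = bev p (fst q)"
    have \<mu>: "\<mu> \<in> \<Lambda>" using q \<Lambda>(2) by (auto simp: chain_index_def \<mu>_def)
    let ?y = "\<lambda>l. if l = \<mu> then chain M p x q else 0"
    have "chain M p x q = (\<Sum>l\<in>\<Lambda>. ?y l)" using \<mu> \<Lambda>(1) by simp
    moreover have "\<forall>l\<in>\<Lambda>. ?y l \<in> gev l"
      using chain_gev[OF p fr q] cplx.subspace_0[OF subspace_gev] by (simp add: \<mu>_def)
    ultimately show "chain M p x q \<in> ?D" by blast
  qed
  ultimately have "cplx.span (chain M p x ` chain_index p) \<subseteq> ?D" by (rule cplx.span_minimal[rotated])
  moreover have "?D \<subseteq> H"
  proof
    fix u assume "u \<in> ?D"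
    then obtain y where y: "u = (\<Sum>i\<in>\<Lambda>. y i)" "\<forall>i\<in>\<Lambda>. y i \<in> gev i" by blast
    show "u \<in> H" unfolding y(1) by (rule cplx.subspace_sum[OF subspace_H]) (use y(2) gev_in in blast)
  qed
  ultimately show "H = ?D" using full_frame_span[OF p fr full] by blast
next
  fix y i assume "(\<forall>i\<in>\<Lambda>. y i \<in> gev i) \<and> sum y \<Lambda> = 0"
  then show "\<forall>i\<in>\<Lambda>. y i = 0" using gev_sum_eq_0[OF \<Lambda>(1), of y] by blast
qed (rule \<Lambda>(1))

text \<open>A Jordan basis is given by the chains in reverse order; the factors \<open>\<mu> ^ k\<close>
  are due to \<open>M - \<mu> = \<mu> tw M \<mu>\<close>.\<close>

lemma full_jordan_blocks:
  "jordan_blocks_on H (monodromy_cplx V L) (map (\<lambda>i. (bsize p, bev p i)) [0..<nblocks p])"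
proof -
  let ?n = "bsize p" and ?m = "nblocks p" and ?e = "chain M p x"
  let ?bs = "map (\<lambda>i. (?n, bev p i)) [0..<?m]"
  define v where "v q = cscale (bev p (fst q) ^ snd q) (?e q)" for q
  define us where "us i = map (\<lambda>j. v (i, ?n - Suc j)) [0..<?n]" for i
  define vs where "vs = concat (map us [0..<?m])"
  have string: "length (us i) = ?n \<and> jordan_string Mc (bev p i) (us i)" if i: "i < ?m" for i
  proof
    show len: "length (us i) = ?n" by (simp add: us_def)
    show "jordan_string Mc (bev p i) (us i)"
      unfolding jordan_string_def len
    proof (intro allI impI)
      fix j assume j: "j < ?n"
      let ?k = "?n - Suc j"
      have uj: "us i ! j = v (i, ?k)" using j by (simp add: us_def)
      have "Mc (v (i, ?k)) = cscale (bev p i) (v (i, ?k)) + v (i, Suc ?k)"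
        using Mc_tw[OF block_data(6)[OF p i], of "?e (i, ?k)"]
        by (simp add: v_def clinear_scale[OF clinear_Mc] cplx.scale_right_distrib chain_def mult.commute del: map_prod_simp)
      moreover have "v (i, Suc ?k) = (if j = 0 then 0 else us i ! (j - 1))"
        using j chain_beyond[OF p fr full i, of ?n] by (auto simp: v_def us_def Suc_diff_Suc)
      ultimately show "Mc (us i ! j) = cscale (bev p i) (us i ! j) + (if j = 0 then 0 else us i ! (j - 1))"
        unfolding uj by simp
    qed
  qed
  have cols: "jordan_columns Mc ?bs vs" unfolding vs_def by (rule jordan_columns_concat[OF string])
  have len: "length vs = ?m * ?n"
    using cols by (simp add: jordan_columns_def o_def sum_list_triv)
  have "(\<lambda>j. ?n - Suc j) ` {..<?n} = {..<?n}"
  proof (intro subset_antisym subsetI)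
    fix k assume "k \<in> {..<?n}"
    then show "k \<in> (\<lambda>j. ?n - Suc j) ` {..<?n}" by (intro image_eqI[of _ _ "?n - Suc k"]) auto
  qed auto
  then have "set (us i) = (\<lambda>k. v (i, k)) ` {..<?n}" for i
    unfolding us_def set_map set_upt atLeast0LessThan by (metis image_image)
  then have set: "set vs = v ` chain_index p"
    by (auto simp: vs_def chain_index_def)
  have zero: "\<forall>q\<in>chain_index p. c q = 0" if c: "(\<Sum>q\<in>chain_index p. cscale (c q) (v q)) = 0" for c
  proof -
    have "(\<Sum>q\<in>chain_index p. cscale (c q * bev p (fst q) ^ snd q) (?e q)) = 0" using c by (simp add: v_def)
    then have "\<forall>q\<in>chain_index p. c q * bev p (fst q) ^ snd q = 0"
      by (intro chain_nondegenerate[OF p fr]) (simp add: LC_simps)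
    then show ?thesis using block_data(6)[OF p] by (auto simp: chain_index_def)
  qed
  note ind = indexed_independent[where v = v, OF finite_chain_index zero]
  have vH: "v q \<in> H" if "q \<in> chain_index p" for q
    unfolding v_def by (rule cplx.subspace_scale[OF subspace_H chain_in[OF p fr that]])
  have sub: "set vs \<subseteq> V \<times> V" unfolding set by (rule image_subsetI[OF vH])
  have card: "card (set vs) = ?m * ?n" unfolding set using card_image[OF ind(1)] card_chain_index by simp
  show ?thesis
    unfolding jordan_blocks_on_def
  proof (intro conjI exI[of _ vs])
    show "0 \<notin> fst ` set ?bs" using block_data(1)[OF p] by auto
    show "distinct vs" using card len by (simp add: card_distinct)
    show "cplx.independent (set vs)" unfolding set by (rule ind(2))
    show "cplx.span (set vs) = H"
      by (rule Times_independent_card(3)[OF fin _ sub]) (use ind(2) set card full in simp_all)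
    show "length vs = dim_row (jordan_matrix ?bs)" using cols by (simp add: jordan_columns_def)
    show "\<forall>j<length vs. monodromy_cplx V L (vs ! j) = (\<Sum>i<length vs. cscale (jordan_matrix ?bs $$ (i, j)) (vs ! i))"
    proof (intro allI impI)
      fix j assume j: "j < length vs"
      then have "vs ! j \<in> H" using sub nth_mem by blast
      then show "monodromy_cplx V L (vs ! j) = (\<Sum>i<length vs. cscale (jordan_matrix ?bs $$ (i, j)) (vs ! i))"
        using cols j monodromy_cplx_eq unfolding jordan_columns_def by simp
    qed
  qed
qed

end

text \<open>The sign conditions follow from the leading form in coordinates: for \<open>a\<close> with
  coefficient \<open>c\<close> at the first frame vector it takes the value \<open>c\<^sup>2
  \<epsilon>\<close> with \<open>c\<close> real, respectively \<open>\<bar>c\<bar>\<^sup>2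
  \<zeta>\<close>, and \<open>c \<noteq> 0\<close> unless \<open>a\<close> lies in the image of
  \<open>N\<close>.\<close>

lemma frame_imp_has_type:
  assumes p: "admissible p" and fr: "frame V L M p x" and full: "dim V = nblocks p * bsize p"
  shows "has_type V L p"
proof -
  note jb = full_jordan_blocks[OF p fr full]
  have blocks: "\<exists>bs. jordan_blocks_on H (monodromy_cplx V L) bs \<and> length bs = nblocks p \<and> (\<forall>b\<in>set bs. fst b = bsize p)"
    using jb by (intro exI conjI) auto
  note ds = full_direct_sum[OF p fr full]
  show ?thesis
  proof (cases p)
    case (Seif1 lam n \<epsilon>)
    have \<epsilon>: "\<epsilon> \<noteq> 0" "bform p 0 = of_real \<epsilon>" "nblocks p = 1" "bsize p = n" "bdual p 0 = 0"
      using p Seif1 by auto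
    have sgn: "LC (a, 0) ((nilp_part V L ^^ (n - 1)) (a, 0)) \<in> pos_ray (of_real \<epsilon>)"
      if a: "a \<in> V" "(a, 0) \<notin> nilp_part V L ` H" for a
    proof -
      have aH: "(a, 0) \<in> H" using a(1) subspace_0[OF subspace_V] by simp
      obtain c z where z: "z \<in> H" "(a, 0) = (\<Sum>i<nblocks p. cscale (c i) (x i)) + T z"
        using frame_mod_T[OF p fr full aH] .
      have cz: "cconj z \<in> H" using z(1) by simp
      have x0: "cconj (x 0) = x 0" using frameD(3)[OF p fr, of 0] Seif1 by simp
      have zero: "0 \<in> H" by (rule cplx.subspace_0[OF subspace_H])
      have e: "cconj (a, 0) = (a, 0 :: 'a)" by simp
      have z': "(a, 0) = (\<Sum>i<nblocks p. cscale (cnj (c i)) (x i)) + T (cconj z)"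
        using arg_cong[OF z(2), of cconj] unfolding e by (simp add: \<epsilon>(3) x0 T_cconj[OF z(1)])
      have x0': "x 0 = (\<Sum>i<nblocks p. cscale ((\<lambda>_. 1) i) (x i)) + T 0"
        by (simp add: \<epsilon>(3) clinear_0[OF clinear_T])
      have "LC (x 0) ((T ^^ (bsize p - 1)) (a, 0)) = c 0 * of_real \<epsilon>"
        by (subst x0', subst z(2), subst leading_form_mod_T[OF p fr full zero z(1)]) (simp add: \<epsilon>)
      moreover have "LC (x 0) ((T ^^ (bsize p - 1)) (a, 0)) = cnj (c 0) * of_real \<epsilon>"
        by (subst x0', subst z', subst leading_form_mod_T[OF p fr full zero cz]) (simp add: \<epsilon>)
      ultimately have real: "cnj (c 0) = c 0" using \<epsilon>(1) by simp
      have c0: "c 0 \<noteq> 0"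
      proof
        assume "c 0 = 0"
        then have "(a, 0) = T z" using z(2) by (simp add: \<epsilon>(3))
        then show False using a(2) z(1) unfolding nilp_part_image by blast
      qed
      have "LC (a, 0) ((nilp_part V L ^^ (n - 1)) (a, 0)) = LC (a, 0) ((T ^^ (bsize p - 1)) (a, 0))"
        using nilp_part_top[OF p fr full aH] \<epsilon>(4) by simp
      also have "\<dots> = c 0 * c 0 * of_real \<epsilon>"
        by (subst (1 2) z(2), subst leading_form_mod_T[OF p fr full z(1) z(1)]) (simp add: \<epsilon>)
      also have "c 0 * c 0 = of_real ((cmod (c 0))\<^sup>2)"
        using complex_norm_square[of "c 0"] real by simp
      finally show ?thesis using c0 unfolding pos_ray_def
        by (intro CollectI exI[of _ "(cmod (c 0))\<^sup>2"]) simp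
    qed
    have eig: "H = gen_eigenspace V L (of_real lam)"
      by (rule full_gen_eigenspace[OF p fr full]) (simp add: Seif1)
    have "\<exists>bs. jordan_blocks_on H (monodromy_cplx V L) bs \<and> length bs = 1" using blocks \<epsilon>(3) by auto
    moreover have "dim V = n" using full \<epsilon>(3,4) by simp
    ultimately show ?thesis unfolding Seif1 has_type.simps using sgn eig by blast
  next
    case (Seif2 lam n)
    have eig: "H = gen_eigenspace V L (of_real lam)"
      by (rule full_gen_eigenspace[OF p fr full]) (simp add: Seif2)
    have "\<exists>bs. jordan_blocks_on H (monodromy_cplx V L) bs \<and> length bs = 2 \<and> (\<forall>b\<in>set bs. fst b = n)"
      using blocks Seif2 by auto
    moreover have "dim V = 2 * n" using full Seif2 by simp
    ultimately show ?thesis unfolding Seif2 has_type.simps using eig by blast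
  next
    case (Seif3 lam n \<zeta>)
    have d: "bform p 0 = \<zeta>" "bform p 1 = cnj \<zeta>" "nblocks p = 2" "bsize p = n" "bdual p 0 = 1" "bdual p 1 = 0"
      "bev p 0 = lam" "bev p 1 = cnj lam"
      using Seif3 by auto
    have \<zeta>: "\<zeta> \<noteq> 0" using p Seif3 by auto
    have ll: "lam * lam \<noteq> 1"
      using block_orthogonal[OF p, of 0 0] p Seif3 by (auto simp: square_eq_1_iff)
    have sum2: "(\<Sum>i<2. f i) = f 0 + f (1::nat)" for f :: "nat \<Rightarrow> 'c::comm_monoid_add"
      by (simp add: numeral_2_eq_2)
    have sgn: "LC a ((nilp_part V L ^^ (n - 1)) (cconj a)) \<in> pos_ray \<zeta>"
      if a: "a \<in> gev lam" "a \<notin> nilp_part V L ` H" for a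
    proof -
      have aH: "a \<in> H" by (rule gev_in[OF a(1)])
      obtain c z where z: "z \<in> H" "a = (\<Sum>i<nblocks p. cscale (c i) (x i)) + T z"
        using frame_mod_T[OF p fr full aH] .
      have cz: "cconj z \<in> H" using z(1) by simp
      have x01: "cconj (x 0) = x 1" "cconj (x 1) = x 0"
        using frameD(3)[OF p fr, of 0] frameD(3)[OF p fr, of 1] Seif3 by simp_all
      have zero: "0 \<in> H" by (rule cplx.subspace_0[OF subspace_H])
      have z': "cconj a = (\<Sum>i<nblocks p. cscale (cnj (c (1 - i))) (x i)) + T (cconj z)"
        unfolding z(2) by (simp add: d(3) sum2 x01 x01[unfolded One_nat_def] T_cconj[OF z(1)] add.commute)
      have x0': "x 0 = (\<Sum>i<nblocks p. cscale ((\<lambda>i. if i = 0 then 1 else 0) i) (x i)) + T 0"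
        by (simp add: d(3) sum2 clinear_0[OF clinear_T])
      have "LC (x 0) ((T ^^ (bsize p - 1)) a) = c 1 * \<zeta>"
        by (subst x0', subst z(2), subst leading_form_mod_T[OF p fr full zero z(1)]) (simp add: d sum2 d[unfolded One_nat_def])
      moreover have "LC (x 0) ((T ^^ (bsize p - 1)) a) = 0"
        using gev_orthogonal[OF frame_gev[OF p fr, of 0] tw_pow_gev[OF a(1)]] T_pow_gev[OF a(1)] ll d by simp
      ultimately have c1: "c 1 = 0" using \<zeta> by simp
      have c0: "c 0 \<noteq> 0"
      proof
        assume "c 0 = 0"
        then have "a = T z" using z(2) c1 by (simp add: d(3) sum2)
        then show False using a(2) z(1) unfolding nilp_part_image by blast
      qed
      have cH: "cconj a \<in> H" using aH by simp
      have "LC a ((nilp_part V L ^^ (n - 1)) (cconj a)) = LC a ((T ^^ (bsize p - 1)) (cconj a))"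
        using nilp_part_top[OF p fr full cH] d(4) by simp
      also have "\<dots> = c 0 * cnj (c 0) * \<zeta>"
        by (subst z(2), subst z', subst leading_form_mod_T[OF p fr full z(1) cz]) (simp add: d sum2 c1 d[unfolded One_nat_def] c1[unfolded One_nat_def])
      also have "c 0 * cnj (c 0) = of_real ((cmod (c 0))\<^sup>2)" by (rule complex_norm_square[symmetric])
      finally show ?thesis using c0 unfolding pos_ray_def
        by (intro CollectI exI[of _ "(cmod (c 0))\<^sup>2"]) simp
    qed
    have "direct_sum_of H {lam, cnj lam} (gen_eigenspace V L)"
      by (rule ds) (use Seif3 in auto)
    moreover have "\<exists>bs. jordan_blocks_on H (monodromy_cplx V L) bs \<and> length bs = 2" using blocks d(3) by auto
    moreover have "dim V = 2 * n" using full d(3,4) by simp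
    ultimately show ?thesis unfolding Seif3 has_type.simps gen_eigenspace_eq using sgn by blast
  next
    case (Seif4 lam n)
    have "direct_sum_of H {of_real lam, inverse (of_real lam)} (gen_eigenspace V L)"
      by (rule ds) (use Seif4 in \<open>auto simp: inverse_eq_divide\<close>)
    then show ?thesis using Seif4 full blocks by simp
  next
    case (Seif5 lam n)
    have "direct_sum_of H {lam, inverse lam, cnj lam, inverse (cnj lam)} (gen_eigenspace V L)"
      by (rule ds) (use Seif5 in \<open>auto simp: inverse_eq_divide\<close>)
    then show ?thesis using Seif5 full blocks by simp
  qed
qed

end

context seif
begin

text \<open>A Jordan block of maximal size \<open>m\<close> yields a paired eigenvalue in the prescribed
  spectrum and hence a frame of order \<open>m\<close>. Comparing dimensions shows that \<open>m\<close>
  is the \<open>n\<close> of the type; for \<open>Seif3\<close>, where the sizes are not prescribed,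
  \<open>2 m \<le> dim V = 2 n\<close> by independence of the chains and \<open>2 n \<le> 2 m\<close> by
  maximality. The sign condition, applied to the first frame vector, identifies the sign of the
  frame.\<close>

lemma has_type_imp_frame:
  assumes p: "admissible p" and ht: "has_type V L p"
  shows "\<exists>x. frame V L M p x \<and> dim V = nblocks p * bsize p"
proof -
  have max: "\<exists>b\<in>set bs. \<forall>b'\<in>set bs. fst b' \<le> fst b" if "bs \<noteq> []" for bs :: "(nat \<times> complex) list"
  proof -
    have "Max (fst ` set bs) \<in> fst ` set bs" using that by (intro Max_in) auto
    then obtain b where b: "b \<in> set bs" "fst b = Max (fst ` set bs)" by auto
    have "\<forall>b'\<in>set bs. fst b' \<le> fst b" unfolding b(2) by simp
    then show ?thesis using b(1) by blast
  qed
  have size: "sum_list (map fst bs) = dim V" if jb: "jordan_blocks_on H (monodromy_cplx V L) bs" for bs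
  proof -
    obtain vs where "jordan_columns Mc bs vs" "length vs = dim V" using jordan_blocks_onE[OF jb] by metis
    then show ?thesis by (simp add: jordan_columns_def)
  qed
  have equal: "\<exists>\<mu>. paired n \<mu>" if jb: "jordan_blocks_on H (monodromy_cplx V L) bs" "bs \<noteq> []" "\<forall>b\<in>set bs. fst b = n" for bs n
  proof -
    have "hd bs \<in> set bs" using jb(2) by simp
    then show ?thesis using jordan_block_paired[OF jb(1), of "hd bs"] jb(3) by auto
  qed
  show ?thesis
  proof (cases p)
    case (Seif1 lam n \<epsilon>)
    have a: "n \<ge> 1" "\<epsilon> = 1 \<or> \<epsilon> = - 1" "lam = 1 \<and> odd n \<or> lam = - 1 \<and> even n" using p Seif1 by auto
    obtain bs where bs: "jordan_blocks_on H (monodromy_cplx V L) bs" "length bs = 1"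
      and dV: "dim V = n" and eig: "H = gev (of_real lam)"
      and sgn: "\<And>a. a \<in> V \<Longrightarrow> (a, 0) \<notin> nilp_part V L ` H \<Longrightarrow>
        LC (a, 0) ((nilp_part V L ^^ (n - 1)) (a, 0)) \<in> pos_ray (of_real \<epsilon>)"
      using ht unfolding Seif1 has_type.simps gen_eigenspace_eq by blast
    obtain b where b: "bs = [b]" using bs(2) by (cases bs) auto
    have "fst b = n" using size[OF bs(1)] dV b by simp
    then obtain \<mu> where \<mu>: "paired n \<mu>" using equal[OF bs(1)] b by auto
    obtain y where y: "y \<in> gev \<mu>" "y \<noteq> 0" using paired_ex[OF \<mu>] by blast
    have "y \<in> gev (of_real lam)" using gev_in[OF y(1)] eig by blast
    then have "\<mu> = of_real lam" using gev_disjoint[OF y(1) _ y(2)] by blast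
    then have pl: "paired n (of_real lam)" using \<mu> by simp
    have "lam * (- 1) ^ (n - 1) = 1" "lam = 1 \<or> lam = - 1" using a(1,3) by (cases n; auto)+
    then obtain \<epsilon>' x where x: "\<epsilon>' \<in> {1, - 1}" "frame V L M (Seif1 lam n \<epsilon>') x" using frame_Seif1[OF pl] by blast
    let ?p = "Seif1 lam n \<epsilon>'"
    have p': "admissible ?p" using a x(1) by auto
    have full: "dim V = nblocks ?p * bsize ?p" using dV by simp
    have "cconj (x 0) = x 0" using frameD(3)[OF p' x(2), of 0] by simp
    then have "snd (x 0) = - snd (x 0)" by (metis cconj_def snd_conv)
    then have "snd (x 0) + snd (x 0) = 0" by (metis add.left_inverse)
    then have s0: "snd (x 0) = 0" by (simp flip: scaleR_2)
    then have x0: "x 0 = (fst (x 0), 0)" by (simp add: prod_eq_iff)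
    have xH: "x 0 \<in> H" using frameD(1)[OF p' x(2), of 0] by simp
    then have "fst (x 0) \<in> V" by auto
    moreover have "x 0 \<notin> nilp_part V L ` H" by (rule frame_vector_not_in_image[OF p' x(2) full]) simp
    ultimately have "LC (x 0) ((nilp_part V L ^^ (n - 1)) (x 0)) \<in> pos_ray (of_real \<epsilon>)"
      using sgn[of "fst (x 0)"] x0 by simp
    moreover have "LC (x 0) ((nilp_part V L ^^ (n - 1)) (x 0)) = of_real \<epsilon>'"
      using nilp_part_top[OF p' x(2) full xH] frame_leading[OF p' x(2) full, of 0 0] by simp
    ultimately obtain r where "r > 0" "complex_of_real \<epsilon>' = of_real \<epsilon> * of_real r" unfolding pos_ray_def by auto
    then have r: "r > 0" "\<epsilon>' = \<epsilon> * r" by (simp_all flip: of_real_mult)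
    then have "\<epsilon>' = \<epsilon>" using a(2) x(1) by auto
    then show ?thesis using x(2) full Seif1 by auto
  next
    case (Seif2 lam n)
    have a: "n \<ge> 1" "lam = 1 \<and> even n \<or> lam = - 1 \<and> odd n" using p Seif2 by auto
    obtain bs where bs: "jordan_blocks_on H (monodromy_cplx V L) bs" "length bs = 2" "\<forall>b\<in>set bs. fst b = n"
      and dV: "dim V = 2 * n" and eig: "H = gev (of_real lam)"
      using ht unfolding Seif2 has_type.simps gen_eigenspace_eq by blast
    have "bs \<noteq> []" using bs(2) by auto
    then obtain \<mu> where \<mu>: "paired n \<mu>" using equal[OF bs(1) _ bs(3)] by blast
    obtain y where y: "y \<in> gev \<mu>" "y \<noteq> 0" using paired_ex[OF \<mu>] by blast
    have "y \<in> gev (of_real lam)" using gev_in[OF y(1)] eig by blast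
    then have "\<mu> = of_real lam" using gev_disjoint[OF y(1) _ y(2)] by blast
    then have pl: "paired n (of_real lam)" using \<mu> by simp
    have "lam = 1 \<or> lam = - 1" "lam * (- 1) ^ (n - 1) = - 1" using a by (cases n; auto)+
    then obtain x where "frame V L M (Seif2 lam n) x" using frame_Seif2_4(1)[OF pl] by blast
    then show ?thesis using dV Seif2 by auto
  next
    case (Seif3 lam n \<zeta>)
    have a: "n \<ge> 1" "cmod lam = 1" "lam \<notin> {1, - 1}" "cmod \<zeta> = 1" "\<zeta> \<notin> {1, - 1}"
      "\<zeta>\<^sup>2 = cnj lam * (- 1) ^ (n + 1)" using p Seif3 by auto
    obtain bs where bs: "jordan_blocks_on H (monodromy_cplx V L) bs" "length bs = 2"
      and dV: "dim V = 2 * n" and ds: "direct_sum_of H {lam, cnj lam} (gen_eigenspace V L)"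
      and sgn: "\<And>a. a \<in> gev lam - nilp_part V L ` H \<Longrightarrow>
        LC a ((nilp_part V L ^^ (n - 1)) (cconj a)) \<in> pos_ray \<zeta>"
      using ht unfolding Seif3 has_type.simps gen_eigenspace_eq by blast
    have "bs \<noteq> []" using bs(2) by auto
    then obtain b where b: "b \<in> set bs" "\<forall>b'\<in>set bs. fst b' \<le> fst b" using max by blast
    \<comment> \<open>the sizes are not prescribed; that of the larger block is \<open>m\<close>\<close>
    define m where "m = fst b"
    have "paired m (snd b)" unfolding m_def by (rule jordan_block_paired[OF bs(1) b(1)]) (use b(2) in blast)
    moreover from this have "snd b = lam \<or> snd b = cnj lam" using paired_in_spectrum[OF _ ds] by blast
    ultimately have pl: "paired m lam" using paired_cnj by (metis complex_cnj_cnj)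
    then have m1: "m \<ge> 1" by (simp add: paired_def)
    have nm: "n \<le> m"
    proof -
      obtain b1 b2 where b12: "bs = [b1, b2]" using bs(2) by (auto simp: numeral_2_eq_2 length_Suc_conv)
      then have "fst b1 + fst b2 = 2 * n" using size[OF bs(1)] dV by simp
      moreover have "fst b1 \<le> m" "fst b2 \<le> m" using b(2) b12 by (auto simp: m_def)
      ultimately show ?thesis by linarith
    qed
    have mn: "m \<le> n"
    proof -
      \<comment> \<open>any square root serves, since only the number of chain vectors matters here\<close>
      define \<zeta>0 where "\<zeta>0 = csqrt (cnj lam * (- 1) ^ (m + 1))"
      have z0: "\<zeta>0\<^sup>2 = cnj lam * (- 1) ^ (m + 1)" by (simp add: \<zeta>0_def)
      obtain \<zeta>' x where z: "\<zeta>' \<in> {\<zeta>0, - \<zeta>0}" "frame V L M (Seif3 lam m \<zeta>') x"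
        using frame_Seif3[OF pl a(2) z0] by blast
      have "admissible (Seif3 lam m \<zeta>')" by (rule admissible_Seif3[OF m1 a(2,3)]) (use z(1) z0 in auto)
      from frame_dim[OF this z(2)] show ?thesis using dV by simp
    qed
    have "m = n" using nm mn by simp
    then have pn: "paired n lam" using pl by simp
    obtain \<zeta>' x where z: "\<zeta>' \<in> {\<zeta>, - \<zeta>}" "frame V L M (Seif3 lam n \<zeta>') x"
      using frame_Seif3[OF pn a(2,6)] by blast
    let ?p = "Seif3 lam n \<zeta>'"
    have p': "admissible ?p" by (rule admissible_Seif3[OF a(1-3)]) (use z(1) a(6) in auto)
    have full: "dim V = nblocks ?p * bsize ?p" using dV by simp
    have xH: "x 0 \<in> H" "x 1 \<in> H" using frameD(1)[OF p' z(2), of 0] frameD(1)[OF p' z(2), of 1] by simp_all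
    have x1: "cconj (x 0) = x 1" using frameD(3)[OF p' z(2), of 0] by simp
    have "x 0 \<in> gev lam" using frame_gev[OF p' z(2), of 0] by simp
    moreover have "x 0 \<notin> nilp_part V L ` H" by (rule frame_vector_not_in_image[OF p' z(2) full]) simp
    ultimately have "LC (x 0) ((nilp_part V L ^^ (n - 1)) (cconj (x 0))) \<in> pos_ray \<zeta>" using sgn by blast
    moreover have "LC (x 0) ((nilp_part V L ^^ (n - 1)) (cconj (x 0))) = \<zeta>'"
      unfolding x1 using nilp_part_top[OF p' z(2) full xH(2)] frame_leading[OF p' z(2) full, of 0 1] by simp
    ultimately obtain r where r: "r > 0" "\<zeta>' = \<zeta> * of_real r" unfolding pos_ray_def by auto
    have "\<zeta>' = \<zeta>"
    proof (rule ccontr)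
      assume "\<zeta>' \<noteq> \<zeta>"
      then have "\<zeta> * of_real r = - \<zeta>" using z(1) r(2) by auto
      then have "\<zeta> * of_real (r + 1) = 0" by (simp add: algebra_simps)
      then show False using r(1) a(4) by (simp del: of_real_add)
    qed
    then show ?thesis using z(2) full Seif3 by auto
  next
    case (Seif4 lam n)
    have a: "n \<ge> 1" "lam > 1 \<or> lam < - 1" using p Seif4 by auto
    obtain bs where bs: "jordan_blocks_on H (monodromy_cplx V L) bs" "length bs = 2" "\<forall>b\<in>set bs. fst b = n"
      and dV: "dim V = 2 * n" and ds: "direct_sum_of H {of_real lam, inverse (of_real lam)} (gen_eigenspace V L)"
      using ht unfolding Seif4 has_type.simps by blast
    have "bs \<noteq> []" using bs(2) by auto
    then obtain \<mu> where \<mu>: "paired n \<mu>" using equal[OF bs(1) _ bs(3)] by blast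
    have "\<mu> = of_real lam \<or> \<mu> = 1 / of_real lam" using paired_in_spectrum[OF \<mu> ds] by (simp add: inverse_eq_divide)
    then have "paired n (of_real lam)" using \<mu> paired_inverse[OF \<mu>] by auto
    then obtain x where "frame V L M (Seif4 lam n) x" using frame_Seif2_4(2) by blast
    then show ?thesis using dV Seif4 by auto
  next
    case (Seif5 lam n)
    have a: "n \<ge> 1" "cmod lam > 1" using p Seif5 by auto
    obtain bs where bs: "jordan_blocks_on H (monodromy_cplx V L) bs" "length bs = 4" "\<forall>b\<in>set bs. fst b = n"
      and dV: "dim V = 4 * n" and ds: "direct_sum_of H {lam, inverse lam, cnj lam, inverse (cnj lam)} (gen_eigenspace V L)"
      using ht unfolding Seif5 has_type.simps by blast
    have "bs \<noteq> []" using bs(2) by auto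
    then obtain \<mu> where \<mu>: "paired n \<mu>" using equal[OF bs(1) _ bs(3)] by blast
    have "\<mu> = lam \<or> \<mu> = 1 / lam \<or> \<mu> = cnj lam \<or> \<mu> = 1 / cnj lam"
      using paired_in_spectrum[OF \<mu> ds] by (auto simp: inverse_eq_divide)
    then have "paired n lam"
      using \<mu> paired_inverse[OF \<mu>] paired_cnj[OF \<mu>] paired_cnj[OF paired_inverse[OF \<mu>]] by auto
    then obtain x where "frame V L M (Seif5 lam n) x" using frame_Seif5 by blast
    then show ?thesis using dV Seif5 by auto
  qed
qed

text \<open>Let \<open>n\<close> be the order of nilpotency of \<open>T\<close>. Nondegeneracy provides a
  vector that is paired nontrivially with some \<open>T ^ (n - 1) y\<close>, so there is a frame; its
  chains span an orthogonal summand.\<close>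

lemma irreducible_has_type:
  assumes irr: "irreducible_pair V L"
  shows "\<exists>p. admissible p \<and> has_type V L p"
proof -
  have V0: "V \<noteq> {0}" using irr by (simp add: irreducible_pair_def)
  define n where "n = (LEAST k. \<forall>u\<in>H. (T ^^ k) u = 0)"
  have n: "\<forall>u\<in>H. (T ^^ n) u = 0" unfolding n_def by (rule LeastI_ex[OF T_nilpotent])
  have n1: "n \<ge> 1"
  proof (rule ccontr)
    assume "\<not> n \<ge> 1"
    then have "n = 0" by simp
    then have *: "u = 0" if "u \<in> H" for u using bspec[OF n that] by simp
    have "v = 0" if "v \<in> V" for v using *[of "(v, 0)"] that subspace_0[OF subspace_V] by (simp add: zero_prod_def)
    then show False using V0 subspace_0[OF subspace_V] by blast
  qed
  then have "n - 1 < n" by simp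
  then have "\<not> (\<forall>u\<in>H. (T ^^ (n - 1)) u = 0)" unfolding n_def by (rule not_less_Least)
  then obtain u where u: "u \<in> H" "(T ^^ (n - 1)) u \<noteq> 0" by blast
  have "\<exists>\<mu>. \<mu> \<noteq> 0 \<and> (\<exists>y\<in>gev \<mu>. (T ^^ (n - 1)) y \<noteq> 0)"
  proof (rule ccontr)
    assume *: "\<not> ?thesis"
    have "(T ^^ (n - 1)) u = 0"
      using u(1)
    proof (rule H_induct)
      show "cplx.subspace {u. (T ^^ (n - 1)) u = 0}"
        by (rule cplx.subspaceI)
          (simp_all add: clinear_0[OF clinear_T_pow] clinear_add[OF clinear_T_pow] clinear_scale[OF clinear_T_pow])
    qed (use * in blast)
    then show False using u(2) by blast
  qed
  then obtain \<mu> y where y: "\<mu> \<noteq> 0" "y \<in> gev \<mu>" "(T ^^ (n - 1)) y \<noteq> 0" by blast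
  let ?t = "(T ^^ (n - 1)) y"
  have tH: "?t \<in> H" by (rule T_pow_in[OF gev_in[OF y(2)]])
  have "\<exists>\<nu>. \<nu> \<noteq> 0 \<and> (\<exists>z\<in>gev \<nu>. LC z ?t \<noteq> 0)"
  proof (rule ccontr)
    assume *: "\<not> ?thesis"
    have "?t = 0"
    proof (rule LC_nondeg(2)[OF tH])
      fix w assume "w \<in> H"
      then show "LC w ?t = 0"
      proof (rule H_induct)
        show "cplx.subspace {w. LC w ?t = 0}" by (rule cplx.subspaceI) (simp_all add: LC_simps)
      qed (use * in blast)
    qed
    then show False using y(3) by blast
  qed
  then obtain \<nu> z where z: "\<nu> \<noteq> 0" "z \<in> gev \<nu>" "LC z ?t \<noteq> 0" by blast
  note ty = T_pow_gev[OF y(2)]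
  have "\<nu> * \<mu> = 1"
    using gev_orthogonal[OF z(2) tw_pow_gev[OF y(2), of "n - 1"]] z(3) ty by fastforce
  then have \<nu>: "\<nu> = 1 / \<mu>" using y(1) by (simp add: divide_simps)
  have "paired n \<nu>"
  proof (rule pairedI[OF z(1) n1 gev_in[OF z(2)] gev_in[OF y(2)]])
    show "(tw M \<nu> ^^ n) z = 0" using n gev_in[OF z(2)] T_pow_gev[OF z(2)] by metis
    have i: "1 / \<nu> = \<mu>" using \<nu> y(1) by simp
    show "(tw M (1 / \<nu>) ^^ n) y = 0" unfolding i using n gev_in[OF y(2)] ty by metis
    show "LC z ((tw M (1 / \<nu>) ^^ (n - 1)) y) \<noteq> 0" unfolding i using z(3) ty by metis
  qed
  then obtain p x where p: "admissible p" and fr: "frame V L M p x" using paired_imp_frame by blast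
  obtain Y where Y: "subspace Y" "Y \<subseteq> V" "\<And>y. y \<in> Y \<Longrightarrow> M y \<in> Y" "Y \<noteq> {0}"
    "\<And>b. b \<in> Y \<Longrightarrow> (\<And>a. a \<in> Y \<Longrightarrow> L a b = 0) \<Longrightarrow> b = 0" "dim Y = nblocks p * bsize p"
    using frame_subpair[OF p fr] by metis
  have "Y = V" by (rule irreducible_subspace[OF Y(1-5) irr])
  then show ?thesis using frame_imp_has_type[OF p fr] Y(6) p by blast
qed

text \<open>All notions depend on the values of the form on \<open>V\<close> only.\<close>

lemma has_type_cong:
  assumes eq: "\<And>a b. a \<in> V \<Longrightarrow> b \<in> V \<Longrightarrow> L a b = L0 a b"
  shows "has_type V L0 p \<longleftrightarrow> has_type V L p"
proof -
  have "monodromy V L0 = monodromy V L"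
    unfolding monodromy_def
  proof (rule arg_cong[where f = The], rule ext)
    fix F
    have "F a \<in> V" if "lin_iso V V F" "a \<in> V" for a using that unfolding lin_iso_def bij_betw_def by blast
    then show "(F \<in> extensional V \<and> lin_iso V V F \<and> (\<forall>a\<in>V. \<forall>b\<in>V. L0 (F a) b = L0 b a)) =
        (F \<in> extensional V \<and> lin_iso V V F \<and> (\<forall>a\<in>V. \<forall>b\<in>V. L (F a) b = L b a))"
      using eq by metis
  qed
  then have mc: "monodromy_cplx V L0 = monodromy_cplx V L" by (simp add: monodromy_cplx_def)
  have u: "unip_part V L0 = unip_part V L" and s: "ss_part V L0 = ss_part V L"
    by (simp_all add: unip_part_def ss_part_def mc)
  have N: "nilp_part V L0 = nilp_part V L" by (rule ext) (simp add: nilp_part_def u)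
  have G: "gen_eigenspace V L0 = gen_eigenspace V L" by (rule ext) (simp add: gen_eigenspace_def s)
  have form: "form_cplx L0 x y = LC x y" if "x \<in> H" "y \<in> H" for x y
    using that eq by (auto simp: form_cplx_def)
  have NH: "nilp_part V L x \<in> H" if "x \<in> H" for x
  proof -
    have "nilp_part V L x \<in> T ` H" using imageI[OF that, of "nilp_part V L"] unfolding nilp_part_image .
    then show ?thesis by (rule imageE) (simp only: T_in)
  qed
  have NkH: "(nilp_part V L ^^ k) x \<in> H" if "x \<in> H" for x k by (rule funpow_in[OF NH that])
  have r: "(a, 0) \<in> H" if "a \<in> V" for a using that subspace_0[OF subspace_V] by simp
  have f1: "form_cplx L0 (a, 0) ((nilp_part V L ^^ k) (a, 0)) = LC (a, 0) ((nilp_part V L ^^ k) (a, 0))" if "a \<in> V" for a k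
    by (rule form[OF r[OF that] NkH[OF r[OF that]]])
  have f3: "form_cplx L0 a ((nilp_part V L ^^ k) (cconj a)) = LC a ((nilp_part V L ^^ k) (cconj a))"
    if "a \<in> gen_eigenspace V L \<mu> - B" for a k \<mu> B
  proof -
    have "a \<in> H" using that gev_in unfolding gen_eigenspace_eq by blast
    then show ?thesis by (intro form NkH) simp_all
  qed
  show ?thesis
  proof (cases p)
    case (Seif1 lam n \<epsilon>)
    then show ?thesis unfolding Seif1 has_type.simps mc N G using f1 by simp
  next
    case (Seif3 lam n \<zeta>)
    show ?thesis unfolding Seif3 has_type.simps mc N G by (simp only: f3 cong: ball_cong)
  qed (simp_all add: mc G)
qed

end

lemma irreducible_pair_cong:
  assumes "seif V L M" and eq: "\<And>a b. a \<in> V \<Longrightarrow> b \<in> V \<Longrightarrow> L a b = L0 a b"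
  shows "irreducible_pair V L0 \<longleftrightarrow> irreducible_pair V L"
proof -
  interpret seif V L M by fact
  have sub: "V1 \<subseteq> V \<and> V2 \<subseteq> V"
    if "subspace V1" "subspace V2" "V = {x + y | x y. x \<in> V1 \<and> y \<in> V2}" for V1 V2
  proof
    show "V1 \<subseteq> V" unfolding that(3) using subspace_0[OF that(2)] by force
    show "V2 \<subseteq> V" unfolding that(3) using subspace_0[OF that(1)] by force
  qed
  have "(subspace V1 \<and> subspace V2 \<and> V1 \<noteq> {0} \<and> V2 \<noteq> {0} \<and>
      V = {x + y | x y. x \<in> V1 \<and> y \<in> V2} \<and> V1 \<inter> V2 = {0} \<and> (\<forall>x\<in>V1. \<forall>y\<in>V2. L0 x y = 0 \<and> L0 y x = 0)) \<longleftrightarrow>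
    (subspace V1 \<and> subspace V2 \<and> V1 \<noteq> {0} \<and> V2 \<noteq> {0} \<and>
      V = {x + y | x y. x \<in> V1 \<and> y \<in> V2} \<and> V1 \<inter> V2 = {0} \<and> (\<forall>x\<in>V1. \<forall>y\<in>V2. L x y = 0 \<and> L y x = 0))"
    (is "?A \<longleftrightarrow> ?B") for V1 V2
  proof (cases "subspace V1 \<and> subspace V2 \<and> V = {x + y | x y. x \<in> V1 \<and> y \<in> V2}")
    case True
    then have s: "V1 \<subseteq> V" "V2 \<subseteq> V" using sub[of V1 V2] by simp_all
    have "(\<forall>x\<in>V1. \<forall>y\<in>V2. L0 x y = 0 \<and> L0 y x = 0) \<longleftrightarrow> (\<forall>x\<in>V1. \<forall>y\<in>V2. L x y = 0 \<and> L y x = 0)"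
      by (intro ball_cong refl)
        (simp add: eq[OF subsetD[OF s(1)] subsetD[OF s(2)]] eq[OF subsetD[OF s(2)] subsetD[OF s(1)]])
    then show ?thesis by (simp only:)
  next
    case False
    then show ?thesis by blast
  qed
  then show ?thesis unfolding irreducible_pair_def by (simp only:)
qed

section \<open>Existence\<close>

lemma lookup_scaleR_poly: "Poly_Mapping.lookup (c *\<^sub>R x) i = c *\<^sub>R Poly_Mapping.lookup x i"
  for x :: "'a \<Rightarrow>\<^sub>0 'b::real_vector"
proof -
  have "finite {i. c *\<^sub>R Poly_Mapping.lookup x i \<noteq> 0}"
    by (rule finite_subset[OF _ finite_lookup[of x]]) auto
  then show ?thesis by (simp add: scaleR_poly_mapping_def)
qed

definition model_A :: "nat \<Rightarrow> (nat \<Rightarrow>\<^sub>0 real) \<Rightarrow> complex" where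
  "model_A k x = Complex (Poly_Mapping.lookup x (4 * k)) (Poly_Mapping.lookup x (4 * k + 1))"

definition model_B :: "nat \<Rightarrow> (nat \<Rightarrow>\<^sub>0 real) \<Rightarrow> complex" where
  "model_B k x = Complex (Poly_Mapping.lookup x (4 * k + 2)) (Poly_Mapping.lookup x (4 * k + 3))"

definition model_space :: "nat \<Rightarrow> (nat \<Rightarrow>\<^sub>0 real) set" where
  "model_space n = {x. \<forall>i\<ge>4 * n. Poly_Mapping.lookup x i = 0}"

text \<open>The hyperbolic pair of the operator \<open>S = lam (1 + shift)\<close> on
  \<open>n\<close>-tuples of complex numbers: the coordinates \<open>A\<close> describe a tuple, the
  coordinates \<open>B\<close> a functional, and the form is the real part of \<open>B x (S (A y)) + B y
  (A x)\<close>. Its monodromy is \<open>S\<close> on tuples and the inverse transpose of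
  \<open>S\<close> on functionals.\<close>

definition model_form :: "nat \<Rightarrow> complex \<Rightarrow> (nat \<Rightarrow>\<^sub>0 real) \<Rightarrow> (nat \<Rightarrow>\<^sub>0 real) \<Rightarrow> real" where
  "model_form n lam x y =
     Re (\<Sum>k<n. lam * (model_B k x + model_B (Suc k) x) * model_A k y + model_B k y * model_A k x)"

abbreviation unit_vec :: "nat \<Rightarrow> nat \<Rightarrow>\<^sub>0 real" where
  "unit_vec i \<equiv> Poly_Mapping.single i 1"

lemma model_linear:
  "model_A k (x + y) = model_A k x + model_A k y" "model_A k (c *\<^sub>R x) = of_real c * model_A k x"
  "model_B k (x + y) = model_B k x + model_B k y" "model_B k (c *\<^sub>R x) = of_real c * model_B k x"
  by (simp_all add: model_A_def model_B_def lookup_add lookup_scaleR_poly complex_eq_iff)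

lemma model_coords_unit:
  "model_A k (unit_vec (4 * j)) = (if k = j then 1 else 0)" "model_A k (unit_vec (4 * j + 1)) = (if k = j then \<i> else 0)"
  "model_A k (unit_vec (4 * j + 2)) = 0" "model_A k (unit_vec (4 * j + 3)) = 0"
  "model_B k (unit_vec (4 * j)) = 0" "model_B k (unit_vec (4 * j + 1)) = 0"
  "model_B k (unit_vec (4 * j + 2)) = (if k = j then 1 else 0)" "model_B k (unit_vec (4 * j + 3)) = (if k = j then \<i> else 0)"
proof -
  have lk: "Poly_Mapping.lookup (unit_vec i) l = (if i = l then 1 else 0)" for i l
    by (simp add: lookup_single when_def)
  show "model_A k (unit_vec (4 * j)) = (if k = j then 1 else 0)" "model_A k (unit_vec (4 * j + 1)) = (if k = j then \<i> else 0)"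
    "model_A k (unit_vec (4 * j + 2)) = 0" "model_A k (unit_vec (4 * j + 3)) = 0"
    "model_B k (unit_vec (4 * j)) = 0" "model_B k (unit_vec (4 * j + 1)) = 0"
    "model_B k (unit_vec (4 * j + 2)) = (if k = j then 1 else 0)" "model_B k (unit_vec (4 * j + 3)) = (if k = j then \<i> else 0)"
    unfolding model_A_def model_B_def lk by (auto simp: complex_eq_iff; presburger)+
qed

lemma bilinear_model_form: "bilinear_form (model_form n lam)"
  unfolding bilinear_form_def
proof (intro conjI allI linearI)
  let ?S = "\<lambda>x y. \<Sum>k<n. lam * (model_B k x + model_B (Suc k) x) * model_A k y + model_B k y * model_A k x"
  have add: "?S (x + y) z = ?S x z + ?S y z" "?S z (x + y) = ?S z x + ?S z y" for x y z
    by (simp_all add: model_linear algebra_simps sum.distrib)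
  have scale: "?S (c *\<^sub>R x) y = of_real c * ?S x y" "?S x (c *\<^sub>R y) = of_real c * ?S x y" for c x y
    by (simp_all add: model_linear algebra_simps sum_distrib_left)
  show "model_form n lam z (x + y) = model_form n lam z x + model_form n lam z y"
    "model_form n lam (x + y) z = model_form n lam x z + model_form n lam y z"
    "model_form n lam x (c *\<^sub>R y) = c *\<^sub>R model_form n lam x y"
    "model_form n lam (c *\<^sub>R x) y = c *\<^sub>R model_form n lam x y" for x y z c
    unfolding model_form_def add scale by simp_all
qed

lemma fin_dim_model_space: "fin_dim_space (model_space n)"
  unfolding fin_dim_space_def
proof
  show sub: "subspace (model_space n)"
    by (rule subspaceI) (simp_all add: model_space_def lookup_add lookup_scaleR_poly)
  have "span (unit_vec ` {..<4 * n}) = model_space n"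
  proof (intro subset_antisym span_minimal[OF _ sub])
    show "unit_vec ` {..<4 * n} \<subseteq> model_space n" by (auto simp: model_space_def lookup_single when_def)
    show "model_space n \<subseteq> span (unit_vec ` {..<4 * n})"
    proof
      fix x assume x: "x \<in> model_space n"
      have "x = (\<Sum>i<4 * n. Poly_Mapping.lookup x i *\<^sub>R unit_vec i)"
      proof (rule poly_mapping_eqI)
        fix l
        have "Poly_Mapping.lookup (\<Sum>i<4 * n. Poly_Mapping.lookup x i *\<^sub>R unit_vec i) l
            = (\<Sum>i<4 * n. if i = l then Poly_Mapping.lookup x i else 0)"
          unfolding lookup_sum by (rule sum.cong) (simp_all add: lookup_scaleR_poly lookup_single when_def)
        also have "\<dots> = Poly_Mapping.lookup x l" using x by (simp add: model_space_def)
        finally show "Poly_Mapping.lookup x l = Poly_Mapping.lookup (\<Sum>i<4 * n. Poly_Mapping.lookup x i *\<^sub>R unit_vec i) l"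
          by simp
      qed
      also have "\<dots> \<in> span (unit_vec ` {..<4 * n})" by (intro span_sum span_scale span_base imageI)
      finally show "x \<in> span (unit_vec ` {..<4 * n})" .
    qed
  qed
  then show "\<exists>B. finite B \<and> span B = model_space n" by blast
qed

lemma model_eq_0:
  assumes "x \<in> model_space n" "\<And>k. k < n \<Longrightarrow> model_A k x = 0" "\<And>k. k < n \<Longrightarrow> model_B k x = 0"
  shows "x = 0"
proof (rule poly_mapping_eqI)
  fix l
  show "Poly_Mapping.lookup x l = Poly_Mapping.lookup 0 l"
  proof (cases "l < 4 * n")
    case True
    define k where "k = l div 4"
    have k: "k < n" using True by (simp add: k_def less_mult_imp_div_less mult.commute)
    have "l = 4 * k \<or> l = 4 * k + 1 \<or> l = 4 * k + 2 \<or> l = 4 * k + 3" unfolding k_def by presburger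
    then show ?thesis using assms(2)[OF k] assms(3)[OF k] by (auto simp: model_A_def model_B_def complex_eq_iff)
  qed (use assms(1) in \<open>simp add: model_space_def\<close>)
qed

lemma unit_vec_in: "k < n \<Longrightarrow> r < 4 \<Longrightarrow> unit_vec (4 * k + r) \<in> model_space n"
  by (auto simp: model_space_def lookup_single when_def)

lemma model_B_beyond: "x \<in> model_space n \<Longrightarrow> model_B n x = 0"
  by (simp add: model_space_def model_B_def complex_eq_iff)

lemma model_form_right:
  assumes "k < n"
  shows "model_form n lam x (unit_vec (4 * k)) = Re (lam * (model_B k x + model_B (Suc k) x))"
    "model_form n lam x (unit_vec (4 * k + 1)) = Re (\<i> * (lam * (model_B k x + model_B (Suc k) x)))"
    "model_form n lam x (unit_vec (4 * k + 2)) = Re (model_A k x)"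
    "model_form n lam x (unit_vec (4 * k + 3)) = Re (\<i> * model_A k x)"
proof -
  have d: "(\<Sum>j<n. f j * (if j = k then c else 0)) = c * f k" "(\<Sum>j<n. (if j = k then c else 0) * f j) = c * f k"
    for f and c :: complex
  proof -
    have "(\<Sum>j<n. f j * (if j = k then c else 0)) = (\<Sum>j<n. if j = k then c * f k else 0)"
      by (rule sum.cong) simp_all
    then show d1: "(\<Sum>j<n. f j * (if j = k then c else 0)) = c * f k" using assms by simp
    show "(\<Sum>j<n. (if j = k then c else 0) * f j) = c * f k"
      unfolding d1[symmetric] by (rule sum.cong) simp_all
  qed
  show "model_form n lam x (unit_vec (4 * k)) = Re (lam * (model_B k x + model_B (Suc k) x))"
    "model_form n lam x (unit_vec (4 * k + 1)) = Re (\<i> * (lam * (model_B k x + model_B (Suc k) x)))"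
    "model_form n lam x (unit_vec (4 * k + 2)) = Re (model_A k x)"
    "model_form n lam x (unit_vec (4 * k + 3)) = Re (\<i> * model_A k x)"
    unfolding model_form_def model_coords_unit sum.distrib d by simp_all
qed

lemma model_form_left:
  assumes "k < n"
  shows "model_form n lam (unit_vec (4 * k)) y = Re (model_B k y)"
    "model_form n lam (unit_vec (4 * k + 1)) y = Re (\<i> * model_B k y)"
    "model_form n lam (unit_vec (4 * k + 2)) y = Re (lam * (model_A k y + (if k = 0 then 0 else model_A (k - 1) y)))"
    "model_form n lam (unit_vec (4 * k + 3)) y = Re (\<i> * (lam * (model_A k y + (if k = 0 then 0 else model_A (k - 1) y))))"
proof -
  have d: "(\<Sum>j<n. f j * (if j = k then c else 0)) = c * f k" for f and c :: complex
  proof -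
    have "(\<Sum>j<n. f j * (if j = k then c else 0)) = (\<Sum>j<n. if j = k then c * f k else 0)"
      by (rule sum.cong) simp_all
    then show ?thesis using assms by simp
  qed
  have s: "(\<Sum>j<n. lam * ((if j = k then c else 0) + (if Suc j = k then c else 0)) * f j)
      = c * (lam * (f k + (if k = 0 then 0 else f (k - 1))))" for c f
  proof -
    have "(\<Sum>j<n. lam * ((if j = k then c else 0) + (if Suc j = k then c else 0)) * f j)
        = (\<Sum>j<n. (if j = k then c * lam * f j else 0) + (if Suc j = k then c * lam * f j else 0))"
      by (rule sum.cong) (simp_all add: algebra_simps)
    also have "\<dots> = c * lam * f k + (\<Sum>j<n. if Suc j = k then c * lam * f j else 0)"
      using assms by (simp add: sum.distrib)
    also have "(\<Sum>j<n. if Suc j = k then c * lam * f j else 0) = (if k = 0 then 0 else c * lam * f (k - 1))"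
    proof (cases k)
      case (Suc k')
      then show ?thesis using assms by simp
    qed simp
    finally show ?thesis by (simp add: algebra_simps)
  qed
  show "model_form n lam (unit_vec (4 * k)) y = Re (model_B k y)"
    "model_form n lam (unit_vec (4 * k + 1)) y = Re (\<i> * model_B k y)"
    unfolding model_form_def model_coords_unit sum.distrib d by simp_all
  show "model_form n lam (unit_vec (4 * k + 2)) y = Re (lam * (model_A k y + (if k = 0 then 0 else model_A (k - 1) y)))"
    "model_form n lam (unit_vec (4 * k + 3)) y = Re (\<i> * (lam * (model_A k y + (if k = 0 then 0 else model_A (k - 1) y))))"
    unfolding model_form_def model_coords_unit sum.distrib s by simp_all
qed

lemma complex_pair: "Complex (Re a + Re (\<i> * b)) (Re b - Re (\<i> * a)) = a + \<i> * b"
  by (simp add: complex_eq_iff)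

lemma Re_zero_both: "Re z = 0 \<Longrightarrow> Re (\<i> * z) = 0 \<Longrightarrow> z = 0"
  by (simp add: complex_eq_iff)

lemma model_pair:
  assumes lam: "lam \<noteq> 0"
  shows "\<exists>M. seif (model_space n) (model_form n lam) M"
proof (rule seif_of_form[OF fin_dim_model_space bilinear_model_form])
  let ?W = "model_space n" and ?Q = "model_form n lam"
  fix x assume x: "x \<in> ?W" "\<And>b. b \<in> ?W \<Longrightarrow> ?Q x b = 0"
  have A: "model_A k x = 0" if k: "k < n" for k
    using x(2)[OF unit_vec_in[OF k, of 2]] x(2)[OF unit_vec_in[OF k, of 3]] model_form_right(3,4)[OF k, of lam x]
    by (intro Re_zero_both) simp_all
  \<comment> \<open>\<open>S\<close> is invertible: solve downwards from \<open>model_B n x = 0\<close>\<close>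
  have BB: "model_B k x + model_B (Suc k) x = 0" if k: "k < n" for k
  proof -
    have "lam * (model_B k x + model_B (Suc k) x) = 0"
      using x(2)[OF unit_vec_in[OF k, of 0]] x(2)[OF unit_vec_in[OF k, of 1]] model_form_right(1,2)[OF k, of lam x]
      by (intro Re_zero_both) simp_all
    then show ?thesis using lam by simp
  qed
  have B: "model_B k x = 0" if "k \<le> n" for k
    using that by (induction k rule: inc_induct) (use BB model_B_beyond[OF x(1)] in \<open>auto simp: add_eq_0_iff2\<close>)
  show "x = 0" by (rule model_eq_0[OF x(1) A B]) simp_all
next
  let ?W = "model_space n" and ?Q = "model_form n lam"
  fix y assume y: "y \<in> ?W" "\<And>a. a \<in> ?W \<Longrightarrow> ?Q a y = 0"
  have B: "model_B k y = 0" if k: "k < n" for k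
    using y(2)[OF unit_vec_in[OF k, of 0]] y(2)[OF unit_vec_in[OF k, of 1]] model_form_left(1,2)[OF k, of lam y]
    by (intro Re_zero_both) simp_all
  have AA: "model_A k y + (if k = 0 then 0 else model_A (k - 1) y) = 0" if k: "k < n" for k
  proof -
    have "lam * (model_A k y + (if k = 0 then 0 else model_A (k - 1) y)) = 0"
      using y(2)[OF unit_vec_in[OF k, of 2]] y(2)[OF unit_vec_in[OF k, of 3]] model_form_left(3,4)[OF k, of lam y]
      by (intro Re_zero_both) simp_all
    then show ?thesis using lam by simp
  qed
  have A: "model_A k y = 0" if "k < n" for k
    using that
  proof (induction k)
    case 0
    then show ?case using AA[of 0] by simp
  next
    case (Suc k)
    then show ?case using AA[of "Suc k"] by simp
  qed
  show "y = 0" by (rule model_eq_0[OF y(1) A B]) simp_all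
qed

text \<open>The complexified tuple \<open>e k\<close> is the \<open>k\<close>-th unit vector in the
  \<open>\<i>\<close>-eigenspace of the complex structure, so \<open>M (e k) = lam (e k + e (k +
  1))\<close>; the dual vectors \<open>d k\<close> satisfy \<open>lam M (d k + d (k - 1)) = d k\<close>.
  Hence \<open>tw M lam\<close> shifts the \<open>e k\<close> upwards, the operator for \<open>1 /
  lam\<close> shifts the \<open>d k\<close> downwards up to units, and \<open>L (e 0) (d 0) =
  2\<close>.\<close>

lemma model_paired:
  assumes n: "n \<ge> 1" and lam: "lam \<noteq> 0" and "seif (model_space n) (model_form n lam) M"
  shows "seif.paired (model_space n) (model_form n lam) M n lam"
proof -
  let ?W = "model_space n" and ?Q = "model_form n lam"
  interpret seif ?W ?Q M by fact
  let ?A = "\<lambda>k b. model_A k (fst b) + \<i> * model_A k (snd b)"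
  let ?B = "\<lambda>k b. model_B k (fst b) + \<i> * model_B k (snd b)"
  define e where "e k = (if k < n then (unit_vec (4 * k), - unit_vec (4 * k + 1)) else 0)" for k
  define d where "d k = (unit_vec (4 * k + 2), - unit_vec (4 * k + 3))" for k
  have u: "unit_vec (4 * k) \<in> ?W" "unit_vec (4 * k + 1) \<in> ?W" "unit_vec (4 * k + 2) \<in> ?W" "unit_vec (4 * k + 3) \<in> ?W"
    if "k < n" for k using unit_vec_in[OF that, of 0] unit_vec_in[OF that, of 1] unit_vec_in[OF that, of 2] unit_vec_in[OF that, of 3]
    by simp_all
  have eH: "e k \<in> H" for k
    using u[of k] subspace_neg[OF subspace_V] subspace_0[OF subspace_V] by (auto simp: e_def zero_prod_def)
  have dH: "d k \<in> H" if "k < n" for k using u[OF that] subspace_neg[OF subspace_V] by (auto simp: d_def)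
  have e_left: "LC (e k) b = ?B k b" if b: "b \<in> H" and k: "k \<le> n" for k b
  proof (cases "k < n")
    case True
    then show ?thesis
      by (simp add: e_def form_cplx_def L_simps model_form_left[OF True] complex_eq_iff del: One_nat_def)
  next
    case False
    then have "k = n" using k by simp
    moreover have "fst b \<in> ?W" "snd b \<in> ?W" using b by auto
    ultimately show ?thesis using model_B_beyond by (simp add: e_def LC_simps)
  qed
  have e_right: "LC b (e k) = lam * (?B k b + ?B (Suc k) b)" if k: "k < n" for k b
  proof -
    let ?a = "lam * (model_B k (fst b) + model_B (Suc k) (fst b))" and ?b = "lam * (model_B k (snd b) + model_B (Suc k) (snd b))"
    have "LC b (e k) = Complex (Re ?a + Re (\<i> * ?b)) (Re ?b - Re (\<i> * ?a))"
      unfolding form_cplx_def using k by (simp only: e_def if_True fst_conv snd_conv L_simps model_form_right[OF k]) (simp add: complex_eq_iff)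
    also have "\<dots> = ?a + \<i> * ?b" by (rule complex_pair)
    finally show ?thesis by (simp add: algebra_simps)
  qed
  have d_left: "LC (d k) b = lam * (?A k b + (if k = 0 then 0 else ?A (k - 1) b))" if k: "k < n" for k b
  proof -
    let ?f = "\<lambda>y. lam * (model_A k y + (if k = 0 then 0 else model_A (k - 1) y))"
    have "LC (d k) b = Complex (Re (?f (fst b)) + Re (\<i> * ?f (snd b))) (Re (?f (snd b)) - Re (\<i> * ?f (fst b)))"
      unfolding form_cplx_def by (simp only: d_def fst_conv snd_conv L_simps model_form_left[OF k]) (simp add: complex_eq_iff)
    also have "\<dots> = ?f (fst b) + \<i> * ?f (snd b)" by (rule complex_pair)
    finally show ?thesis by (simp add: algebra_simps)
  qed
  have d_right: "LC b (d k) = ?A k b" if k: "k < n" for k b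
  proof -
    have "LC b (d k) = Complex (Re (model_A k (fst b)) + Re (\<i> * model_A k (snd b)))
        (Re (model_A k (snd b)) - Re (\<i> * model_A k (fst b)))"
      unfolding form_cplx_def by (simp only: d_def fst_conv snd_conv L_simps model_form_right[OF k]) (simp add: complex_eq_iff)
    then show ?thesis unfolding complex_pair .
  qed
  have eqI: "x = y" if "x \<in> H" "y \<in> H" "\<And>b. b \<in> H \<Longrightarrow> LC x b = LC y b" for x y
  proof -
    have "x - y = 0"
      by (rule LC_nondeg(1)) (use that cplx.subspace_diff[OF subspace_H] in \<open>simp_all add: LC_simps del: mem_Sigma_iff\<close>)
    then show ?thesis by simp
  qed
  have Me: "Mc (e k) = cscale lam (e k + e (Suc k))" if k: "k < n" for k
  proof (rule eqI)
    show "Mc (e k) \<in> H" by (rule Mc_in[OF eH])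
    show "cscale lam (e k + e (Suc k)) \<in> H"
      by (intro cplx.subspace_scale[OF subspace_H] cplx.subspace_add[OF subspace_H] eH)
    fix b assume b: "b \<in> H"
    show "LC (Mc (e k)) b = LC (cscale lam (e k + e (Suc k))) b"
      using Mc_form[OF eH b] e_right[OF k] e_left[OF b, of k] e_left[OF b, of "Suc k"] k by (simp add: LC_simps)
  qed
  have twe: "tw M lam (e k) = e (Suc k)" if "k < n" for k
    unfolding tw_def Me[OF that] using lam by simp
  have e_pow: "(tw M lam ^^ k) (e 0) = e k" if "k \<le> n" for k
    using that by (induction k) (simp_all add: twe)
  have Md: "cscale lam (Mc (d k + (if k = 0 then 0 else d (k - 1)))) = d k" if k: "k < n" for k
  proof (rule eqI)
    let ?s = "d k + (if k = 0 then 0 else d (k - 1))"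
    have s: "?s \<in> H" using dH[OF k] dH[of "k - 1"] k cplx.subspace_add[OF subspace_H] by auto
    show "cscale lam (Mc ?s) \<in> H" by (rule cplx.subspace_scale[OF subspace_H Mc_in[OF s]])
    show "d k \<in> H" by (rule dH[OF k])
    fix b assume b: "b \<in> H"
    have "LC (cscale lam (Mc ?s)) b = lam * LC b ?s" using Mc_form[OF s b] by (simp add: LC_simps)
    also have "\<dots> = LC (d k) b" using k d_right[OF k] d_right[of "k - 1"] by (simp add: d_left[OF k] LC_simps)
    finally show "LC (cscale lam (Mc ?s)) b = LC (d k) b" .
  qed
  let ?t = "tw M (1 / lam)"
  have t: "?t y = cscale lam (Mc y) - y" for y by (simp add: tw_def)
  have t0: "?t (d 0) = 0" using Md[of 0] n by (simp add: t)
  have d0: "cscale lam (Mc (d 0)) = d 0" using Md[of 0] n by simp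
  have tS: "?t (d (Suc k)) = - cscale lam (Mc (d k))" if "Suc k < n" for k
    using Md[OF that] unfolding t by (simp add: clinear_add[OF clinear_Mc] cplx.scale_right_distrib algebra_simps eq_diff_eq del: map_prod_simp)
  have d_pow: "(?t ^^ k) (d k) = cscale ((- 1) ^ k) (d 0)" if "k < n" for k
    using that
  proof (induction k)
    case 0
    show ?case by simp
  next
    case (Suc k)
    have "(?t ^^ Suc k) (d (Suc k)) = (?t ^^ k) (- cscale lam (Mc (d k)))"
      using tS[OF Suc.prems] by (simp add: funpow_swap1)
    also have "\<dots> = - cscale lam (Mc ((?t ^^ k) (d k)))"
      by (simp add: clinear_minus[OF clinear_tw_pow] clinear_scale[OF clinear_tw_pow] tw_pow_Mc)
    also have "cscale lam (Mc ((?t ^^ k) (d k))) = cscale ((- 1) ^ k) (cscale lam (Mc (d 0)))"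
      using Suc by (simp add: clinear_scale[OF clinear_Mc] mult.commute del: map_prod_simp)
    finally show ?case unfolding d0 by simp
  qed
  have n': "n - 1 < n" "n = Suc (n - 1)" using n by simp_all
  have dn: "(?t ^^ n) (d (n - 1)) = 0"
  proof -
    have "(?t ^^ n) (d (n - 1)) = ?t ((?t ^^ (n - 1)) (d (n - 1)))" by (subst n'(2)) simp
    also have "\<dots> = 0" unfolding d_pow[OF n'(1)] clinear_scale[OF clinear_tw] t0 by simp
    finally show ?thesis .
  qed
  have "LC (e 0) (d 0) = 2"
    using e_left[OF dH[of 0], of 0] n model_coords_unit(7,8)[of 0 0] model_linear(4)[of 0 "- 1"]
    by (simp add: d_def)
  then have "LC (e 0) ((?t ^^ (n - 1)) (d (n - 1))) \<noteq> 0" unfolding d_pow[OF n'(1)] LC_simps by simp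
  moreover have "(tw M lam ^^ n) (e 0) = 0" using e_pow[of n] by (simp add: e_def)
  ultimately show ?thesis by (intro pairedI[OF lam n eH dH[OF n'(1)] _ dn])
qed

lemma seif_uminus: "seif V L M \<Longrightarrow> seif V (\<lambda>a b. - L a b) M"
proof -
  assume "seif V L M"
  then interpret seif V L M .
  have "bilinear_form (\<lambda>a b. - L a b)"
    unfolding bilinear_form_def by (auto intro!: linearI simp: L_simps)
  then show ?thesis
    by (intro seif.intro fin lin_M M_in) (use nondeg_left nondeg_right M_form in \<open>simp_all\<close>)
qed

lemma frame_uminus:
  assumes "frame V L M p x" "nblocks q = nblocks p" "bsize q = bsize p" "bev q = bev p" "bdual q = bdual p"
    "bconj q = bconj p" "\<And>i. bform q i = - bform p i"
  shows "frame V (\<lambda>a b. - L a b) M q x"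
proof -
  have "form_cplx (\<lambda>a b. - L a b) u v = - form_cplx L u v" for u v
    by (simp add: form_cplx_def complex_eq_iff)
  then show ?thesis using assms unfolding frame_def by simp
qed

text \<open>Extract a frame from the model and restrict to its span. If the sign comes out wrong, take
  the negative of the form, which has the same monodromy.\<close>

lemma type_exists:
  assumes p: "admissible p"
  shows "\<exists>(V :: (nat \<Rightarrow>\<^sub>0 real) set) L. seifert_form_pair V L \<and> has_type V L p"
proof -
  define n lam where "n = bsize p" and "lam = bev p 0"
  have n: "n \<ge> 1" and lam: "lam \<noteq> 0" using block_data(1,2)[OF p] block_data(6)[OF p, of 0] by (simp_all add: n_def lam_def)
  obtain M where M: "seif (model_space n) (model_form n lam) M" using model_pair[OF lam] by blast
  let ?W = "model_space n" and ?Q = "model_form n lam"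
  interpret w: seif ?W ?Q M by (rule M)
  have pr: "w.paired n lam" by (rule model_paired[OF n lam M])
  have sub: "\<exists>Y. seif Y ?Q M \<and> frame Y ?Q M q x \<and> dim Y = nblocks q * bsize q" if q: "admissible q" "frame ?W ?Q M q x" for q x
  proof -
    obtain Y where "subspace Y" "Y \<subseteq> ?W" "\<And>y. y \<in> Y \<Longrightarrow> M y \<in> Y"
      "\<And>b. b \<in> Y \<Longrightarrow> (\<And>a. a \<in> Y \<Longrightarrow> ?Q a b = 0) \<Longrightarrow> b = 0" "frame Y ?Q M q x" "dim Y = nblocks q * bsize q"
      using w.frame_subpair[OF q] by metis
    then show ?thesis using w.seif_subspace by blast
  qed
  have pos: ?thesis if f: "frame ?W ?Q M p x" for x
  proof -
    obtain Y where Y: "seif Y ?Q M" "frame Y ?Q M p x" "dim Y = nblocks p * bsize p" using sub[OF p f] by blast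
    then show ?thesis using seif.seifert_form_pair seif.frame_imp_has_type[OF Y(1) p Y(2,3)] by blast
  qed
  have neg: ?thesis if q: "admissible q" "frame ?W ?Q M q x" and
    data: "nblocks p = nblocks q" "bsize p = bsize q" "bev p = bev q" "bdual p = bdual q"
      "bconj p = bconj q" "\<And>i. bform p i = - bform q i" for q x
  proof -
    obtain Y where Y: "seif Y ?Q M" "frame Y ?Q M q x" "dim Y = nblocks q * bsize q" using sub[OF q] by blast
    note s = seif_uminus[OF Y(1)]
    have "frame Y (\<lambda>a b. - ?Q a b) M p x" by (rule frame_uminus[OF Y(2) data])
    then show ?thesis using seif.seifert_form_pair[OF s] seif.frame_imp_has_type[OF s p] Y(3) data(1,2) by metis
  qed
  show ?thesis
  proof (cases p)
    case (Seif1 l m \<epsilon>)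
    have a: "m \<ge> 1" "\<epsilon> = 1 \<or> \<epsilon> = - 1" "l = 1 \<and> odd m \<or> l = - 1 \<and> even m" using p Seif1 by auto
    have nl: "n = m" "lam = of_real l" by (simp_all add: n_def lam_def Seif1)
    have "l * (- 1) ^ (m - 1) = 1" "l = 1 \<or> l = - 1" using a(1,3) by (cases m; auto)+
    then obtain \<epsilon>' x where x: "\<epsilon>' \<in> {1, - 1}" "frame ?W ?Q M (Seif1 l m \<epsilon>') x"
      using w.frame_Seif1[of m l] pr unfolding nl by blast
    show ?thesis
    proof (cases "\<epsilon>' = \<epsilon>")
      case True
      then show ?thesis using pos x(2) Seif1 by blast
    next
      case False
      then have e: "\<epsilon> = - \<epsilon>'" using a(2) x(1) by auto
      have "admissible (Seif1 l m \<epsilon>')" using a x(1) by auto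
      then show ?thesis by (rule neg[OF _ x(2)]) (auto simp: Seif1 e fun_eq_iff)
    qed
  next
    case (Seif2 l m)
    have a: "m \<ge> 1" "l = 1 \<and> even m \<or> l = - 1 \<and> odd m" using p Seif2 by auto
    have nl: "n = m" "lam = of_real l" by (simp_all add: n_def lam_def Seif2)
    have "l = 1 \<or> l = - 1" "l * (- 1) ^ (m - 1) = - 1" using a by (cases m; auto)+
    then show ?thesis using w.frame_Seif2_4(1)[of m l] pr pos unfolding nl Seif2 by blast
  next
    case (Seif3 l m \<zeta>)
    have a: "m \<ge> 1" "cmod l = 1" "l \<notin> {1, - 1}" "\<zeta>\<^sup>2 = cnj l * (- 1) ^ (m + 1)" using p Seif3 by auto
    have nl: "n = m" "lam = l" by (simp_all add: n_def lam_def Seif3)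
    obtain \<zeta>' x where x: "\<zeta>' \<in> {\<zeta>, - \<zeta>}" "frame ?W ?Q M (Seif3 l m \<zeta>') x"
      using w.frame_Seif3[OF _ a(2,4)] pr unfolding nl by blast
    show ?thesis
    proof (cases "\<zeta>' = \<zeta>")
      case True
      then show ?thesis using pos x(2) Seif3 by blast
    next
      case False
      then have e: "\<zeta>' = - \<zeta>" using x(1) by auto
      have "admissible (Seif3 l m \<zeta>')" by (rule admissible_Seif3[OF a(1-3)]) (simp add: e a(4))
      then show ?thesis by (rule neg[OF _ x(2)]) (auto simp: Seif3 e fun_eq_iff)
    qed
  next
    case (Seif4 l m)
    have nl: "n = m" "lam = of_real l" by (simp_all add: n_def lam_def Seif4)
    show ?thesis using w.frame_Seif2_4(2)[of m l] pr pos unfolding nl Seif4 by blast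
  next
    case (Seif5 l m)
    have nl: "n = m" "lam = l" by (simp_all add: n_def lam_def Seif5)
    show ?thesis using w.frame_Seif5[of m l] pr pos unfolding nl Seif5 by blast
  qed
qed


section \<open>The classification\<close>

lemma typed_pair_frame:
  assumes "admissible p" "seifert_form_pair V L0" "has_type V L0 p"
  obtains L M x where "seif V L M" "\<And>a b. a \<in> V \<Longrightarrow> b \<in> V \<Longrightarrow> L a b = L0 a b"
    "frame V L M p x" "dim V = nblocks p * bsize p"
proof -
  obtain L M where s: "seif V L M" and eq: "\<And>a b. a \<in> V \<Longrightarrow> b \<in> V \<Longrightarrow> L a b = L0 a b"
    using seif_extend[OF assms(2)] by metis
  have "has_type V L p" using seif.has_type_cong[OF s eq] assms(3) by blast
  from seif.has_type_imp_frame[OF s assms(1) this] show ?thesis using that s eq by blast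
qed

lemma isomorphic_pairs_cong:
  assumes "\<And>a b. a \<in> V \<Longrightarrow> b \<in> V \<Longrightarrow> L a b = L0 a b" "\<And>a b. a \<in> W \<Longrightarrow> b \<in> W \<Longrightarrow> K a b = K0 a b"
    and "isomorphic_pairs V L W K"
  shows "isomorphic_pairs V L0 W K0"
proof -
  obtain f where f: "lin_iso V W f" "\<forall>a\<in>V. \<forall>b\<in>V. K (f a) (f b) = L a b"
    using assms(3) by (auto simp: isomorphic_pairs_def)
  have "f a \<in> W" if "a \<in> V" for a using f(1) that unfolding lin_iso_def bij_betw_def by blast
  then have "\<forall>a\<in>V. \<forall>b\<in>V. K0 (f a) (f b) = L0 a b" using f(2) assms(1,2) by metis
  then show ?thesis using f(1) unfolding isomorphic_pairs_def by blast
qed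

text \<open>Exchange the two generators, which are conjugate to each other.\<close>

lemma frame_Seif3_conj:
  assumes "frame V L M (Seif3 (cnj lam) n (cnj \<zeta>)) x"
  shows "frame V L M (Seif3 lam n \<zeta>) (\<lambda>i. x (1 - i))"
  unfolding frame_def
proof (intro allI impI)
  fix i assume "i < nblocks (Seif3 lam n \<zeta>)"
  then have i: "i = 0 \<or> i = 1" by auto
  have f: "j < nblocks (Seif3 (cnj lam) n (cnj \<zeta>)) \<Longrightarrow> x j \<in> V \<times> V \<and>
     (tw M (bev (Seif3 (cnj lam) n (cnj \<zeta>)) j) ^^ n) (x j) = 0 \<and> x (1 - j) = cconj (x j) \<and>
     form_cplx L (x j) ((tw M (bev (Seif3 (cnj lam) n (cnj \<zeta>)) (1 - j)) ^^ (n - 1)) (x (1 - j)))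
       = bform (Seif3 (cnj lam) n (cnj \<zeta>)) j" for j
    using assms unfolding frame_def bconj.simps bdual.simps bsize.simps by blast
  show "x (1 - i) \<in> V \<times> V \<and> (tw M (bev (Seif3 lam n \<zeta>) i) ^^ bsize (Seif3 lam n \<zeta>)) (x (1 - i)) = 0 \<and>
      x (1 - bconj (Seif3 lam n \<zeta>) i) = cconj (x (1 - i)) \<and>
      form_cplx L (x (1 - i)) ((tw M (bev (Seif3 lam n \<zeta>) (bdual (Seif3 lam n \<zeta>) i)) ^^ (bsize (Seif3 lam n \<zeta>) - 1))
        (x (1 - bdual (Seif3 lam n \<zeta>) i))) = bform (Seif3 lam n \<zeta>) i"
    using i
  proof
    assume "i = 0"
    then show ?thesis using f[of 1] by (auto simp del: mem_Sigma_iff)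
  next
    assume "i = 1"
    then show ?thesis using f[of 0] by (auto simp del: mem_Sigma_iff)
  qed
qed

theorem theorem2p9:
  shows
    "(\<forall>p. admissible p \<longrightarrow>
        (\<exists>(V :: (nat \<Rightarrow>\<^sub>0 real) set) L. seifert_form_pair V L \<and> has_type V L p)) \<and>
     (\<forall>p (V :: 'a::real_vector set) L.
        admissible p \<and> seifert_form_pair V L \<and> has_type V L p \<longrightarrow> irreducible_pair V L) \<and>
     (\<forall>p (V :: 'a set) L (W :: 'b::real_vector set) K.
        admissible p \<and> seifert_form_pair V L \<and> has_type V L p \<and>
        seifert_form_pair W K \<and> has_type W K p \<longrightarrow> isomorphic_pairs V L W K) \<and>
     (\<forall>(V :: 'a set) L.
        seifert_form_pair V L \<and> irreducible_pair V L \<longrightarrow> (\<exists>p. admissible p \<and> has_type V L p)) \<and>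
     (\<forall>lam n \<zeta> (V :: 'a set) L (W :: 'b set) K.
        admissible (Seif3 lam n \<zeta>) \<and>
        seifert_form_pair V L \<and> has_type V L (Seif3 lam n \<zeta>) \<and>
        seifert_form_pair W K \<and> has_type W K (Seif3 (cnj lam) n (cnj \<zeta>)) \<longrightarrow>
        isomorphic_pairs V L W K)"
proof (intro conjI allI impI)
  fix p assume "admissible p"
  then show "\<exists>(V :: (nat \<Rightarrow>\<^sub>0 real) set) L. seifert_form_pair V L \<and> has_type V L p" by (rule type_exists)
next
  fix p and V :: "'a set" and L0
  assume *: "admissible p \<and> seifert_form_pair V L0 \<and> has_type V L0 p"
  then obtain L M x where s: "seif V L M" "\<And>a b. a \<in> V \<Longrightarrow> b \<in> V \<Longrightarrow> L a b = L0 a b"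
    and fr: "frame V L M p x" "dim V = nblocks p * bsize p"
    using typed_pair_frame by metis
  show "irreducible_pair V L0"
    using seif.frame_irreducible[OF s(1) _ fr] irreducible_pair_cong[OF s] * by blast
next
  fix p and V :: "'a set" and L0 and W :: "'b set" and K0
  assume *: "admissible p \<and> seifert_form_pair V L0 \<and> has_type V L0 p \<and> seifert_form_pair W K0 \<and> has_type W K0 p"
  obtain L M x where s: "seif V L M" "\<And>a b. a \<in> V \<Longrightarrow> b \<in> V \<Longrightarrow> L a b = L0 a b"
    and fx: "frame V L M p x" "dim V = nblocks p * bsize p"
    using typed_pair_frame[of p V L0] * by metis
  obtain K N y where t: "seif W K N" "\<And>a b. a \<in> W \<Longrightarrow> b \<in> W \<Longrightarrow> K a b = K0 a b"
    and fy: "frame W K N p y" "dim W = nblocks p * bsize p"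
    using typed_pair_frame[of p W K0] * by metis
  have iso: "isomorphic_pairs V L W K"
    by (rule frames_isomorphic[OF s(1) t(1) _ fx(1) fy(1) fx(2) fy(2)]) (use * in blast)
  show "isomorphic_pairs V L0 W K0" by (rule isomorphic_pairs_cong[OF s(2) t(2) iso])
next
  fix V :: "'a set" and L0
  assume *: "seifert_form_pair V L0 \<and> irreducible_pair V L0"
  obtain L M where s: "seif V L M" "\<And>a b. a \<in> V \<Longrightarrow> b \<in> V \<Longrightarrow> L a b = L0 a b"
    using seif_extend[of V L0] * by metis
  have "irreducible_pair V L" using irreducible_pair_cong[OF s] * by blast
  then obtain p where "admissible p" "has_type V L p" using seif.irreducible_has_type[OF s(1)] by blast
  then show "\<exists>p. admissible p \<and> has_type V L0 p" using seif.has_type_cong[OF s] by blast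
next
  fix lam n \<zeta> and V :: "'a set" and L0 and W :: "'b set" and K0
  assume *: "admissible (Seif3 lam n \<zeta>) \<and> seifert_form_pair V L0 \<and> has_type V L0 (Seif3 lam n \<zeta>) \<and>
        seifert_form_pair W K0 \<and> has_type W K0 (Seif3 (cnj lam) n (cnj \<zeta>))"
  then have a: "n \<ge> 1" "cmod lam = 1" "lam \<noteq> 1" "lam \<noteq> - 1" "\<zeta>\<^sup>2 = cnj lam * (- 1) ^ (n + 1)" by auto
  have "cnj lam \<notin> {1, - 1}" using a(3,4) by (metis complex_cnj_cnj complex_cnj_minus complex_cnj_one insert_iff empty_iff)
  moreover have "(cnj \<zeta>)\<^sup>2 = cnj (cnj lam) * (- 1) ^ (n + 1)"
    using arg_cong[OF a(5), of cnj] by simp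
  ultimately have p': "admissible (Seif3 (cnj lam) n (cnj \<zeta>))" using a(1,2) by (intro admissible_Seif3) simp_all
  obtain L M x where s: "seif V L M" "\<And>a b. a \<in> V \<Longrightarrow> b \<in> V \<Longrightarrow> L a b = L0 a b"
    and fx: "frame V L M (Seif3 lam n \<zeta>) x" "dim V = nblocks (Seif3 lam n \<zeta>) * bsize (Seif3 lam n \<zeta>)"
    using typed_pair_frame[of "Seif3 lam n \<zeta>" V L0] * by metis
  obtain K N y where t: "seif W K N" "\<And>a b. a \<in> W \<Longrightarrow> b \<in> W \<Longrightarrow> K a b = K0 a b"
    and fy: "frame W K N (Seif3 (cnj lam) n (cnj \<zeta>)) y"
      "dim W = nblocks (Seif3 (cnj lam) n (cnj \<zeta>)) * bsize (Seif3 (cnj lam) n (cnj \<zeta>))"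
    using typed_pair_frame[OF p', of W K0] * by metis
  have iso: "isomorphic_pairs V L W K"
    by (rule frames_isomorphic[OF s(1) t(1) _ fx(1) frame_Seif3_conj[OF fy(1)] fx(2)]) (use * fy(2) in simp_all)
  show "isomorphic_pairs V L0 W K0" by (rule isomorphic_pairs_cong[OF s(2) t(2) iso])
qed

end
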